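(* Let $L\ge 0$ be an integer and $\alpha>0$. Let $f:\mathbb Z\to\mathbb C$ be a bounded function with $f(n)=1$ for all $n<0$, let $g(\lambda)=\prod_{i=1}^\infty f(\lambda_i+L-i)$ for partitions $\lambda$, and write $\phi=f-1$. Then $$\mathbb E_{\mathrm{Plan}}^{\alpha}[g]=\sum_{k=0}^\infty\frac1{k!}\sum_{h\in\mathbb N^k}\ \prod_{j=1}^k\phi(h_j)\ \det\bigl[B^\alpha(h_i-L,h_j-L)\bigr]_{i,j=1}^k,$$ where $B^\alpha$ is the discrete Bessel kernel. That is, $\mathbb E_{\mathrm{Plan}}^{\alpha}[g]$ equals the Fredholm determinant $\det(I+T)$ of the operator $T$ on $\ell^2(\mathbb N)$ with kernel $B^\alpha(x-L,y-L)\phi(y)$, $x,y\in\mathbb N$.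
   Context: $\mathbb N=\{0,1,2,\dots\}$. A partition is a sequence $\lambda_1\ge\lambda_2\ge\dots$ in $\mathbb N$ with finite sum; $f^\lambda$ is the number of standard Young tableaux of shape $\lambda$. The Poissonized Plancherel measure with parameter $\alpha>0$ is the probability measure on the set of all partitions given by $\mathbb P_{\mathrm{Plan}}^\alpha[\{\lambda\}]=e^{-\alpha}\frac{\alpha^N}{N!}\frac{(f^\lambda)^2}{N!}$, $N=\sum_j\lambda_j$; $\mathbb E_{\mathrm{Plan}}^\alpha$ is the corresponding expectation. Let $J_\nu(t)$ denote the Bessel function of the first kind of order $\nu$. The discrete Bessel kernel is, for integers $x\ne y$, $$B^\alpha(x,y)=\sqrt\alpha\,\frac{J_x(2\sqrt\alpha)J_{y+1}(2\sqrt\alpha)-J_{x+1}(2\sqrt\alpha)J_y(2\sqrt\alpha)}{x-y},$$ and on the diagonal $$B^\alpha(x,x)=\sqrt\alpha\,\bigl[J^{\bullet}_x(2\sqrt\alpha)J_{x+1}(2\sqrt\alpha)-J_x(2\sqrt\alpha)J^{\bullet}_{x+1}(2\sqrt\alpha)\bigr],$$ where $J^{\bullet}_x(t)=\frac{\partial}{\partial x}J_x(t)$ is the derivative with respect to the order. The $k=0$ term of the series is $1$. *)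

theory Defs
  imports "HOL-Analysis.Analysis" "Jordan_Normal_Form.Determinant"
begin

section \<open>Partitions and the Poissonized Plancherel measure\<close>

text \<open>Sequences are indexed from 0: the part \<open>\<lambda>\<^sub>i\<close> (with \<open>i \<ge> 1\<close>) is \<open>p (i - 1)\<close>.\<close>

definition is_partition :: "(nat \<Rightarrow> nat) \<Rightarrow> bool" where
  "is_partition p \<longleftrightarrow> decseq p \<and> summable p"

definition psize :: "(nat \<Rightarrow> nat) \<Rightarrow> nat" where
  "psize p = (\<Sum>i. p i)"

definition young_diagram :: "(nat \<Rightarrow> nat) \<Rightarrow> (nat \<times> nat) set" where
  "young_diagram p = {(i, j). j < p i}"

text \<open>Tableaux are made extensional (a fixed dummy value outside the diagram), so that distinct
  functions are distinct fillings of the diagram.\<close>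

definition standard_tableaux :: "(nat \<Rightarrow> nat) \<Rightarrow> (nat \<times> nat \<Rightarrow> nat) set" where
  "standard_tableaux p =
    {T \<in> extensional (young_diagram p).
       bij_betw T (young_diagram p) {1..psize p} \<and>
       (\<forall>i j j'. (i, j) \<in> young_diagram p \<longrightarrow> (i, j') \<in> young_diagram p \<longrightarrow> j < j' \<longrightarrow> T (i, j) < T (i, j')) \<and>
       (\<forall>i i' j. (i, j) \<in> young_diagram p \<longrightarrow> (i', j) \<in> young_diagram p \<longrightarrow> i < i' \<longrightarrow> T (i, j) < T (i', j))}"

definition num_syt :: "(nat \<Rightarrow> nat) \<Rightarrow> nat" where
  "num_syt p = card (standard_tableaux p)"

definition plancherel_weight :: "real \<Rightarrow> (nat \<Rightarrow> nat) \<Rightarrow> real" where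
  "plancherel_weight \<alpha> p =
     exp (- \<alpha>) * (\<alpha> ^ psize p / fact (psize p)) * ((real (num_syt p))\<^sup>2 / fact (psize p))"

definition poissonized_plancherel :: "real \<Rightarrow> (nat \<Rightarrow> nat) measure" where
  "poissonized_plancherel \<alpha> =
     point_measure {p. is_partition p} (\<lambda>p. ennreal (plancherel_weight \<alpha> p))"

section \<open>Bessel functions and the discrete Bessel kernel\<close>

text \<open>The order \<open>\<nu>\<close> is an arbitrary real number. The function \<open>rGamma\<close> is the entire function
  \<open>1 / \<Gamma>\<close>, which vanishes at the poles of \<open>\<Gamma>\<close>; the power series therefore also covers negative
  integer orders. Because of the real power the argument \<open>t\<close> must be positive.\<close>

definition Bessel_J :: "real \<Rightarrow> real \<Rightarrow> real" where
  "Bessel_J \<nu> t =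
     (\<Sum>m. (- 1) ^ m / fact m * rGamma (real m + \<nu> + 1) * (t / 2) powr (2 * real m + \<nu>))"

definition Bessel_J_order_deriv :: "real \<Rightarrow> real \<Rightarrow> real" where
  "Bessel_J_order_deriv x t = deriv (\<lambda>\<nu>. Bessel_J \<nu> t) x"

definition discrete_Bessel_kernel :: "real \<Rightarrow> int \<Rightarrow> int \<Rightarrow> real" where
  "discrete_Bessel_kernel \<alpha> x y =
    (let t = 2 * sqrt \<alpha>; u = real_of_int x; v = real_of_int y in
     if x \<noteq> y
     then sqrt \<alpha> * (Bessel_J u t * Bessel_J (v + 1) t - Bessel_J (u + 1) t * Bessel_J v t) / (u - v)
     else sqrt \<alpha> * (Bessel_J_order_deriv u t * Bessel_J (u + 1) t
                    - Bessel_J u t * Bessel_J_order_deriv (u + 1) t))"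

section \<open>Fredholm determinants on \<open>\<ell>\<^sup>2(\<nat>)\<close>\<close>

definition ell2 :: "(nat \<Rightarrow> complex) set" where
  "ell2 = {u. summable (\<lambda>n. (cmod (u n))\<^sup>2)}"

definition ell2_norm :: "(nat \<Rightarrow> complex) \<Rightarrow> real" where
  "ell2_norm u = sqrt (\<Sum>n. (cmod (u n))\<^sup>2)"

definition kernel_operator ::
  "(nat \<Rightarrow> nat \<Rightarrow> complex) \<Rightarrow> (nat \<Rightarrow> complex) \<Rightarrow> nat \<Rightarrow> complex" where
  "kernel_operator K u x = (\<Sum>\<^sub>\<infinity>y. K x y * u y)"

text \<open>The kernel defines a bounded operator on \<open>\<ell>\<^sup>2(\<nat>)\<close>. Linearity is automatic from the
  convergence of the sums.\<close>

definition bounded_ell2_kernel :: "(nat \<Rightarrow> nat \<Rightarrow> complex) \<Rightarrow> bool" where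
  "bounded_ell2_kernel K \<longleftrightarrow>
     (\<forall>u\<in>ell2. \<forall>x. (\<lambda>y. K x y * u y) summable_on UNIV) \<and>
     (\<exists>C. \<forall>u\<in>ell2. kernel_operator K u \<in> ell2 \<and> ell2_norm (kernel_operator K u) \<le> C * ell2_norm u)"

definition unit_seq :: "nat \<Rightarrow> nat \<Rightarrow> complex" where
  "unit_seq n = (\<lambda>x. if x = n then 1 else 0)"

text \<open>\<open>\<nat>\<^sup>k\<close>, as extensional functions on \<open>{0, \<dots>, k - 1}\<close>; a single element for \<open>k = 0\<close>.\<close>

abbreviation nat_tuples :: "nat \<Rightarrow> (nat \<Rightarrow> nat) set" where
  "nat_tuples k \<equiv> {..<k} \<rightarrow>\<^sub>E UNIV"

text \<open>\<open>det(I + A) = \<Sum>\<^sub>k tr(\<Lambda>\<^sup>k A)\<close>, with the traces expanded in the standard basis, so that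
  \<open>tr(\<Lambda>\<^sup>k A) = 1/k! \<Sum>\<^sub>h det(\<langle>e\<^bsub>h i\<^esub>, A e\<^bsub>h j\<^esub>\<rangle>)\<close>. The value is only
  meaningful if all the sums converge.\<close>

definition fredholm_det :: "((nat \<Rightarrow> complex) \<Rightarrow> nat \<Rightarrow> complex) \<Rightarrow> complex" where
  "fredholm_det A =
     (\<Sum>k. 1 / fact k * (\<Sum>\<^sub>\<infinity>h\<in>nat_tuples k.
        Determinant.det (Matrix.mat k k (\<lambda>(i, j). A (unit_seq (h j)) (h i)))))"

end

theory Submission
  imports Defs
begin

text \<open>
  By the determinantal formula \<open>f\<^sup>\<lambda> / N! = det [1 / (\<lambda>\<^sub>i - i + j)!]\<close>, the Plancherel weight of a
  partition with at most \<open>n\<close> parts is the square of an \<open>n \<times> n\<close> determinant in the positions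
  \<open>\<lambda>\<^sub>i - i\<close>. A unipotent column operation turns its entries into truncations of the Bessel
  functions \<open>J\<^bsub>x + j\<^esub>(2\<surd>\<alpha>)\<close>, which are orthonormal in \<open>\<ell>\<^sup>2(\<int>)\<close>. The Cauchy-Binet formula therefore
  expresses the expectation of \<open>2\<^bsup>|H \<inter> S|\<^esup>\<close>, where \<open>S\<close> is the set of positions and \<open>H\<close> is finite, as
  \<open>det G\<^sub>n \<cdot> det (I + K\<^sub>n)\<^sub>H\<close>. Here the Gram matrix \<open>G\<^sub>n\<close> is the identity plus a positive semidefinite
  matrix that is concentrated near the last index, so \<open>K\<^sub>n\<close> tends to
  \<open>\<Sum>\<^sub>j J\<^bsub>x + j\<^esub> J\<^bsub>y + j\<^esub>\<close> as \<open>n\<close> tends to infinity. This sum telescopes to the discrete Bessel kernel.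
  The factor \<open>det G\<^sub>n\<close> tends to \<open>exp \<alpha>\<close> because the weights add up to 1, that is,
  \<open>\<Sum> (f\<^sup>\<lambda>)\<^sup>2 = N!\<close>. Comparing the expansions over the subsets of \<open>H\<close> gives the correlation functions.
  Expanding \<open>g = \<Prod> (1 + \<phi>)\<close> over finite sets of occupied positions gives the theorem; all sums
  converge absolutely because the number of occupied positions is at most \<open>N + L\<close>.
\<close>

section \<open>Determinants over finite index sets\<close>

text \<open>Working with at most \<open>n\<close> parts keeps every determinant finite, at the price
  that the truncated functions are no longer orthonormal. Cutting column \<open>j\<close> after
  \<open>n - j\<close> terms preserves the determinant and confines the support to
  \<open>x >= -n\<close>, so that Cauchy-Binet runs over exactly the partitions with at most
  \<open>n\<close> parts. It also leaves the truncations biorthogonal to the full Bessel functions,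
  which is why \<open>G_n - I\<close> is the Gram matrix of the remainders. Neither the inverse nor
  the determinant of \<open>G_n\<close> is ever evaluated: \<open>G_n >= I\<close> bounds the
  solutions of the linear systems uniformly in \<open>n\<close>, and empty \<open>H\<close> supplies
  the normalisation. The statistic with base 2 is chosen because its product weight is 1 plus the
  indicator of \<open>H\<close>. The weighted Gram matrix is then \<open>G_n\<close> plus one
  rank-one term per point of \<open>H\<close>, and the power of 2 counts the subsets of
  \<open>H\<close> inside \<open>S\<close>, in parallel with the principal minors in the expansion
  of \<open>det (I + K)\<close>. Boundedness of the operator comes from probability: nonnegativity
  of the two-point function gives \<open>B(x,y)^2 <= B(x,x) B(y,y)\<close>, and the trace is
  finite.\<close>

definition det_on :: "'i set \<Rightarrow> ('i \<Rightarrow> 'i \<Rightarrow> 'a) \<Rightarrow> 'a :: comm_ring_1" where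
  "det_on S A = (\<Sum>p | p permutes S. of_int (sign p) * (\<Prod>i\<in>S. A i (p i)))"

lemma det_mat_eq_det_on:
  "Determinant.det (Matrix.mat n n (\<lambda>(i, j). A i j)) = det_on {..<n} A"
proof -
  have "(\<Prod>i = 0..<n. Matrix.mat n n (\<lambda>(i, j). A i j) $$ (i, p i)) = (\<Prod>i = 0..<n. A i (p i))"
    if "p permutes {0..<n}" for p
    by (rule prod.cong[OF refl], subst index_mat(1)) (use permutes_in_image[OF that] in auto)
  then show ?thesis
    unfolding det_def'[OF mat_carrier] det_on_def lessThan_atLeast0 by (intro sum.cong[OF refl]) simp
qed

lemma det_on_cong:
  assumes "\<And>i j. i \<in> S \<Longrightarrow> j \<in> S \<Longrightarrow> A i j = B i j"
  shows "det_on S A = det_on S B"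
proof -
  have "(\<Prod>i\<in>S. A i (p i)) = (\<Prod>i\<in>S. B i (p i))" if "p permutes S" for p
    using permutes_in_image[OF that] assms by (intro prod.cong) auto
  then show ?thesis
    unfolding det_on_def by (intro sum.cong) auto
qed

lemma det_on_empty [simp]: "det_on {} A = 1" by (simp add: det_on_def)

lemma det_on_singleton [simp]: "det_on {a} A = A a a" by (simp add: det_on_def permutes_sing)

lemma det_on_pair:
  assumes "a \<noteq> b"
  shows "det_on {a, b} A = A a a * A b b - A a b * A b a"
proof -
  have "{p. p permutes {a, b}} = {id, Transposition.transpose a b}"
    using permutes_doubleton_iff[of _ a b] by auto
  moreover have "id \<noteq> Transposition.transpose a b"
    using assms by (metis id_apply transpose_apply_first)
  ultimately show ?thesis
    using assms by (simp add: det_on_def sign_swap_id)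
qed

lemma det_on_transpose:
  assumes "finite S"
  shows "det_on S (\<lambda>i j. A j i) = det_on S A"
proof -
  have "(\<Prod>i\<in>S. A (Hilbert_Choice.inv p i) i) = (\<Prod>i\<in>S. A i (p i))" if "p permutes S" for p
    using that by (subst prod.permute[OF that]) (auto simp: o_def permutes_inverses)
  moreover have "sign (Hilbert_Choice.inv p) = sign p" if "p permutes S" for p
    using that assms by (intro sign_inverse permutes_imp_permutation)
  ultimately show ?thesis
    unfolding det_on_def by (subst sum_permutations_inverse) (auto intro!: sum.cong)
qed

lemma det_on_reindex:
  assumes f: "bij_betw f S T" and "finite S"
  shows "det_on S (\<lambda>i j. A (f i) (f j)) = det_on T A"
proof -
  let ?m = "map_permutation S f"
  have inj: "inj_on f S" and T: "T = f ` S"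
    using f by (auto simp: bij_betw_def)
  have "det_on T A = (\<Sum>p | p permutes S. of_int (sign (?m p)) * (\<Prod>i\<in>T. A i (?m p i)))"
    unfolding det_on_def
  proof (rule sum.reindex_bij_witness[of _ ?m "map_permutation T (inv_into S f)"])
    fix p assume p: "p \<in> {p. p permutes T}"
    have g: "bij_betw (inv_into S f) T S" by (rule bij_betw_inv_into[OF f])
    show "?m (map_permutation T (inv_into S f) p) = p"
      by (rule map_permutation_compose_inv[OF g]) (use p f in \<open>auto simp: bij_betw_inv_into_right\<close>)
    then show "of_int (sign (?m (map_permutation T (inv_into S f) p))) *
        (\<Prod>i\<in>T. A i (?m (map_permutation T (inv_into S f) p) i)) = of_int (sign p) * (\<Prod>i\<in>T. A i (p i))"
      by (simp only:)
    show "map_permutation T (inv_into S f) p \<in> {p. p permutes S}"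
      using map_permutation_permutes[OF g] p by auto
  next
    fix p assume p: "p \<in> {p. p permutes S}"
    show "map_permutation T (inv_into S f) (?m p) = p"
      by (rule map_permutation_compose_inv[OF f]) (use p f in \<open>auto simp: bij_betw_inv_into_left\<close>)
    show "?m p \<in> {p. p permutes T}"
      using map_permutation_permutes[OF f] p by auto
  qed
  also have "\<dots> = det_on S (\<lambda>i j. A (f i) (f j))"
    unfolding det_on_def
  proof (rule sum.cong[OF refl])
    fix p assume p: "p \<in> {p. p permutes S}"
    have "sign (?m p) = sign p"
      using p inj assms(2) by (subst sign_map_permutation) auto
    moreover have "(\<Prod>i\<in>T. A i (?m p i)) = (\<Prod>i\<in>S. A (f i) (f (p i)))"
      unfolding T using inj by (subst prod.reindex) (auto simp: map_permutation_apply)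
    ultimately show "of_int (sign (?m p)) * (\<Prod>i\<in>T. A i (?m p i)) = of_int (sign p) * (\<Prod>i\<in>S. A (f i) (f (p i)))"
      by simp
  qed
  finally show ?thesis ..
qed

text \<open>In the product for a permutation \<open>p\<close>, let \<open>T\<close> be the set of
  factors taken from \<open>A\<close>. The Kronecker factors outside \<open>T\<close> vanish unless
  \<open>p\<close> fixes every point there, that is, unless \<open>p\<close> permutes
  \<open>T\<close>. Permutations are functions on the whole type, so \<open>p\<close> and its sign
  are the same for \<open>S\<close> and for \<open>T\<close>.\<close>

lemma det_on_one_plus:
  assumes "finite S"
  shows "det_on S (\<lambda>i j. (if i = j then 1 else 0) + A i j) = (\<Sum>T\<in>Pow S. det_on T A)"
proof -
  have *: "(\<Prod>i\<in>S. (if i = p i then 1 else 0) + A i (p i)) =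
      (\<Sum>T\<in>Pow S. if p permutes T then \<Prod>i\<in>T. A i (p i) else 0)" if p: "p permutes S" for p
  proof -
    have "(\<Prod>i\<in>S. (if i = p i then 1 else 0) + A i (p i)) = (\<Prod>i\<in>S. A i (p i) + (if i = p i then 1 else 0))"
      by (simp add: add.commute)
    also have "\<dots> = (\<Sum>T\<in>Pow S. (\<Prod>i\<in>T. A i (p i)) * (\<Prod>i\<in>S - T. if i = p i then 1 else 0))"
      by (rule prod_add[OF assms])
    also have "\<dots> = (\<Sum>T\<in>Pow S. if p permutes T then \<Prod>i\<in>T. A i (p i) else 0)"
    proof (intro sum.cong refl)
      fix T assume T: "T \<in> Pow S"
      have fin: "finite (S - T)" using assms by auto
      show "(\<Prod>i\<in>T. A i (p i)) * (\<Prod>i\<in>S - T. if i = p i then 1 else 0) =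
          (if p permutes T then \<Prod>i\<in>T. A i (p i) else 0)"
      proof (cases "p permutes T")
        case True
        then have "(\<Prod>i\<in>S - T. if i = p i then 1 else 0 :: 'b) = 1"
          by (intro prod.neutral) (auto simp: permutes_def)
        then show ?thesis using True by simp
      next
        case False
        then obtain i where "i \<in> S - T" "p i \<noteq> i"
          using permutes_superset[OF p, of T] by metis
        then have "(\<Prod>i\<in>S - T. if i = p i then 1 else 0 :: 'b) = 0"
          using fin by (intro prod_zero) force+
        then show ?thesis using False by simp
      qed
    qed
    finally show ?thesis .
  qed
  have "det_on S (\<lambda>i j. (if i = j then 1 else 0) + A i j) =
      (\<Sum>p | p permutes S. \<Sum>T\<in>Pow S. if p permutes T then of_int (sign p) * (\<Prod>i\<in>T. A i (p i)) else 0)"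
    unfolding det_on_def by (intro sum.cong refl) (auto simp: * sum_distrib_left intro!: sum.cong)
  also have "\<dots> = (\<Sum>T\<in>Pow S. \<Sum>p | p permutes S. if p permutes T then of_int (sign p) * (\<Prod>i\<in>T. A i (p i)) else 0)"
    by (rule sum.swap)
  also have "\<dots> = (\<Sum>T\<in>Pow S. det_on T A)"
    unfolding det_on_def
  proof (rule sum.cong[OF refl])
    fix T assume T: "T \<in> Pow S"
    show "(\<Sum>p | p permutes S. if p permutes T then of_int (sign p) * (\<Prod>i\<in>T. A i (p i)) else 0) =
       (\<Sum>p | p permutes T. of_int (sign p) * (\<Prod>i\<in>T. A i (p i)))"
      using T assms by (intro sum.mono_neutral_cong_right) (auto simp: finite_permutations intro: permutes_subset)
  qed
  finally show ?thesis .
qed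

lemma prod_if_eq:
  assumes "finite S" "i \<in> S"
  shows "(\<Prod>k\<in>S. if k = i then f k else g k) = f i * (\<Prod>k\<in>S - {i}. g k)"
proof -
  have "(\<Prod>k\<in>S. if k = i then f k else g k) = f i * (\<Prod>k\<in>S - {i}. if k = i then f k else g k)"
    using assms by (subst prod.remove[of _ i]) auto
  also have "(\<Prod>k\<in>S - {i}. if k = i then f k else g k) = (\<Prod>k\<in>S - {i}. g k)"
    by (intro prod.cong) auto
  finally show ?thesis .
qed

text \<open>The Leibniz term of \<open>p\<close> picks up the factor \<open>u i + v (p i)\<close>.
  Its sum over \<open>i\<close> does not depend on \<open>p\<close>, because \<open>p\<close> only
  rearranges the values of \<open>v\<close>.\<close>

lemma det_on_row_weights_sum:
  assumes "finite S"
  shows "(\<Sum>i\<in>S. det_on S (\<lambda>k l. if k = i then (u k + v l) * A k l else A k l)) =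
    (sum u S + sum v S) * det_on S A"
proof -
  have "(\<Sum>i\<in>S. det_on S (\<lambda>k l. if k = i then (u k + v l) * A k l else A k l)) =
     (\<Sum>p | p permutes S. \<Sum>i\<in>S. of_int (sign p) * (\<Prod>k\<in>S. if k = i then (u k + v (p k)) * A k (p k) else A k (p k)))"
    unfolding det_on_def by (rule sum.swap)
  also have "\<dots> = (\<Sum>p | p permutes S. (sum u S + sum v S) * (of_int (sign p) * (\<Prod>k\<in>S. A k (p k))))"
  proof (intro sum.cong refl)
    fix p assume p: "p \<in> {p. p permutes S}"
    have "(\<Sum>i\<in>S. of_int (sign p) * (\<Prod>k\<in>S. if k = i then (u k + v (p k)) * A k (p k) else A k (p k))) =
        (\<Sum>i\<in>S. (u i + v (p i)) * (of_int (sign p) * (\<Prod>k\<in>S. A k (p k))))"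
      using assms by (intro sum.cong refl) (simp add: prod_if_eq prod.remove mult_ac)
    also have "\<dots> = (sum u S + sum v S) * (of_int (sign p) * (\<Prod>k\<in>S. A k (p k)))"
      using sum.permute[of p S v] p by (simp add: sum_distrib_right[symmetric] sum.distrib o_def)
    finally show "(\<Sum>i\<in>S. of_int (sign p) * (\<Prod>k\<in>S. if k = i then (u k + v (p k)) * A k (p k) else A k (p k))) = \<dots>" .
  qed
  finally show ?thesis by (simp add: det_on_def sum_distrib_left)
qed

text \<open>Both sides add up the Leibniz terms in which one of the chosen entries
  \<open>(i, p i)\<close> is taken from \<open>C\<close>; that entry can be labelled by its row or
  by its column.\<close>

lemma det_on_sum_replace_rows_eq_cols:
  assumes "finite S"
  shows "(\<Sum>i\<in>S. det_on S (\<lambda>k l. if k = i then C k l else A k l)) =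
    (\<Sum>j\<in>S. det_on S (\<lambda>k l. if l = j then C k l else A k l))"
proof -
  have "(\<Sum>i\<in>S. det_on S (\<lambda>k l. if k = i then C k l else A k l)) =
     (\<Sum>p | p permutes S. \<Sum>i\<in>S. of_int (sign p) * (\<Prod>k\<in>S. if k = i then C k (p k) else A k (p k)))"
    unfolding det_on_def by (rule sum.swap)
  also have "\<dots> = (\<Sum>p | p permutes S. \<Sum>j\<in>S. of_int (sign p) * (\<Prod>k\<in>S. if p k = j then C k (p k) else A k (p k)))"
  proof (rule sum.cong[OF refl])
    fix p assume p: "p \<in> {p. p permutes S}"
    then have "inj p" by (auto simp: permutes_inj)
    then show "(\<Sum>i\<in>S. of_int (sign p) * (\<Prod>k\<in>S. if k = i then C k (p k) else A k (p k))) =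
       (\<Sum>j\<in>S. of_int (sign p) * (\<Prod>k\<in>S. if p k = j then C k (p k) else A k (p k)))"
      using sum.permute[of p S "\<lambda>j. of_int (sign p) * (\<Prod>k\<in>S. if p k = j then C k (p k) else A k (p k))"] p
      by (simp add: o_def inj_eq)
  qed
  also have "\<dots> = (\<Sum>j\<in>S. det_on S (\<lambda>k l. if l = j then C k l else A k l))"
    unfolding det_on_def by (rule sum.swap)
  finally show ?thesis .
qed

lemma det_on_zero_row:
  assumes "finite S" "i \<in> S" "\<And>j. j \<in> S \<Longrightarrow> A i j = 0"
  shows "det_on S A = 0"
  unfolding det_on_def
proof (intro sum.neutral ballI)
  fix p assume p: "p \<in> {p. p permutes S}"
  have "(\<Prod>i\<in>S. A i (p i)) = 0"
    using assms p by (intro prod_zero bexI[of _ i]) (auto simp: permutes_in_image)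
  then show "of_int (sign p) * (\<Prod>i\<in>S. A i (p i)) = 0" by simp
qed

lemma det_on_identical_rows:
  fixes n :: nat
  assumes "i \<noteq> j" "i < n" "j < n" "\<And>k. k < n \<Longrightarrow> A i k = A j k"
  shows "det_on {..<n} A = 0"
  unfolding det_mat_eq_det_on[symmetric]
proof (rule det_identical_rows[OF _ assms(1-3)])
  show "Matrix.row (Matrix.mat n n (\<lambda>(i, j). A i j)) i = Matrix.row (Matrix.mat n n (\<lambda>(i, j). A i j)) j"
    using assms by (intro eq_vecI) auto
qed auto

lemma det_on_identical_cols:
  fixes n :: nat
  assumes "i \<noteq> j" "i < n" "j < n" "\<And>k. k < n \<Longrightarrow> A k i = A k j"
  shows "det_on {..<n} A = 0"
  using det_on_identical_rows[of i j n "\<lambda>i j. A j i"] assms det_on_transpose[of "{..<n}" A] by simp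

lemma det_on_mult:
  fixes n :: nat
  shows   "det_on {..<n} (\<lambda>i j. \<Sum>k<n. A i k * B k j) = det_on {..<n} A * det_on {..<n} B"
proof -
  let ?M = "\<lambda>A. Matrix.mat n n (\<lambda>(i, j). A i j)"
  have "?M (\<lambda>i j. \<Sum>k<n. A i k * B k j) = ?M A * ?M B"
    by (rule eq_matI) (auto simp: scalar_prod_def lessThan_atLeast0)
  then show ?thesis
    unfolding det_mat_eq_det_on[symmetric] by (simp add: Determinant.det_mult[of _ n])
qed

lemma det_on_permute_rows:
  fixes n :: nat
  assumes "p permutes {..<n}"
  shows "det_on {..<n} (\<lambda>i j. A (p i) j) = of_int (sign p) * det_on {..<n} A"
proof -
  have "Matrix.mat n n (\<lambda>(i, j). Matrix.mat n n (\<lambda>(i, j). A i j) $$ (p i, j)) = Matrix.mat n n (\<lambda>(i, j). A (p i) j)"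
    by (rule eq_matI) (use permutes_in_image[OF assms] in auto)
  then show ?thesis
  using det_permute_rows[of "Matrix.mat n n (\<lambda>(i, j). A i j)" n p] assms
  unfolding det_mat_eq_det_on[symmetric] by (simp add: lessThan_atLeast0)
qed

lemma det_on_upper_triangular:
  fixes n :: nat
  assumes "\<And>i j. j < i \<Longrightarrow> i < n \<Longrightarrow> A i j = 0"
  shows "det_on {..<n} A = (\<Prod>i<n. A i i)"
proof -
  have "upper_triangular (Matrix.mat n n (\<lambda>(i, j). A i j))"
    using assms by (auto simp: upper_triangular_def)
  from det_upper_triangular[OF this, of n] show ?thesis
    unfolding det_mat_eq_det_on[symmetric] by (simp add: prod_list_diag_prod lessThan_atLeast0)
qed

lemma det_on_mult_left:
  "det_on S (\<lambda>i j. c i * A i j) = prod c S * det_on S A"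
  unfolding det_on_def prod.distrib sum_distrib_left by (rule sum.cong) (simp_all only: mult.left_commute)

lemma det_on_mult_right:
  "det_on S (\<lambda>i j. A i j * c j) = prod c S * det_on S A"
proof -
  have "(\<Prod>i\<in>S. A i (p i) * c (p i)) = prod c S * (\<Prod>i\<in>S. A i (p i))" if "p permutes S" for p
    using prod.permute[OF that, of c] by (simp add: prod.distrib o_def)
  then show ?thesis
    unfolding det_on_def sum_distrib_left by (intro sum.cong refl) (simp add: mult.left_commute)
qed

section \<open>The Cauchy-Binet formula and low-rank perturbations\<close>

lemma has_sum_finite_sum:
  fixes f :: "'i \<Rightarrow> 'x \<Rightarrow> 'a :: topological_comm_monoid_add"
  assumes "finite I" "\<And>i. i \<in> I \<Longrightarrow> (f i has_sum s i) A"
  shows "((\<lambda>x. \<Sum>i\<in>I. f i x) has_sum (\<Sum>i\<in>I. s i)) A"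
  using assms by (induction I rule: finite_induct) (auto intro!: has_sum_add)

lemma abs_summable_on_PiE_prod:
  fixes f :: "'i \<Rightarrow> 'x \<Rightarrow> real"
  assumes "finite I" "countable M" "\<And>i. i \<in> I \<Longrightarrow> (\<lambda>y. norm (f i y)) summable_on M"
  shows "(\<lambda>x. norm (\<Prod>i\<in>I. f i (x i))) summable_on (I \<rightarrow>\<^sub>E M)"
  using assms unfolding abs_summable_equivalent
  by (intro Infinite_Set_Sum.abs_summable_on_prod_PiE) auto

lemma has_sum_PiE_prod:
  fixes f :: "'i \<Rightarrow> 'x \<Rightarrow> real"
  assumes "finite I" "countable M" "\<And>i. i \<in> I \<Longrightarrow> (\<lambda>y. norm (f i y)) summable_on M"
  shows "((\<lambda>x. \<Prod>i\<in>I. f i (x i)) has_sum (\<Prod>i\<in>I. \<Sum>\<^sub>\<infinity>y\<in>M. f i y)) (I \<rightarrow>\<^sub>E M)"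
proof -
  have "(\<lambda>x. \<Prod>i\<in>I. f i (x i)) summable_on (I \<rightarrow>\<^sub>E M)"
    using abs_summable_on_PiE_prod[OF assms] by (rule abs_summable_summable)
  moreover have "(\<Sum>\<^sub>\<infinity>x\<in>I \<rightarrow>\<^sub>E M. \<Prod>i\<in>I. f i (x i)) = (\<Prod>i\<in>I. \<Sum>\<^sub>\<infinity>y\<in>M. f i y)"
    by (rule infsum_prod_PiE_abs) (use assms in auto)
  ultimately show ?thesis by (simp add: has_sum_iff)
qed

text \<open>The discrete Andreief identity. After Leibniz expansion each term is a product over the
  coordinates, which can be summed coordinate by coordinate. The first factor is a plain product
  instead of a second determinant, so no \<open>n!\<close> appears.\<close>

lemma andreief:
  fixes c a :: "nat \<Rightarrow> 'x \<Rightarrow> real"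
  assumes "countable M" "\<And>i j. i < n \<Longrightarrow> j < n \<Longrightarrow> (\<lambda>x. norm (c i x * a j x)) summable_on M"
  shows "((\<lambda>x. (\<Prod>i<n. c i (x i)) * det_on {..<n} (\<lambda>i j. a j (x i)))
    has_sum det_on {..<n} (\<lambda>i j. \<Sum>\<^sub>\<infinity>x\<in>M. c i x * a j x)) ({..<n} \<rightarrow>\<^sub>E M)"
proof -
  have "((\<lambda>x. \<Sum>p | p permutes {..<n}. of_int (sign p) * (\<Prod>i<n. c i (x i) * a (p i) (x i)))
     has_sum (\<Sum>p | p permutes {..<n}. of_int (sign p) * (\<Prod>i<n. \<Sum>\<^sub>\<infinity>x\<in>M. c i x * a (p i) x))) ({..<n} \<rightarrow>\<^sub>E M)"
  proof (intro has_sum_finite_sum has_sum_cmult_right has_sum_PiE_prod assms)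
    fix p i assume "p \<in> {p. p permutes {..<n}}" "i \<in> {..<n}"
    then show "i < n" "p i < n"
      using permutes_in_image[of p "{..<n}" i] by auto
  qed (auto simp: finite_permutations)
  then show ?thesis by (simp add: det_on_def prod.distrib sum_distrib_left mult.left_commute)
qed

text \<open>Sylvester's identity. The matrix \<open>M\<close> with blocks \<open>I, -X, C, I\<close>
  factors as \<open>M1 * L\<close> and as \<open>L * M2\<close> with \<open>det L = 1\<close>, and
  \<open>M1\<close>, \<open>M2\<close> are block triangular with the two determinants in
  question.\<close>

lemma det_one_plus_mult_commute:
  fixes X C :: "nat \<Rightarrow> nat \<Rightarrow> real"
  shows "det_on {..<n} (\<lambda>i j. (if i = j then 1 else 0) + (\<Sum>h<k. X i h * C h j)) =
    det_on {..<k} (\<lambda>g h. (if g = h then 1 else 0) + (\<Sum>i<n. C g i * X i h))"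
proof -
  let ?X = "Matrix.mat n k (\<lambda>(i, h). X i h)" and ?C = "Matrix.mat k n (\<lambda>(h, j). C h j)"
  let ?I = "\<lambda>n. 1\<^sub>m n :: real mat"
  have c: "?X \<in> carrier_mat n k" "?C \<in> carrier_mat k n" by auto
  define L where "L = four_block_mat (?I n) (0\<^sub>m n k) (?C) (?I k)"
  define M where "M = four_block_mat (?I n) (- ?X) (?C) (?I k)"
  define M1 where "M1 = four_block_mat (?I n + ?X * ?C) (- ?X) (0\<^sub>m k n) (?I k)"
  define M2 where "M2 = four_block_mat (?I n) (- ?X) (0\<^sub>m k n) (?I k + ?C * ?X)"
  have L: "L \<in> carrier_mat (n + k) (n + k)" and M1: "M1 \<in> carrier_mat (n + k) (n + k)" and M2: "M2 \<in> carrier_mat (n + k) (n + k)"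
    by (auto simp: L_def M1_def M2_def)
  have "M1 * L = M"
    unfolding M1_def L_def M_def
    by (subst mult_four_block_mat[of _ n n _ k _ k _ _ n _ k]) (auto intro!: cong_four_block_mat simp: minus_add_uminus_mat)
  have "L * M2 = M"
    unfolding M2_def L_def M_def
    by (subst mult_four_block_mat[of _ n n _ k _ k _ _ n _ k]) (auto intro!: cong_four_block_mat)
  have "Determinant.det L = 1"
    unfolding L_def by (subst det_four_block_mat_upper_right_zero[of _ n _ k]) auto
  have "Determinant.det M1 = Determinant.det (?I n + ?X * ?C)"
    unfolding M1_def by (subst det_four_block_mat_lower_left_zero[of _ n _ k]) auto
  have "Determinant.det M2 = Determinant.det (?I k + ?C * ?X)"
    unfolding M2_def by (subst det_four_block_mat_lower_left_zero[of _ n _ k]) auto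
  have "Determinant.det (?I n + ?X * ?C) = Determinant.det (?I k + ?C * ?X)"
    using Determinant.det_mult[OF M1 L] Determinant.det_mult[OF L M2] \<open>M1 * L = M\<close> \<open>L * M2 = M\<close>
      \<open>Determinant.det L = 1\<close> \<open>Determinant.det M1 = _\<close> \<open>Determinant.det M2 = _\<close> by simp
  moreover have "?I n + ?X * ?C = Matrix.mat n n (\<lambda>(i, j). (if i = j then 1 else 0) + (\<Sum>h<k. X i h * C h j))"
    by (rule eq_matI) (auto simp: scalar_prod_def lessThan_atLeast0)
  moreover have "?I k + ?C * ?X = Matrix.mat k k (\<lambda>(g, h). (if g = h then 1 else 0) + (\<Sum>i<n. C g i * X i h))"
    by (rule eq_matI) (auto simp: scalar_prod_def lessThan_atLeast0)
  ultimately show ?thesis by (simp add: det_mat_eq_det_on)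
qed

text \<open>Cramer's rule: the adjugate applied to \<open>b\<close>, divided by the determinant, is
  a solution.\<close>

lemma det_on_nonzero_solve:
  fixes G :: "nat \<Rightarrow> nat \<Rightarrow> real"
  assumes "det_on {..<n} G \<noteq> 0"
  obtains X where "\<And>i. i < n \<Longrightarrow> (\<Sum>j<n. G i j * X j) = b i"
proof -
  let ?G = "Matrix.mat n n (\<lambda>(i, j). G i j)"
  have G: "?G \<in> carrier_mat n n" by auto
  have "Determinant.det ?G \<noteq> 0"
    using assms by (simp add: det_mat_eq_det_on)
  have 1: "?G * adj_mat ?G = Determinant.det ?G \<cdot>\<^sub>m 1\<^sub>m n" by (rule adj_mat[OF G])
  have 2: "adj_mat ?G \<in> carrier_mat n n" by (rule adj_mat[OF G])
  define v where "v = inverse (Determinant.det ?G) \<cdot>\<^sub>v (adj_mat ?G *\<^sub>v Matrix.vec n b)"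
  have v: "v \<in> carrier_vec n"
    using 2 by (auto simp: v_def carrier_vecI)
  have "?G *\<^sub>v v = inverse (Determinant.det ?G) \<cdot>\<^sub>v (?G *\<^sub>v (adj_mat ?G *\<^sub>v Matrix.vec n b))"
    unfolding v_def using G 2 by (intro mult_mat_vec) (auto intro: carrier_vecI)
  also have "?G *\<^sub>v (adj_mat ?G *\<^sub>v Matrix.vec n b) = (?G * adj_mat ?G) *\<^sub>v Matrix.vec n b"
    using G 2 by (intro assoc_mult_mat_vec[symmetric]) auto
  also have "inverse (Determinant.det ?G) \<cdot>\<^sub>v ((?G * adj_mat ?G) *\<^sub>v Matrix.vec n b) = Matrix.vec n b"
    unfolding 1 using \<open>Determinant.det ?G \<noteq> 0\<close> by (intro eq_vecI) (auto simp: scalar_prod_def mult.assoc if_distrib[of "\<lambda>x. x * _"] if_distrib[of "(*) _"] cong: if_cong)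
  finally have eq: "?G *\<^sub>v v = Matrix.vec n b" .
  show ?thesis
  proof (rule that)
    fix i assume "i < n"
    then have "(?G *\<^sub>v v) $ i = (\<Sum>j<n. G i j * v $ j)"
      using v by (auto simp: scalar_prod_def lessThan_atLeast0)
    moreover have "(?G *\<^sub>v v) $ i = b i"
      unfolding eq using \<open>i < n\<close> by simp
    ultimately show "(\<Sum>j<n. G i j * v $ j) = b i" by (simp only:)
  qed
qed

lemma det_on_zero_kernel:
  fixes G :: "nat \<Rightarrow> nat \<Rightarrow> real"
  assumes "det_on {..<n} G = 0"
  obtains v where "\<And>i. i < n \<Longrightarrow> (\<Sum>j<n. G i j * v j) = 0" "\<exists>j<n. v j \<noteq> 0"
proof -
  let ?G = "Matrix.mat n n (\<lambda>(i, j). G i j)"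
  have "Determinant.det ?G = 0"
    using assms by (simp add: det_mat_eq_det_on)
  then obtain v where v: "v \<in> carrier_vec n" "v \<noteq> 0\<^sub>v n" "?G *\<^sub>v v = 0\<^sub>v n"
    using det_0_iff_vec_prod_zero[of ?G n] by auto
  show ?thesis
  proof (rule that)
    fix i assume "i < n"
    then have "(?G *\<^sub>v v) $ i = (\<Sum>j<n. G i j * v $ j)"
      using v(1) by (auto simp: scalar_prod_def lessThan_atLeast0)
    moreover have "(?G *\<^sub>v v) $ i = 0"
      unfolding v(3) using \<open>i < n\<close> by simp
    ultimately show "(\<Sum>j<n. G i j * v $ j) = 0" by (simp only:)
  next
    show "\<exists>j<n. v $ j \<noteq> 0"
      using v by (metis carrier_vecD eq_vecI index_zero_vec)
  qed
qed

text \<open>With \<open>X = G\<inverse> B\<close> the second factor is \<open>det(I + C G\<inverse> B)\<close>.\<close>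

lemma det_on_add_low_rank:
  fixes G X B C :: "nat \<Rightarrow> nat \<Rightarrow> real"
  assumes "\<And>i h. i < n \<Longrightarrow> h < k \<Longrightarrow> (\<Sum>j<n. G i j * X j h) = B i h"
  shows "det_on {..<n} (\<lambda>i j. G i j + (\<Sum>h<k. B i h * C h j)) =
    det_on {..<n} G * det_on {..<k} (\<lambda>g h. (if g = h then 1 else 0) + (\<Sum>i<n. C g i * X i h))"
proof -
  have "det_on {..<n} (\<lambda>i j. G i j + (\<Sum>h<k. B i h * C h j)) =
    det_on {..<n} (\<lambda>i j. \<Sum>l<n. G i l * ((if l = j then 1 else 0) + (\<Sum>h<k. X l h * C h j)))"
  proof (intro det_on_cong)
    fix i j assume ij: "i \<in> {..<n}" "j \<in> {..<n}"
    have "(\<Sum>h<k. B i h * C h j) = (\<Sum>h<k. \<Sum>l<n. G i l * X l h * C h j)"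
      using ij by (intro sum.cong) (auto simp flip: assms simp: sum_distrib_right)
    also have "\<dots> = (\<Sum>l<n. G i l * (\<Sum>h<k. X l h * C h j))"
      by (subst sum.swap) (simp add: sum_distrib_left mult_ac)
    moreover have "(\<Sum>l<n. G i l * (if l = j then 1 else 0)) = G i j"
      using ij by (simp add: if_distrib[of "(*) _"] cong: if_cong)
    ultimately show "G i j + (\<Sum>h<k. B i h * C h j) = (\<Sum>l<n. G i l * ((if l = j then 1 else 0) + (\<Sum>h<k. X l h * C h j)))"
      by (simp add: distrib_left sum.distrib)
  qed
  then show ?thesis by (simp only: det_on_mult det_one_plus_mult_commute)
qed

section \<open>Standard Young tableaux\<close>

text \<open>The coefficient of \<open>z^k\<close> in \<open>exp (s z)\<close>, extended by 0 to
  negative \<open>k\<close>. With this extension the relation \<open>e_(k-1) = k e_k\<close> at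
  \<open>s = 1\<close> holds for all integers.\<close>

definition ecoeff :: "real \<Rightarrow> int \<Rightarrow> real" where
  "ecoeff s k = (if k < 0 then 0 else s ^ nat k / fact (nat k))"

lemma ecoeff_neg [simp]: "k < 0 \<Longrightarrow> ecoeff s k = 0" by (simp add: ecoeff_def)

lemma ecoeff_0 [simp]: "ecoeff s 0 = 1" by (simp add: ecoeff_def)

lemma ecoeff_of_nat: "ecoeff s (int k) = s ^ k / fact k" by (simp add: ecoeff_def)

lemma ecoeff_pred: "ecoeff 1 (k - 1) = of_int k * ecoeff 1 k"
proof (cases "k \<le> 0")
  case False
  then obtain m where "k = int (Suc m)"
    by (metis not_le zero_less_imp_eq_int not0_implies_Suc of_nat_0_less_iff gr_implies_not0)
  moreover have "ecoeff 1 (int (Suc m)) = 1 / (real (Suc m) * fact m)"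
    by (simp only: ecoeff_of_nat power_one fact_Suc)
  moreover have "ecoeff 1 (int (Suc m) - 1) = 1 / fact m"
    using ecoeff_of_nat[of 1 m] by simp
  ultimately show ?thesis by (simp del: of_nat_Suc)
qed (auto simp: ecoeff_def)

text \<open>At \<open>x = part_pos p\<close> this is Aitken's determinant for \<open>f / N!\<close>,
  with entries \<open>1 / (p i - i + j)!\<close>. Arbitrary integer rows \<open>x\<close> are
  allowed so that a single row can be shifted by one.\<close>

definition pos_det :: "nat \<Rightarrow> (nat \<Rightarrow> int) \<Rightarrow> real" where
  "pos_det n x = det_on {..<n} (\<lambda>i j. ecoeff 1 (x i + int j + 1))"

text \<open>Lowering row \<open>k\<close> multiplies its entry in column \<open>l\<close> by
  \<open>x k + l + 1\<close>, a row weight plus a column weight, so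
  \<open>det_on_row_weights_sum\<close> applies. At a partition the total weight is its
  size.\<close>

lemma pos_det_sum_decrement:
  "(\<Sum>i<n. pos_det n (x(i := x i - 1))) = (\<Sum>i<n. of_int (x i + int i + 1)) * pos_det n x"
proof -
  have "(\<Sum>i<n. pos_det n (x(i := x i - 1))) =
    (\<Sum>i<n. det_on {..<n} (\<lambda>k l. if k = i then (of_int (x k) + of_int (int l + 1)) * ecoeff 1 (x k + int l + 1)
       else ecoeff 1 (x k + int l + 1)))"
    unfolding pos_det_def
  proof (intro sum.cong refl det_on_cong)
    fix i k l :: nat
    show "ecoeff 1 ((x(i := x i - 1)) k + int l + 1) =
        (if k = i then (of_int (x k) + of_int (int l + 1)) * ecoeff 1 (x k + int l + 1)
         else ecoeff 1 (x k + int l + 1))"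
      using ecoeff_pred[of "x k + int l + 1"] by (cases "k = i") (simp_all add: algebra_simps)
  qed
  also have "\<dots> = (\<Sum>i<n. of_int (x i + int i + 1)) * pos_det n x"
    by (subst det_on_row_weights_sum) (auto simp: pos_det_def sum.distrib)
  finally show ?thesis .
qed

text \<open>Raising the rows in turn amounts to raising the columns in turn. A raised column
  \<open>j < n\<close> coincides with column \<open>j + 1\<close>, so only the last column survives.
  By the hypothesis the last row is \<open>0, ..., 0, 1\<close>; hence only permutations with
  \<open>p n = n\<close> count, and for these raising the last column is harmless because
  \<open>ecoeff 1 0\<close> and \<open>ecoeff 1 1\<close> are both 1.\<close>

lemma pos_det_sum_increment:
  assumes "x n = - int n - 1"
  shows "(\<Sum>i\<le>n. pos_det (Suc n) (x(i := x i + 1))) = pos_det (Suc n) x"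
proof -
  let ?A = "\<lambda>k l. ecoeff 1 (x k + int l + 1)"
  let ?C = "\<lambda>k l. ecoeff 1 (x k + int (Suc l) + 1)"
  let ?D = "\<lambda>j. det_on {..<Suc n} (\<lambda>k l. if l = j then ?C k l else ?A k l)"
  have "(\<Sum>i\<le>n. pos_det (Suc n) (x(i := x i + 1))) =
     (\<Sum>i<Suc n. det_on {..<Suc n} (\<lambda>k l. if k = i then ?C k l else ?A k l))"
    unfolding pos_det_def lessThan_Suc_atMost by (intro sum.cong refl det_on_cong) (auto simp: algebra_simps)
  also have "\<dots> = (\<Sum>j<Suc n. ?D j)" by (rule det_on_sum_replace_rows_eq_cols) simp
  also have "\<dots> = (\<Sum>j<n. ?D j) + ?D n" by simp
  also have "(\<Sum>j<n. ?D j) = 0"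
  proof (intro sum.neutral ballI)
    fix j assume "j \<in> {..<n}"
    then show "?D j = 0" by (intro det_on_identical_cols[of j "Suc j"]) auto
  qed
  also have "?D n = pos_det (Suc n) x"
    unfolding pos_det_def det_on_def
  proof (intro sum.cong refl)
    fix p assume p: "p \<in> {p. p permutes {..<Suc n}}"
    show "of_int (sign p) * (\<Prod>i<Suc n. if p i = n then ?C i (p i) else ?A i (p i)) =
          of_int (sign p) * (\<Prod>i<Suc n. ?A i (p i))"
    proof (cases "p n = n")
      case True
      have "(\<Prod>i<Suc n. if p i = n then ?C i (p i) else ?A i (p i)) = (\<Prod>i<Suc n. ?A i (p i))"
      proof (intro prod.cong refl)
        fix i
        have "p i = n \<longleftrightarrow> i = n"
          using p True by (metis mem_Collect_eq permutes_inj injD)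
        then show "(if p i = n then ?C i (p i) else ?A i (p i)) = ?A i (p i)"
          using True assms by (auto simp: ecoeff_def)
      qed
      then show ?thesis by simp
    next
      case False
      have "p n < n"
        using p False permutes_in_image[of p "{..<Suc n}" n] by auto
      then have "?A n (p n) = 0"
        using assms by simp
      then show ?thesis using False by simp
    qed
  qed
  finally show ?thesis by (simp only: add_0)
qed

text \<open>Shifting a row in which no cell can be removed or added produces two equal rows or a
  zero row. Sums over removable or addable cells can therefore be extended to all rows.\<close>

lemma pos_det_eq_0:
  assumes "i < n" "x i = x (Suc i) \<and> Suc i < n \<or> x i < - int n"
  shows "pos_det n x = 0"
  using assms(2)
proof (elim conjE disjE)
  assume "x i = x (Suc i)" "Suc i < n"
  then show ?thesis
    unfolding pos_det_def by (intro det_on_identical_rows[of i "Suc i"]) auto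
next
  assume "x i < - int n"
  then show ?thesis
    using assms(1) unfolding pos_det_def by (intro det_on_zero_row[of _ i]) auto
qed

text \<open>The \<open>- 1\<close> compensates for counting rows from 0: with
  \<open>j = i + 1\<close> this is the \<open>j\<close>-th part minus \<open>j\<close>.\<close>

definition part_pos :: "(nat \<Rightarrow> nat) \<Rightarrow> nat \<Rightarrow> int" where
  "part_pos p i = int (p i) - int i - 1"

section \<open>Partitions with boundedly many parts, and their removable and addable cells\<close>

definition bounded_partitions :: "nat \<Rightarrow> (nat \<Rightarrow> nat) set" where
  "bounded_partitions n = {p. is_partition p \<and> (\<forall>i\<ge>n. p i = 0)}"

definition partitions_of :: "nat \<Rightarrow> (nat \<Rightarrow> nat) set" where
  "partitions_of N = {p. is_partition p \<and> psize p = N}"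

lemma bounded_partitionsI:
  assumes "decseq p" "\<And>i. i \<ge> n \<Longrightarrow> p i = 0"
  shows "p \<in> bounded_partitions n"
  using assms summable_finite[of "{..<n}" p] by (auto simp: bounded_partitions_def is_partition_def not_less)

lemma psize_bounded:
  assumes "\<And>i. i \<ge> n \<Longrightarrow> p i = 0"
  shows "psize p = (\<Sum>i<n. p i)"
  unfolding psize_def by (rule suminf_finite) (use assms in \<open>auto simp: not_less\<close>)

lemma partition_in_bounded:
  assumes "is_partition p"
  shows "p \<in> bounded_partitions (psize p)"
proof -
  have p: "decseq p" "summable p"
    using assms by (auto simp: is_partition_def)
  have "p i = 0" if "i \<ge> psize p" for i
  proof (rule ccontr)
    assume "p i \<noteq> 0"
    have "p j \<ge> 1" if "j \<le> i" for j
      using decseqD[OF p(1) that] \<open>p i \<noteq> 0\<close> by linarith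
    then have "(\<Sum>j\<le>i. p j) \<ge> Suc i"
      using sum_mono[of "{..i}" "\<lambda>_. 1" p] by simp
    moreover have "(\<Sum>j\<le>i. p j) \<le> psize p"
      unfolding psize_def by (rule sum_le_suminf[OF p(2)]) auto
    ultimately show False
      using that by simp
  qed
  then show ?thesis
    using assms by (simp add: bounded_partitions_def)
qed

lemma finite_partitions_of: "finite (partitions_of N)"
proof (rule finite_subset)
  show "partitions_of N \<subseteq> {p. \<forall>x. (x \<in> {..<N} \<longrightarrow> p x \<in> {..N}) \<and> (x \<notin> {..<N} \<longrightarrow> p x = 0)}"
  proof (intro subsetI CollectI allI conjI impI)
    fix p i assume p: "p \<in> partitions_of N"
    then have *: "p \<in> bounded_partitions N"
      using partition_in_bounded by (auto simp: partitions_of_def)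
    show "p i = 0" if "i \<notin> {..<N}"
      using that * by (auto simp: bounded_partitions_def)
    show "p i \<in> {..N}" if "i \<in> {..<N}"
    proof -
      have "p i \<le> (\<Sum>i<N. p i)"
        using that by (intro member_le_sum) auto
      then show ?thesis
        using p psize_bounded[of N p] * by (auto simp: bounded_partitions_def partitions_of_def)
    qed
  qed
qed (intro finite_set_of_finite_funs; simp)

definition corners :: "(nat \<Rightarrow> nat) \<Rightarrow> nat set" where
  "corners p = {i. p (Suc i) < p i}"

definition addable :: "(nat \<Rightarrow> nat) \<Rightarrow> nat set" where
  "addable p = {i. i = 0 \<or> p i < p (i - 1)}"

lemma corners_bounded: "p \<in> bounded_partitions n \<Longrightarrow> corners p \<subseteq> {..<n}"
  by (auto simp: corners_def bounded_partitions_def intro!: leI)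

lemma addable_bounded: "p \<in> bounded_partitions n \<Longrightarrow> addable p \<subseteq> {..n}"
  by (auto simp: addable_def bounded_partitions_def intro!: leI)

lemma decseq_remove_corner:
  assumes "decseq p" "i \<in> corners p"
  shows "decseq (p(i := p i - 1))"
  unfolding decseq_Suc_iff
proof
  fix k show "(p(i := p i - 1)) (Suc k) \<le> (p(i := p i - 1)) k"
    using decseqD[OF assms(1), of k "Suc k"] assms(2) by (auto simp: corners_def)
qed

lemma decseq_add_cell:
  assumes "decseq p" "i \<in> addable p"
  shows "decseq (p(i := p i + 1))"
  unfolding decseq_Suc_iff
proof
  fix k show "(p(i := p i + 1)) (Suc k) \<le> (p(i := p i + 1)) k"
    using decseqD[OF assms(1), of k "Suc k"] assms(2) by (auto simp: addable_def)
qed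

lemma remove_corner:
  assumes "p \<in> bounded_partitions n" "i \<in> corners p"
  shows "p(i := p i - 1) \<in> bounded_partitions n" "psize p = Suc (psize (p(i := p i - 1)))"
    "i \<in> addable (p(i := p i - 1))"
proof -
  have "i < n" and dec: "decseq p"
    using corners_bounded[OF assms(1)] assms by (auto simp: bounded_partitions_def is_partition_def)
  show *: "p(i := p i - 1) \<in> bounded_partitions n"
    using assms decseq_remove_corner[of p i] by (intro bounded_partitionsI) (auto simp: bounded_partitions_def is_partition_def)
  have "(\<Sum>k<n. p k) = p i + (\<Sum>k\<in>{..<n} - {i}. p k)"
    using \<open>i < n\<close> by (subst sum.remove[of _ i]) auto
  moreover have "(\<Sum>k<n. (p(i := p i - 1)) k) = (p i - 1) + (\<Sum>k\<in>{..<n} - {i}. p k)"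
    using \<open>i < n\<close> by (subst sum.remove[of _ i]) auto
  ultimately show "psize p = Suc (psize (p(i := p i - 1)))"
    using psize_bounded[of n p] psize_bounded[of n "p(i := p i - 1)"] assms *
    by (auto simp: bounded_partitions_def corners_def)
  show "i \<in> addable (p(i := p i - 1))"
    using decseqD[OF dec, of "i - 1" i] assms(2) by (auto simp: addable_def corners_def)
qed

lemma add_cell:
  assumes "p \<in> bounded_partitions n" "i \<in> addable p"
  shows "p(i := p i + 1) \<in> bounded_partitions (Suc n)" "psize (p(i := p i + 1)) = Suc (psize p)"
    "i \<in> corners (p(i := p i + 1))"
proof -
  have "i \<le> n" and dec: "decseq p"
    using addable_bounded[OF assms(1)] assms by (auto simp: bounded_partitions_def is_partition_def)
  show *: "p(i := p i + 1) \<in> bounded_partitions (Suc n)"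
    using assms \<open>i \<le> n\<close> by (intro bounded_partitionsI decseq_add_cell dec) (auto simp: bounded_partitions_def)
  show **: "i \<in> corners (p(i := p i + 1))"
    using decseqD[OF dec, of i "Suc i"] by (auto simp: corners_def)
  show "psize (p(i := p i + 1)) = Suc (psize p)"
    using remove_corner(2)[OF * **] by (simp only: fun_upd_same fun_upd_upd fun_upd_triv add_diff_cancel_right')
qed

section \<open>Removing the largest entry of a standard tableau\<close>

lemma young_diagram_remove_corner:
  assumes "i \<in> corners p"
  shows "young_diagram (p(i := p i - 1)) = young_diagram p - {(i, p i - 1)}"
proof -
  have "(a, b) \<in> young_diagram (p(i := p i - 1)) \<longleftrightarrow> (a, b) \<in> young_diagram p - {(i, p i - 1)}" for a b
    using assms by (cases "a = i") (auto simp: young_diagram_def corners_def)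
  then show ?thesis by (intro equalityI subrelI) (simp_all only:)
qed

lemma finite_young_diagram:
  assumes "p \<in> bounded_partitions n"
  shows "finite (young_diagram p)"
proof (rule finite_subset)
  show "young_diagram p \<subseteq> {..<n} \<times> {..p 0}"
  proof clarify
    fix i j assume "(i, j) \<in> young_diagram p"
    then have "j < p i" by (simp add: young_diagram_def)
    moreover have "i < n"
      using assms \<open>j < p i\<close> by (cases "i < n") (auto simp: bounded_partitions_def)
    moreover have "p i \<le> p 0"
      using assms by (auto simp: bounded_partitions_def is_partition_def intro: decseqD)
    ultimately show "i \<in> {..<n} \<and> j \<in> {..p 0}" by auto
  qed
qed auto

lemma finite_standard_tableaux:
  assumes "is_partition p"
  shows "finite (standard_tableaux p)"
proof (rule finite_subset)
  show "standard_tableaux p \<subseteq> young_diagram p \<rightarrow>\<^sub>E {1..psize p}"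
    by (auto simp: standard_tableaux_def PiE_def dest: bij_betw_apply)
  show "finite (young_diagram p \<rightarrow>\<^sub>E {1..psize p})"
    using finite_young_diagram[OF partition_in_bounded[OF assms]] by (intro finite_PiE) auto
qed

text \<open>A cell to the right of or below the maximal entry would have to carry a still larger
  one.\<close>

lemma standard_tableau_max_cell:
  assumes p: "is_partition p" "psize p = Suc N" and T: "T \<in> standard_tableaux p"
  obtains i where "i \<in> corners p" "T (i, p i - 1) = Suc N"
proof -
  have bij: "bij_betw T (young_diagram p) {1..Suc N}"
    using T p by (auto simp: standard_tableaux_def)
  then have "Suc N \<in> T ` young_diagram p" by (auto simp: bij_betw_def)
  then obtain i j where ij: "(i, j) \<in> young_diagram p" "T (i, j) = Suc N" by force
  have le: "T c \<le> Suc N" if "c \<in> young_diagram p" for c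
    using bij that by (auto dest: bij_betw_apply)
  have "(i, Suc j) \<notin> young_diagram p"
  proof
    assume c: "(i, Suc j) \<in> young_diagram p"
    then have "T (i, j) < T (i, Suc j)"
      using T ij(1) lessI unfolding standard_tableaux_def by blast
    then show False using le[OF c] ij by simp
  qed
  moreover have "(Suc i, j) \<notin> young_diagram p"
  proof
    assume c: "(Suc i, j) \<in> young_diagram p"
    then have "T (i, j) < T (Suc i, j)"
      using T ij(1) lessI unfolding standard_tableaux_def by blast
    then show False using le[OF c] ij by simp
  qed
  ultimately have "j = p i - 1" "i \<in> corners p"
    using ij by (auto simp: young_diagram_def corners_def)
  then show ?thesis
    using ij that by auto
qed

lemma standard_tableauxD:
  assumes "T \<in> standard_tableaux p"
  shows "T \<in> extensional (young_diagram p)" "bij_betw T (young_diagram p) {1..psize p}"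
    "\<And>i j j'. (i, j) \<in> young_diagram p \<Longrightarrow> (i, j') \<in> young_diagram p \<Longrightarrow> j < j' \<Longrightarrow> T (i, j) < T (i, j')"
    "\<And>i i' j. (i, j) \<in> young_diagram p \<Longrightarrow> (i', j) \<in> young_diagram p \<Longrightarrow> i < i' \<Longrightarrow> T (i, j) < T (i', j)"
  using assms unfolding standard_tableaux_def by blast+

lemma standard_tableauxI:
  assumes "T \<in> extensional (young_diagram p)" "bij_betw T (young_diagram p) {1..psize p}"
    "\<And>i j j'. (i, j) \<in> young_diagram p \<Longrightarrow> (i, j') \<in> young_diagram p \<Longrightarrow> j < j' \<Longrightarrow> T (i, j) < T (i, j')"
    "\<And>i i' j. (i, j) \<in> young_diagram p \<Longrightarrow> (i', j) \<in> young_diagram p \<Longrightarrow> i < i' \<Longrightarrow> T (i, j) < T (i', j)"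
  shows "T \<in> standard_tableaux p"
  using assms unfolding standard_tableaux_def by blast

text \<open>The inverse map writes \<open>Suc N\<close> back into the corner. Monotonicity persists
  because this entry exceeds all others and the corner is last in its row and in its column.\<close>

lemma bij_betw_remove_max_cell:
  assumes p: "is_partition p" "psize p = Suc N" and i: "i \<in> corners p"
  shows "bij_betw (\<lambda>T. restrict T (young_diagram (p(i := p i - 1))))
    {T \<in> standard_tableaux p. T (i, p i - 1) = Suc N} (standard_tableaux (p(i := p i - 1)))"
proof -
  define q where "q = p(i := p i - 1)"
  obtain c where c_def: "c = (i, p i - 1)" by simp
  note n = partition_in_bounded[OF p(1)]
  have Y: "young_diagram q = young_diagram p - {c}"
    unfolding q_def c_def by (rule young_diagram_remove_corner[OF i])
  have c: "c \<in> young_diagram p" "c \<notin> young_diagram q"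
    using i unfolding Y by (simp_all add: c_def young_diagram_def corners_def)
  have Yp: "young_diagram p = insert c (young_diagram q)"
    using c(1) unfolding Y by blast
  have q: "psize q = N"
    using remove_corner(2)[OF n i] p by (simp add: q_def)
  have dec: "decseq p"
    using p by (simp add: is_partition_def)
  \<comment> \<open>In \<open>row\<close> and \<open>col\<close>, a cell with another cell of the
    diagram to its right or below it cannot be the corner, so the smaller member of each compared
    pair lies in \<open>q\<close>.\<close>
  have row: "(a, b) \<in> young_diagram q" if "(a, b') \<in> young_diagram p" "b < b'" for a b b'
    using that i unfolding Y by (auto simp: c_def young_diagram_def)
  have col: "(a, b) \<in> young_diagram q" if *: "(a, b) \<in> young_diagram p" "(a', b) \<in> young_diagram p" "a < a'" for a a' b
  proof -
    have "p a' \<le> p (Suc a)"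
      using that by (intro decseqD[OF dec]) simp
    then have "(a, b) \<noteq> c"
      using * i by (auto simp: c_def young_diagram_def corners_def)
    then show ?thesis using *(1) unfolding Y by simp
  qed
  have "bij_betw (\<lambda>T. restrict T (young_diagram q)) {T \<in> standard_tableaux p. T c = Suc N} (standard_tableaux q)"
  proof (rule bij_betw_byWitness[where f' = "\<lambda>T. T(c := Suc N)"])
    show "\<forall>T\<in>{T \<in> standard_tableaux p. T c = Suc N}. (restrict T (young_diagram q))(c := Suc N) = T"
    proof (intro ballI ext)
      fix T x assume "T \<in> {T \<in> standard_tableaux p. T c = Suc N}"
      then have T: "T \<in> standard_tableaux p" "T c = Suc N" by simp_all
      then show "((restrict T (young_diagram q))(c := Suc N)) x = T x"
        using extensional_arb[OF standard_tableauxD(1)[OF T(1)], of x]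
        by (cases "x = c"; cases "x \<in> young_diagram q") (simp_all add: Yp)
    qed
    show "\<forall>T\<in>standard_tableaux q. restrict (T(c := Suc N)) (young_diagram q) = T"
    proof (intro ballI ext)
      fix T x assume "T \<in> standard_tableaux q"
      then have "x \<notin> young_diagram q \<Longrightarrow> T x = undefined"
        by (intro extensional_arb[OF standard_tableauxD(1)])
      then show "restrict (T(c := Suc N)) (young_diagram q) x = T x"
        using c(2) by (cases "x \<in> young_diagram q") auto
    qed
    show "(\<lambda>T. restrict T (young_diagram q)) ` {T \<in> standard_tableaux p. T c = Suc N} \<subseteq> standard_tableaux q"
    proof (rule image_subsetI, rule standard_tableauxI)
      fix T assume "T \<in> {T \<in> standard_tableaux p. T c = Suc N}"
      then have T: "T \<in> standard_tableaux p" "T c = Suc N" by simp_all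
      have bij: "bij_betw T (insert c (young_diagram q)) {1..Suc N}"
        using standard_tableauxD(2)[OF T(1)] p(2) by (simp only: Yp)
      have eq: "{1..Suc N} - {Suc N} = {1..N}" by auto
      have "bij_betw T (insert c (young_diagram q) - {c}) ({1..Suc N} - {T c})"
        using bij by (rule bij_betw_subset) (use bij c(2) in \<open>auto simp: bij_betw_def inj_on_def\<close>)
      then have "bij_betw T (young_diagram q) {1..psize q}"
        using c(2) by (simp add: T(2) eq q del: One_nat_def)
      then show "bij_betw (restrict T (young_diagram q)) (young_diagram q) {1..psize q}"
        by (simp cong: bij_betw_cong)
      show "restrict T (young_diagram q) (a, b) < restrict T (young_diagram q) (a, b')"
        if "(a, b) \<in> young_diagram q" "(a, b') \<in> young_diagram q" "b < b'" for a b b'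
        using standard_tableauxD(3)[OF T(1), of a b b'] that Yp by simp
      show "restrict T (young_diagram q) (a, b) < restrict T (young_diagram q) (a', b)"
        if "(a, b) \<in> young_diagram q" "(a', b) \<in> young_diagram q" "a < a'" for a a' b
        using standard_tableauxD(4)[OF T(1), of a b a'] that Yp by simp
    qed simp
    show "(\<lambda>T. T(c := Suc N)) ` standard_tableaux q \<subseteq> {T \<in> standard_tableaux p. T c = Suc N}"
    proof (rule image_subsetI, rule CollectI, rule conjI, rule standard_tableauxI)
      fix T assume T: "T \<in> standard_tableaux q"
      let ?T = "T(c := Suc N)"
      have bij: "bij_betw T (young_diagram q) {1..N}"
        using standard_tableauxD(2)[OF T] q by simp
      have le: "T d < Suc N" if "d \<in> young_diagram q" for d
        using bij_betw_apply[OF bij that] by simp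
      have "bij_betw ?T (young_diagram q) {1..N} = bij_betw T (young_diagram q) {1..N}"
        using c(2) by (intro bij_betw_cong) auto
      then have "bij_betw ?T (young_diagram q \<union> {c}) ({1..N} \<union> {Suc N})"
        using bij by (intro bij_betw_combine) (simp_all add: bij_betw_def)
      moreover have "young_diagram q \<union> {c} = young_diagram p" "{1..N} \<union> {Suc N} = {1..psize p}"
        using p(2) by (auto simp: Yp)
      ultimately show "bij_betw ?T (young_diagram p) {1..psize p}" by simp
      show "?T \<in> extensional (young_diagram p)"
        using standard_tableauxD(1)[OF T] by (simp add: extensional_def Yp)
      show "?T (a, b) < ?T (a, b')"
        if "(a, b) \<in> young_diagram p" "(a, b') \<in> young_diagram p" "b < b'" for a b b'
        using standard_tableauxD(3)[OF T, of a b b'] row[OF that(2,3)] that(2,3) c(2) le[of "(a, b)"]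
        by (cases "(a, b') = c"; cases "(a, b) = c") (simp_all add: Yp)
      show "?T (a, b) < ?T (a', b)"
        if "(a, b) \<in> young_diagram p" "(a', b) \<in> young_diagram p" "a < a'" for a a' b
        using standard_tableauxD(4)[OF T, of a b a'] col[OF that] that(2,3) c(2) le[of "(a, b)"]
        by (cases "(a', b) = c"; cases "(a, b) = c") (simp_all add: Yp)
    qed simp
  qed
  then show ?thesis by (simp only: q_def c_def)
qed

text \<open>The tableaux are sorted by the corner that carries the largest entry.\<close>

lemma num_syt_rec:
  assumes p: "is_partition p" "psize p = Suc N"
  shows "num_syt p = (\<Sum>i\<in>corners p. num_syt (p(i := p i - 1)))"
proof -
  let ?S = "\<lambda>i. {T \<in> standard_tableaux p. T (i, p i - 1) = Suc N}"
  have fin: "finite (corners p)"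
    using corners_bounded[OF partition_in_bounded[OF p(1)]] finite_subset by blast
  have "standard_tableaux p = (\<Union>i\<in>corners p. ?S i)"
    using standard_tableau_max_cell[OF p] by auto
  then have "num_syt p = card (\<Union>i\<in>corners p. ?S i)"
    unfolding num_syt_def by simp
  also have "\<dots> = (\<Sum>i\<in>corners p. card (?S i))"
  proof (intro card_UN_disjoint fin ballI impI)
    show "finite (?S i)" for i
      using finite_standard_tableaux[OF p(1)] by simp
    fix i k assume "i \<in> corners p" "k \<in> corners p" "i \<noteq> k"
    then have Y: "(i, p i - 1) \<in> young_diagram p" "(k, p k - 1) \<in> young_diagram p" "(i, p i - 1) \<noteq> (k, p k - 1)"
      by (auto simp: young_diagram_def corners_def)
    show "?S i \<inter> ?S k = {}"
    proof safe
      fix T assume T: "T \<in> standard_tableaux p" "T (i, p i - 1) = Suc N" "T (k, p k - 1) = Suc N"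
      then have "inj_on T (young_diagram p)" by (auto simp: standard_tableaux_def bij_betw_def)
      then have "(i, p i - 1) = (k, p k - 1)"
        using Y T by (intro inj_onD[of T "young_diagram p"]) auto
      then show "T \<in> {}" using Y by blast
    qed
  qed
  also have "\<dots> = (\<Sum>i\<in>corners p. num_syt (p(i := p i - 1)))"
    unfolding num_syt_def by (intro sum.cong refl bij_betw_same_card[OF bij_betw_remove_max_cell[OF p]])
  finally show ?thesis .
qed

section \<open>The determinantal formula and the sum of the squares\<close>

lemma part_pos_upd_minus: "p i > 0 \<Longrightarrow> part_pos (p(i := p i - 1)) = (part_pos p)(i := part_pos p i - 1)"
  by (auto simp: part_pos_def fun_eq_iff)

lemma part_pos_upd_plus: "part_pos (p(i := p i + 1)) = (part_pos p)(i := part_pos p i + 1)"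
  by (auto simp: part_pos_def fun_eq_iff)

text \<open>Both sides obey the same recursion over removable cells: \<open>num_syt_rec\<close> on
  the left and \<open>pos_det_sum_decrement\<close> on the right, where the weights
  \<open>x i + i + 1 = p i\<close> add up to the size and rows without a corner contribute 0. Any
  bound \<open>n\<close> on the number of parts is admissible, which later allows an extra empty
  row.\<close>

lemma num_syt_eq_det:
  assumes "p \<in> bounded_partitions n"
  shows "real (num_syt p) = fact (psize p) * pos_det n (part_pos p)"
  using assms
proof (induction "psize p" arbitrary: p)
  case 0
  have "p i = 0" for i
    using partition_in_bounded[of p] 0 by (auto simp: bounded_partitions_def)
  then have p: "p = (\<lambda>_. 0)" by auto
  have Y: "young_diagram p = {}" by (auto simp: young_diagram_def p)
  have "standard_tableaux p = {\<lambda>_. undefined}"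
    using 0 by (auto simp: standard_tableaux_def Y bij_betw_def)
  then have "num_syt p = 1" by (simp add: num_syt_def)
  moreover have "pos_det n (part_pos p) = 1"
    unfolding pos_det_def by (subst det_on_upper_triangular) (auto simp: part_pos_def p)
  ultimately show ?case
    using 0 by simp
next
  case (Suc N)
  have p: "is_partition p" "decseq p" "\<And>i. i \<ge> n \<Longrightarrow> p i = 0"
    using Suc.prems by (auto simp: bounded_partitions_def is_partition_def)
  have "real (num_syt p) = (\<Sum>i\<in>corners p. real (num_syt (p(i := p i - 1))))"
    using num_syt_rec[OF p(1), of N] Suc.hyps by simp
  also have "\<dots> = (\<Sum>i\<in>corners p. fact N * pos_det n ((part_pos p)(i := part_pos p i - 1)))"
  proof (intro sum.cong refl)
    fix i assume i: "i \<in> corners p"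
    note r = remove_corner[OF Suc.prems i]
    have N: "N = psize (p(i := p i - 1))"
      using r Suc.hyps by simp
    show "real (num_syt (p(i := p i - 1))) = fact N * pos_det n ((part_pos p)(i := part_pos p i - 1))"
      using Suc.hyps(1)[OF N r(1)] N part_pos_upd_minus[of p i] i by (simp add: corners_def)
  qed
  also have "\<dots> = (\<Sum>i<n. fact N * pos_det n ((part_pos p)(i := part_pos p i - 1)))"
  proof (intro sum.mono_neutral_left ballI)
    fix i assume i: "i \<in> {..<n} - corners p"
    then have eq: "p (Suc i) = p i"
      using decseqD[OF p(2), of i "Suc i"] by (auto simp: corners_def)
    have "pos_det n ((part_pos p)(i := part_pos p i - 1)) = 0"
    proof (rule pos_det_eq_0[of i])
      show "i < n" using i by simp
      show "((part_pos p)(i := part_pos p i - 1)) i = ((part_pos p)(i := part_pos p i - 1)) (Suc i) \<and> Suc i < n \<or>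
        ((part_pos p)(i := part_pos p i - 1)) i < - int n"
      proof (cases "Suc i < n")
        case True
        then show ?thesis using eq by (simp add: part_pos_def)
      next
        case False
        then have "Suc i = n" using i by auto
        then have "p i = 0" using p(3)[of n] eq by simp
        then show ?thesis using \<open>Suc i = n\<close> by (auto simp: part_pos_def)
      qed
    qed
    then show "fact N * pos_det n ((part_pos p)(i := part_pos p i - 1)) = 0" by simp
  qed (use corners_bounded[OF Suc.prems] in auto)
  also have "\<dots> = fact N * ((\<Sum>i<n. of_int (part_pos p i + int i + 1)) * pos_det n (part_pos p))"
    by (simp add: pos_det_sum_decrement flip: sum_distrib_left)
  also have "(\<Sum>i<n. of_int (part_pos p i + int i + 1)) = real (Suc N)"
    using psize_bounded[of n p] p Suc.hyps by (simp add: part_pos_def flip: of_nat_sum)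
  finally show ?case by (simp only: Suc.hyps(2)[symmetric] fact_Suc mult_ac)
qed

text \<open>The extra row \<open>n\<close>, empty in \<open>p\<close>, leaves room for a new part
  and satisfies the hypothesis \<open>x n = - int n - 1\<close> of
  \<open>pos_det_sum_increment\<close>. The factor on the right is the quotient of the factorials in
  the two determinantal formulas.\<close>

lemma num_syt_up_sum:
  assumes "is_partition p"
  shows "(\<Sum>i\<in>addable p. num_syt (p(i := p i + 1))) = Suc (psize p) * num_syt p"
proof -
  let ?N = "psize p" and ?x = "part_pos p"
  define n where "n = psize p"
  have p: "p \<in> bounded_partitions n" "decseq p" "\<And>i. i \<ge> n \<Longrightarrow> p i = 0"
    using assms partition_in_bounded[OF assms] by (auto simp: is_partition_def n_def bounded_partitions_def)
  have p': "p \<in> bounded_partitions (Suc n)"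
    using p by (auto simp: bounded_partitions_def)
  have "(\<Sum>i\<in>addable p. real (num_syt (p(i := p i + 1)))) =
      (\<Sum>i\<in>addable p. fact (Suc ?N) * pos_det (Suc n) (?x(i := ?x i + 1)))"
  proof (intro sum.cong refl)
    fix i assume i: "i \<in> addable p"
    note r = add_cell[OF p(1) i]
    show "real (num_syt (p(i := p i + 1))) = fact (Suc ?N) * pos_det (Suc n) (?x(i := ?x i + 1))"
      using num_syt_eq_det[OF r(1)] r(2) by (simp only: part_pos_upd_plus)
  qed
  also have "\<dots> = (\<Sum>i\<le>n. fact (Suc ?N) * pos_det (Suc n) (?x(i := ?x i + 1)))"
  proof (intro sum.mono_neutral_left ballI)
    fix i assume i: "i \<in> {..n} - addable p"
    then obtain k where k: "i = Suc k" by (auto simp: addable_def gr0_conv_Suc)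
    have eq: "p (Suc k) = p k"
      using i k decseqD[OF p(2), of k "Suc k"] by (auto simp: addable_def)
    have "pos_det (Suc n) (?x(i := ?x i + 1)) = 0"
      by (rule pos_det_eq_0[of k]) (use k eq i in \<open>auto simp: part_pos_def\<close>)
    then show "fact (Suc ?N) * pos_det (Suc n) (?x(i := ?x i + 1)) = 0" by simp
  qed (use addable_bounded[OF p(1)] in auto)
  also have "\<dots> = fact (Suc ?N) * pos_det (Suc n) ?x"
    using pos_det_sum_increment[of ?x n] p(3)[of n] by (simp add: part_pos_def flip: sum_distrib_left)
  also have "\<dots> = Suc ?N * real (num_syt p)"
    using num_syt_eq_det[OF p'] by simp
  finally have "real (\<Sum>i\<in>addable p. num_syt (p(i := p i + 1))) = real (Suc ?N * num_syt p)"
    by (simp only: of_nat_sum of_nat_mult)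
  then show ?thesis by (simp only: of_nat_eq_iff)
qed

lemma partitions_of_0: "partitions_of 0 = {\<lambda>_. 0}"
proof safe
  fix p assume "p \<in> partitions_of 0"
  then show "p = (\<lambda>_. 0)"
    using partition_in_bounded[of p] by (auto simp: partitions_of_def bounded_partitions_def)
next
  have "(\<lambda>_. 0) \<in> bounded_partitions 0"
    by (rule bounded_partitionsI) (auto simp: decseq_def)
  then show "(\<lambda>_. 0) \<in> partitions_of 0"
    using psize_bounded[of 0 "\<lambda>_. 0"] by (auto simp: partitions_of_def bounded_partitions_def)
qed

text \<open>One factor of each square is replaced by its sum over removable cells. The pairs of
  partitions that differ by one cell are then regrouped by the smaller one, and the sum over addable
  cells collapses to \<open>Suc N\<close> times the previous total.\<close>

theorem sum_num_syt_squared: "(\<Sum>p\<in>partitions_of N. (num_syt p)\<^sup>2) = fact N"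
proof (induction N)
  case 0
  have "(\<lambda>_. 0) \<in> bounded_partitions 0"
    by (rule bounded_partitionsI) (auto simp: decseq_def)
  moreover have "psize (\<lambda>_. 0) = 0" by (simp add: psize_def)
  ultimately have "real (num_syt (\<lambda>_. 0)) = 1"
    by (subst num_syt_eq_det) (auto simp: pos_det_def)
  then show ?case by (simp add: partitions_of_0)
next
  case (Suc N)
  have fc: "finite (corners p)" "finite (addable p)" if "is_partition p" for p
    using corners_bounded[OF partition_in_bounded[OF that]] addable_bounded[OF partition_in_bounded[OF that]]
    by (auto intro: finite_subset)
  have "(\<Sum>p\<in>partitions_of (Suc N). (num_syt p)\<^sup>2) =
     (\<Sum>p\<in>partitions_of (Suc N). \<Sum>i\<in>corners p. num_syt p * num_syt (p(i := p i - 1)))"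
  proof (rule sum.cong[OF refl])
    fix p assume "p \<in> partitions_of (Suc N)"
    then have "num_syt p = (\<Sum>i\<in>corners p. num_syt (p(i := p i - 1)))"
      using num_syt_rec[of p N] by (simp add: partitions_of_def)
    then show "(num_syt p)\<^sup>2 = (\<Sum>i\<in>corners p. num_syt p * num_syt (p(i := p i - 1)))"
      by (simp only: power2_eq_square flip: sum_distrib_left)
  qed
  also have "\<dots> = (\<Sum>(p, i)\<in>Sigma (partitions_of (Suc N)) corners. num_syt p * num_syt (p(i := p i - 1)))"
    by (rule sum.Sigma) (use fc finite_partitions_of in \<open>auto simp: partitions_of_def\<close>)
  also have "\<dots> = (\<Sum>(p, i)\<in>Sigma (partitions_of N) addable. num_syt (p(i := p i + 1)) * num_syt p)"
  proof (rule sum.reindex_bij_witness[of _ "\<lambda>(p, i). (p(i := p i + 1), i)" "\<lambda>(p, i). (p(i := p i - 1), i)"]; clarify)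
    fix p i assume *: "p \<in> partitions_of (Suc N)" "i \<in> corners p"
    then have pos: "p i > 0" by (auto simp: corners_def)
    have b: "p \<in> bounded_partitions (Suc N)"
      using * partition_in_bounded[of p] by (auto simp: partitions_of_def)
    let ?q = "p(i := p i - 1)"
    show "?q(i := ?q i + 1) = p \<and> i = i"
      using pos by auto
    show "?q \<in> partitions_of N \<and> i \<in> addable ?q"
      using remove_corner[OF b *(2)] * by (auto simp: partitions_of_def bounded_partitions_def)
    show "num_syt (?q(i := ?q i + 1)) * num_syt ?q = num_syt p * num_syt ?q"
      using pos by simp
  next
    fix p i assume *: "p \<in> partitions_of N" "i \<in> addable p"
    have b: "p \<in> bounded_partitions N"
      using * partition_in_bounded[of p] by (auto simp: partitions_of_def)
    let ?q = "p(i := p i + 1)"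
    show "?q(i := ?q i - 1) = p \<and> i = i" by auto
    show "?q \<in> partitions_of (Suc N) \<and> i \<in> corners ?q"
      using add_cell[OF b *(2)] * by (auto simp: partitions_of_def bounded_partitions_def)
  qed
  also have "\<dots> = (\<Sum>p\<in>partitions_of N. \<Sum>i\<in>addable p. num_syt (p(i := p i + 1)) * num_syt p)"
    by (rule sum.Sigma[symmetric]) (use fc finite_partitions_of in \<open>auto simp: partitions_of_def\<close>)
  also have "\<dots> = (\<Sum>p\<in>partitions_of N. Suc N * (num_syt p)\<^sup>2)"
  proof (rule sum.cong[OF refl])
    fix p assume "p \<in> partitions_of N"
    then have "(\<Sum>i\<in>addable p. num_syt (p(i := p i + 1))) = Suc N * num_syt p"
      using num_syt_up_sum[of p] by (auto simp: partitions_of_def)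
    then show "(\<Sum>i\<in>addable p. num_syt (p(i := p i + 1)) * num_syt p) = Suc N * (num_syt p)\<^sup>2"
      by (simp only: power2_eq_square mult.assoc flip: sum_distrib_right)
  qed
  finally show ?case by (simp only: Suc fact_Suc of_nat_id flip: sum_distrib_left)
qed

section \<open>Partitions as sets of positions\<close>

lemma part_pos_strict_decreasing:
  assumes "is_partition p" "i < k"
  shows "part_pos p k < part_pos p i"
  using decseqD[of p i k] assms by (auto simp: part_pos_def is_partition_def)

lemma inj_part_pos:
  assumes "is_partition p"
  shows "inj_on (part_pos p) A"
  using part_pos_strict_decreasing[OF assms] by (intro linorder_inj_onI') (metis less_irrefl)

text \<open>The \<open>i\<close>-th position is the one with exactly \<open>i\<close> larger
  elements in the set. If it were smaller for \<open>p\<close> than for \<open>q\<close>, strictly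
  more elements would lie above it.\<close>

lemma part_pos_image_unique:
  assumes p: "is_partition p" and q: "is_partition q"
    and eq: "part_pos p ` {..<n} = part_pos q ` {..<n}" and "i < n"
  shows "part_pos p i = part_pos q i"
proof -
  have less: "\<not> part_pos p i < part_pos q i"
    if p: "is_partition p" and q: "is_partition q" and eq: "part_pos p ` {..<n} = part_pos q ` {..<n}" for p q
  proof
    assume lt: "part_pos p i < part_pos q i"
    have card: "card {y \<in> part_pos r ` {..<n}. part_pos r i < y} = i" if r: "is_partition r" for r
    proof -
      have "part_pos r i < part_pos r k \<longleftrightarrow> k < i" for k
        using part_pos_strict_decreasing[OF r, of i k] part_pos_strict_decreasing[OF r, of k i]
        by (cases i k rule: linorder_cases) auto
      then have "{y \<in> part_pos r ` {..<n}. part_pos r i < y} = part_pos r ` {..<i}"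
        using \<open>i < n\<close> by auto
      then show ?thesis
        using inj_part_pos[OF r] by (simp add: card_image)
    qed
    have "{y \<in> part_pos q ` {..<n}. part_pos q i < y} \<subset> {y \<in> part_pos p ` {..<n}. part_pos p i < y}"
      unfolding eq using lt \<open>i < n\<close> by auto
    then have "card {y \<in> part_pos q ` {..<n}. part_pos q i < y} < card {y \<in> part_pos p ` {..<n}. part_pos p i < y}"
      by (intro psubset_card_mono) auto
    then show False
      using card[OF p] card[OF q] by simp
  qed
  show ?thesis
    using less[OF p q eq] less[OF q p eq[symmetric]] by simp
qed

text \<open>Counted from 0, the \<open>k\<close>-th smallest element is at least
  \<open>k - n\<close>. This is exactly the nonnegativity of the part assigned to row
  \<open>n - 1 - k\<close>.\<close>

lemma ex_partition_of_positions:
  assumes "finite X" "card X = n" "\<And>x. x \<in> X \<Longrightarrow> x \<ge> - int n"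
  obtains p where "p \<in> bounded_partitions n" "part_pos p ` {..<n} = X"
proof -
  define l where "l = sorted_list_of_set X"
  have l: "sorted_wrt (<) l" "set l = X" "length l = n"
    using assms by (auto simp: l_def)
  have lt: "l ! i < l ! k" if "i < k" "k < n" for i k
    using sorted_wrt_nth_less[OF l(1)] that l(3) by simp
  have ge: "l ! k \<ge> int k - int n" if "k < n" for k
    using that
  proof (induction k)
    case 0
    then show ?case using assms(3)[of "l ! 0"] l(2,3) nth_mem[of 0 l] by simp
  next
    case (Suc k)
    then show ?case using lt[of k "Suc k"] by simp
  qed
  define p where "p i = (if i < n then nat (l ! (n - 1 - i) + int i + 1) else 0)" for i
  have pos: "part_pos p i = l ! (n - 1 - i)" if "i < n" for i
    using ge[of "n - 1 - i"] that by (auto simp: part_pos_def p_def)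
  show ?thesis
  proof (rule that)
    have "p (Suc i) \<le> p i" for i
    proof (cases "Suc i < n")
      case True
      then have "l ! (n - 1 - Suc i) < l ! (n - 1 - i)" by (intro lt) auto
      then show ?thesis
        using True by (simp add: p_def nat_mono)
    qed (simp add: p_def)
    then show "p \<in> bounded_partitions n"
      by (intro bounded_partitionsI) (auto simp: decseq_Suc_iff p_def)
    have "part_pos p ` {..<n} = (\<lambda>i. l ! i) ` ((\<lambda>i. n - 1 - i) ` {..<n})"
      unfolding image_image using pos by (intro image_cong) auto
    also have "(\<lambda>i. n - 1 - i) ` {..<n} = {..<n}"
    proof (intro equalityI subsetI)
      fix i assume "i \<in> {..<n}"
      then show "i \<in> (\<lambda>i. n - 1 - i) ` {..<n}"
        by (intro image_eqI[of _ _ "n - 1 - i"]) auto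
    qed auto
    also have "(\<lambda>i. l ! i) ` {..<n} = X"
      using l by (auto simp: in_set_conv_nth image_iff)
    finally show "part_pos p ` {..<n} = X" .
  qed
qed

abbreviation position_tuple :: "nat \<Rightarrow> (nat \<Rightarrow> nat) \<Rightarrow> (nat \<Rightarrow> nat) \<Rightarrow> nat \<Rightarrow> int" where
  "position_tuple n p \<pi> \<equiv> restrict (\<lambda>i. part_pos p (\<pi> i)) {..<n}"

text \<open>An injective tuple is a rearrangement of its decreasing sort, and the latter belongs to
  a unique partition. The lower bound \<open>- int n\<close> is the position of row
  \<open>n - 1\<close> when that row is empty.\<close>

lemma bij_betw_partition_permutation:
  "bij_betw (\<lambda>(p, \<pi>). position_tuple n p \<pi>)
     (bounded_partitions n \<times> {\<pi>. \<pi> permutes {..<n}})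
     {x \<in> {..<n} \<rightarrow>\<^sub>E {- int n..}. inj_on x {..<n}}"
proof (rule bij_betwI')
  fix a b assume "a \<in> bounded_partitions n \<times> {\<pi>. \<pi> permutes {..<n}}" "b \<in> bounded_partitions n \<times> {\<pi>. \<pi> permutes {..<n}}"
  then obtain p \<pi> q \<rho> where ab: "a = (p, \<pi>)" "b = (q, \<rho>)" and p: "p \<in> bounded_partitions n" and q: "q \<in> bounded_partitions n"
    and \<pi>: "\<pi> permutes {..<n}" and \<rho>: "\<rho> permutes {..<n}" by auto
  have part: "is_partition p" "is_partition q"
    using p q by (auto simp: bounded_partitions_def)
  have "p = q \<and> \<pi> = \<rho>" if eq: "position_tuple n p \<pi> = position_tuple n q \<rho>"
  proof
    have eq': "part_pos p (\<pi> i) = part_pos q (\<rho> i)" if "i < n" for i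
      using fun_cong[OF eq, of i] that by simp
    have "part_pos p ` {..<n} = part_pos p ` \<pi> ` {..<n}"
      using permutes_image[OF \<pi>] by simp
    also have "\<dots> = part_pos q ` \<rho> ` {..<n}"
      unfolding image_image using eq' by (intro image_cong) auto
    also have "\<dots> = part_pos q ` {..<n}"
      using permutes_image[OF \<rho>] by simp
    finally have pos: "part_pos p i = part_pos q i" if "i < n" for i
      using part_pos_image_unique[OF part _ that] by simp
    show "p = q"
    proof
      fix i show "p i = q i"
        using pos[of i] p q by (cases "i < n") (auto simp: part_pos_def bounded_partitions_def)
    qed
    show "\<pi> = \<rho>"
    proof
      fix i show "\<pi> i = \<rho> i"
      proof (cases "i < n")
        case True
        then have "part_pos p (\<pi> i) = part_pos p (\<rho> i)"
          using eq'[OF True] \<open>p = q\<close> by simp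
        then show ?thesis
          using inj_part_pos[OF part(1), of UNIV] by (auto dest: injD)
      next
        case False
        then show ?thesis using \<pi> \<rho> by (auto simp: permutes_def)
      qed
    qed
  qed
  then show "(case a of (p, \<pi>) \<Rightarrow> position_tuple n p \<pi>) =
      (case b of (p, \<pi>) \<Rightarrow> position_tuple n p \<pi>) \<longleftrightarrow> a = b"
    by (auto simp: ab)
next
  fix a assume "a \<in> bounded_partitions n \<times> {\<pi>. \<pi> permutes {..<n}}"
  then obtain p \<pi> where a: "a = (p, \<pi>)" and p: "p \<in> bounded_partitions n" and \<pi>: "\<pi> permutes {..<n}"
    by auto
  have part: "is_partition p"
    using p by (auto simp: bounded_partitions_def)
  have "part_pos p (\<pi> i) \<ge> - int n" if "i < n" for i
    using permutes_in_image[OF \<pi>, of i] that by (simp add: part_pos_def)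
  moreover have "inj_on (\<lambda>i. part_pos p (\<pi> i)) {..<n}"
    using comp_inj_on[OF permutes_inj_on[OF \<pi>] inj_part_pos[OF part]] by (simp add: o_def)
  ultimately show "(case a of (p, \<pi>) \<Rightarrow> position_tuple n p \<pi>) \<in> {x \<in> {..<n} \<rightarrow>\<^sub>E {- int n..}. inj_on x {..<n}}"
    by (auto simp: a inj_on_restrict_eq)
next
  fix x assume x: "x \<in> {x \<in> {..<n} \<rightarrow>\<^sub>E {- int n..}. inj_on x {..<n}}"
  then have inj: "inj_on x {..<n}" by simp
  obtain p where p: "p \<in> bounded_partitions n" "part_pos p ` {..<n} = x ` {..<n}"
    using ex_partition_of_positions[of "x ` {..<n}" n] x by (auto simp: card_image)
  have part: "is_partition p"
    using p by (auto simp: bounded_partitions_def)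
  have bij: "bij_betw (part_pos p) {..<n} (x ` {..<n})" "bij_betw x {..<n} (x ` {..<n})"
    using inj_part_pos[OF part] inj p(2) by (auto simp: bij_betw_def)
  define \<pi> where "\<pi> i = (if i < n then inv_into {..<n} (part_pos p) (x i) else i)" for i
  have "bij_betw (inv_into {..<n} (part_pos p) \<circ> x) {..<n} {..<n}"
    using bij(2) bij_betw_inv_into[OF bij(1)] by (rule bij_betw_trans)
  then have "bij_betw \<pi> {..<n} {..<n}"
    by (rule iffD1[OF bij_betw_cong, rotated]) (simp add: \<pi>_def)
  then have "\<pi> permutes {..<n}" by (rule bij_imp_permutes) (simp add: \<pi>_def)
  moreover have "part_pos p (\<pi> i) = x i" if "i < n" for i
    using bij_betw_inv_into_right[OF bij(1)] that by (simp add: \<pi>_def)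
  then have "x = position_tuple n p \<pi>"
    using x by (intro ext) (auto simp: PiE_def extensional_def restrict_def)
  ultimately show "\<exists>a\<in>bounded_partitions n \<times> {\<pi>. \<pi> permutes {..<n}}. x = (case a of (p, \<pi>) \<Rightarrow> position_tuple n p \<pi>)"
    using p(1) by (intro bexI[of _ "(p, \<pi>)"]) auto
qed

text \<open>Cauchy-Binet in terms of partitions. The Andreief sum has a plain product next to the
  determinant; summing over all rearrangements of one set of positions turns this product into the
  second determinant. Tuples with a repetition drop out because two rows agree.\<close>

lemma has_sum_partition_det_squared:
  fixes f :: "int \<Rightarrow> real" and b :: "nat \<Rightarrow> int \<Rightarrow> real"
  assumes b0: "\<And>j x. j < n \<Longrightarrow> x < - int n \<Longrightarrow> b j x = 0"
    and summable: "\<And>i j. i < n \<Longrightarrow> j < n \<Longrightarrow> (\<lambda>x. norm (f x * b i x * b j x)) summable_on UNIV"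
  shows "((\<lambda>p. (\<Prod>i<n. f (part_pos p i)) * (det_on {..<n} (\<lambda>i j. b j (part_pos p i)))\<^sup>2)
    has_sum det_on {..<n} (\<lambda>i j. \<Sum>\<^sub>\<infinity>x. f x * b i x * b j x)) (bounded_partitions n)"
proof -
  define F where "F x = (\<Prod>i<n. f (x i) * b i (x i)) * det_on {..<n} (\<lambda>i j. b j (x i))" for x :: "nat \<Rightarrow> int"
  let ?P = "{\<pi>. \<pi> permutes {..<n}}" and ?D = "det_on {..<n} (\<lambda>i j. \<Sum>\<^sub>\<infinity>x. f x * b i x * b j x)"
  have "(F has_sum det_on {..<n} (\<lambda>i j. \<Sum>\<^sub>\<infinity>x\<in>{- int n..}. f x * b i x * b j x)) ({..<n} \<rightarrow>\<^sub>E {- int n..})"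
    unfolding F_def using summable by (intro andreief) (auto intro: summable_on_subset_banach)
  also have "det_on {..<n} (\<lambda>i j. \<Sum>\<^sub>\<infinity>x\<in>{- int n..}. f x * b i x * b j x) = ?D"
    by (intro det_on_cong infsum_cong_neutral) (auto simp: b0)
  finally have "(F has_sum ?D) ({..<n} \<rightarrow>\<^sub>E {- int n..})" .
  moreover have "F x = 0" if not_inj: "\<not> inj_on x {..<n}" for x
  proof -
    obtain i k where "i < n" "k < n" "i \<noteq> k" "x i = x k"
      using not_inj unfolding inj_on_def by blast
    then have "det_on {..<n} (\<lambda>i j. b j (x i)) = 0"
      by (intro det_on_identical_rows[of i k]) auto
    then show ?thesis by (simp add: F_def)
  qed
  ultimately have "(F has_sum ?D) {x \<in> {..<n} \<rightarrow>\<^sub>E {- int n..}. inj_on x {..<n}}"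
    by (subst has_sum_cong_neutral[where g = F and T = "{..<n} \<rightarrow>\<^sub>E {- int n..}"]) auto
  then have "((\<lambda>a. F (case a of (p, \<pi>) \<Rightarrow> position_tuple n p \<pi>)) has_sum ?D) (bounded_partitions n \<times> ?P)"
    by (subst has_sum_reindex_bij_betw[OF bij_betw_partition_permutation])
  then have "((\<lambda>p. \<Sum>\<pi>\<in>?P. F (position_tuple n p \<pi>)) has_sum ?D) (bounded_partitions n)"
    by (rule has_sum_SigmaD) (auto intro!: has_sum_finite finite_permutations)
  moreover have "(\<Sum>\<pi>\<in>?P. F (position_tuple n p \<pi>)) =
      (\<Prod>i<n. f (part_pos p i)) * (det_on {..<n} (\<lambda>i j. b j (part_pos p i)))\<^sup>2" for p
  proof -
    let ?d = "det_on {..<n} (\<lambda>i j. b j (part_pos p i))"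
    have "F (position_tuple n p \<pi>) =
        of_int (sign \<pi>) * (\<Prod>i<n. b i (part_pos p (\<pi> i)) * f (part_pos p (\<pi> i))) * ?d" if "\<pi> \<in> ?P" for \<pi>
    proof -
      have "det_on {..<n} (\<lambda>i j. b j (position_tuple n p \<pi> i)) =
          det_on {..<n} (\<lambda>i j. b j (part_pos p (\<pi> i)))" by (intro det_on_cong) auto
      also have "\<dots> = of_int (sign \<pi>) * ?d"
        using that det_on_permute_rows[of \<pi> n "\<lambda>i j. b j (part_pos p i)"] by simp
      finally show ?thesis by (simp add: F_def mult_ac)
    qed
    then have "(\<Sum>\<pi>\<in>?P. F (position_tuple n p \<pi>)) =
        det_on {..<n} (\<lambda>i k. b i (part_pos p k) * f (part_pos p k)) * ?d"
      by (simp add: det_on_def sum_distrib_right)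
    also have "det_on {..<n} (\<lambda>i k. b i (part_pos p k) * f (part_pos p k)) = (\<Prod>i<n. f (part_pos p i)) * ?d"
      using det_on_transpose[of "{..<n}" "\<lambda>i j. b j (part_pos p i)"] by (simp add: det_on_mult_right)
    finally show ?thesis by (simp only: power2_eq_square mult.assoc)
  qed
  ultimately show ?thesis by simp
qed

section \<open>Bessel functions of integer order\<close>

lemma ecoeff_nonneg: "s \<ge> 0 \<Longrightarrow> ecoeff s k \<ge> 0" by (simp add: ecoeff_def)


lemma abs_ecoeff: "\<bar>ecoeff s k\<bar> = ecoeff \<bar>s\<bar> k"
  by (simp add: ecoeff_def power_abs)

lemma has_sum_ecoeff_nat: "((\<lambda>k. ecoeff s (int k)) has_sum exp s) UNIV"
proof (rule norm_summable_imp_has_sum)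
  show "summable (\<lambda>k. norm (ecoeff s (int k)))"
    using summable_exp[of "\<bar>s\<bar>"] by (simp add: ecoeff_of_nat abs_mult power_abs divide_inverse mult.commute)
  show "(\<lambda>k. ecoeff s (int k)) sums exp s"
    using exp_converges[of s] by (simp add: ecoeff_of_nat scaleR_conv_of_real divide_inverse mult.commute)
qed

lemma has_sum_ecoeff: "((\<lambda>k. ecoeff s (k + d)) has_sum exp s) UNIV"
proof -
  have "((\<lambda>k. ecoeff s (k + d)) has_sum exp s) (range (\<lambda>k. int k - d))"
    using has_sum_ecoeff_nat[of s] by (subst has_sum_reindex) (auto simp: inj_on_def o_def)
  moreover have "k \<in> range (\<lambda>k. int k - d)" if "k + d \<ge> 0" for k
    using that by (intro image_eqI[of _ _ "nat (k + d)"]) auto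
  then have "ecoeff s (k + d) = 0" if "k \<notin> range (\<lambda>k. int k - d)" for k
    using that by (metis ecoeff_neg not_le)
  ultimately show ?thesis
    by (subst has_sum_cong_neutral[where g = "\<lambda>k. ecoeff s (k + d)" and T = "range (\<lambda>k. int k - d)"]) auto
qed

lemma ecoeff_le_exp: "s \<ge> 0 \<Longrightarrow> ecoeff s k \<le> exp s"
  using finite_sum_le_has_sum[OF has_sum_ecoeff[of s 0], of "{k}"] by (simp add: ecoeff_nonneg)

lemma summable_on_mult_bounded:
  fixes f g :: "'x \<Rightarrow> real"
  assumes "(\<lambda>x. norm (f x)) summable_on A" "\<And>x. x \<in> A \<Longrightarrow> norm (g x) \<le> C"
  shows "(\<lambda>x. norm (f x * g x)) summable_on A"
proof (rule Infinite_Sum.abs_summable_on_comparison_test)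
  show "(\<lambda>x. norm (C * norm (f x))) summable_on A"
    using summable_on_cmult_right[OF assms(1), of "\<bar>C\<bar>"] by (simp add: abs_mult)
  show "norm (f x * g x) \<le> norm (C * norm (f x))" if "x \<in> A" for x
    using mult_left_mono[OF order_trans[OF assms(2)[OF that] abs_ge_self], of "norm (f x)"]
    by (simp add: abs_mult mult.commute)
qed

lemma summable_on_prodI:
  fixes f :: "'x \<Rightarrow> 'y \<Rightarrow> real"
  assumes "\<And>x. x \<in> A \<Longrightarrow> ((\<lambda>y. norm (f x y)) has_sum g x) B" "g summable_on A"
  shows "(\<lambda>(x, y). norm (f x y)) summable_on A \<times> B" "(\<lambda>(x, y). f x y) summable_on A \<times> B"
proof -
  show *: "(\<lambda>(x, y). norm (f x y)) summable_on A \<times> B"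
    by (rule summable_on_SigmaI[where g = g]) (use assms in auto)
  show "(\<lambda>(x, y). f x y) summable_on A \<times> B"
    by (rule abs_summable_summable) (use * in \<open>simp add: case_prod_unfold\<close>)
qed

lemma sum_ecoeff_antidiagonal:
  "(\<Sum>k\<le>l. ecoeff s (int (l - k)) * ecoeff (- s) (int k)) = (if l = 0 then 1 else 0)"
proof -
  have "(\<Sum>k\<le>l. ecoeff s (int (l - k)) * ecoeff (- s) (int k)) = (\<Sum>k\<le>l. of_nat (l choose k) * (- s) ^ k * s ^ (l - k)) / fact l"
    unfolding sum_divide_distrib ecoeff_of_nat by (intro sum.cong refl) (simp add: binomial_fact mult_ac)
  also have "\<dots> = (if l = 0 then 1 else 0)" by (simp flip: binomial_ring add: power_0_left)
  finally show ?thesis .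
qed

text \<open>The product of the series \<open>exp (s z)\<close> and \<open>exp (- s z)\<close> is 1.\<close>

lemma infsum_ecoeff_cancel:
  assumes "\<And>l. norm (h l) \<le> C"
  shows "(\<Sum>\<^sub>\<infinity>y. \<Sum>\<^sub>\<infinity>k. ecoeff s (int y) * ecoeff (- s) (int k) * h (y + k)) = h 0"
proof -
  let ?f = "\<lambda>y k. ecoeff s (int y) * ecoeff (- s) (int k) * h (y + k)"
  have norm1: "((\<lambda>k. norm (ecoeff s (int y) * ecoeff (- s) (int k))) has_sum ecoeff \<bar>s\<bar> (int y) * exp \<bar>s\<bar>) UNIV" for y
    using has_sum_cmult_right[OF has_sum_ecoeff_nat[of "\<bar>s\<bar>"], of "ecoeff \<bar>s\<bar> (int y)"]
    by (simp add: abs_mult abs_ecoeff)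
  have "(\<lambda>(y, k). norm (ecoeff s (int y) * ecoeff (- s) (int k))) summable_on UNIV \<times> UNIV"
    by (rule summable_on_prodI[OF norm1]) (intro summable_on_cmult_left has_sum_imp_summable[OF has_sum_ecoeff_nat])
  then have "(\<lambda>a. norm ((case a of (y, k) \<Rightarrow> ecoeff s (int y) * ecoeff (- s) (int k)) * h (fst a + snd a))) summable_on UNIV \<times> UNIV"
    by - (rule summable_on_mult_bounded[where C = C], simp only: case_prod_unfold, rule assms)
  then have summable: "(\<lambda>(y, k). ?f y k) summable_on UNIV \<times> UNIV"
    by - (rule abs_summable_summable, simp only: case_prod_unfold fst_conv snd_conv)
  \<comment> \<open>The pairs \<open>(y, k)\<close> are regrouped by \<open>l = y + k\<close>, since
    the factor \<open>h\<close> depends on \<open>l\<close> alone.\<close>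
  have bij: "bij_betw (\<lambda>(l, k). (l - k, k)) (Sigma UNIV (\<lambda>l. {..l})) (UNIV \<times> UNIV :: (nat \<times> nat) set)"
    by (rule bij_betwI[where g = "\<lambda>(y, k). (y + k, k)"]) auto
  have "(\<Sum>\<^sub>\<infinity>y. \<Sum>\<^sub>\<infinity>k. ?f y k) = (\<Sum>\<^sub>\<infinity>(y, k)\<in>UNIV \<times> UNIV. ?f y k)"
    by (rule infsum_Sigma'_banach[OF summable])
  also have "\<dots> = (\<Sum>\<^sub>\<infinity>a\<in>Sigma UNIV (\<lambda>l. {..l}). case (case a of (l, k) \<Rightarrow> (l - k, k)) of (y, k) \<Rightarrow> ?f y k)"
    by (rule infsum_reindex_bij_betw[OF bij, symmetric])
  also have "\<dots> = (\<Sum>\<^sub>\<infinity>(l, k)\<in>Sigma UNIV (\<lambda>l. {..l}). ?f (l - k) k)"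
    by (intro infsum_cong) auto
  also have "\<dots> = (\<Sum>\<^sub>\<infinity>l. \<Sum>\<^sub>\<infinity>k\<in>{..l}. ?f (l - k) k)"
  proof (rule infsum_Sigma'_banach[symmetric])
    have "(\<lambda>a. case (case a of (l, k) \<Rightarrow> (l - k, k)) of (y, k) \<Rightarrow> ?f y k) summable_on Sigma UNIV (\<lambda>l. {..l})"
      using summable summable_on_reindex_bij_betw[OF bij, of "\<lambda>(y, k). ?f y k"] by blast
    then show "(\<lambda>(l, k). ?f (l - k) k) summable_on Sigma UNIV (\<lambda>l. {..l})"
      by (simp add: case_prod_unfold)
  qed
  also have "\<dots> = (\<Sum>\<^sub>\<infinity>l. (\<Sum>k\<le>l. ecoeff s (int (l - k)) * ecoeff (- s) (int k)) * h l)"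
    by (intro infsum_cong) (simp add: sum_distrib_right)
  also have "\<dots> = (\<Sum>\<^sub>\<infinity>l\<in>{0}. h l)"
    unfolding sum_ecoeff_antidiagonal by (intro infsum_cong_neutral) auto
  finally show ?thesis by simp
qed

text \<open>For integers \<open>x\<close>, this is the Bessel function \<open>J\<^sub>x(2s)\<close>.\<close>

definition bes :: "real \<Rightarrow> int \<Rightarrow> real" where
  "bes s x = (\<Sum>\<^sub>\<infinity>k. ecoeff (- s) (int k) * ecoeff s (x + int k))"

text \<open>For \<open>s >= 0\<close>, the Bessel series from index \<open>m\<close> on with all
  signs removed. It majorises the Bessel function itself (\<open>m = 0\<close>) and the remainder
  after truncation (\<open>m = n - j\<close>), and it is summable over all \<open>x\<close>.\<close>

definition bes_tail :: "real \<Rightarrow> nat \<Rightarrow> int \<Rightarrow> real" where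
  "bes_tail s m x = (\<Sum>\<^sub>\<infinity>k\<in>{m..}. ecoeff s (int k) * ecoeff s (x + int k))"

lemma bes_summable:
  assumes "s \<ge> 0"
  shows "(\<lambda>k. norm (ecoeff (- s) (int k) * ecoeff s (x + int k))) summable_on A"
proof (rule summable_on_mult_bounded)
  show "(\<lambda>k. norm (ecoeff (- s) (int k))) summable_on A"
    unfolding real_norm_def abs_ecoeff by (rule summable_on_subset_banach[OF has_sum_imp_summable[OF has_sum_ecoeff_nat]]) simp
  show "norm (ecoeff s (x + int k)) \<le> exp s" for k
    using assms by (simp add: abs_ecoeff ecoeff_le_exp)
qed

lemma bes_tail_summable:
  assumes "s \<ge> 0"
  shows "(\<lambda>k. ecoeff s (int k) * ecoeff s (x + int k)) summable_on A"
  using bes_summable[OF assms, of x A] assms by (simp add: abs_mult abs_ecoeff)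

lemma bes_tail_nonneg: "s \<ge> 0 \<Longrightarrow> bes_tail s m x \<ge> 0"
  unfolding bes_tail_def by (intro infsum_nonneg mult_nonneg_nonneg ecoeff_nonneg)

lemma bes_le_bes_tail:
  assumes "s \<ge> 0"
  shows "norm (bes s x) \<le> bes_tail s 0 x"
  unfolding bes_def bes_tail_def
  using norm_infsum_bound[OF bes_summable[OF assms, of x UNIV]] assms
  by (simp add: abs_mult abs_ecoeff)

lemma ecoeff_add_le:
  assumes "s \<ge> 0"
  shows "ecoeff s (int (m + l)) \<le> ecoeff s (int m) * ecoeff s (int l)"
proof -
  have "fact m * fact l \<le> (fact (m + l) :: real)"
    using dvd_imp_le[OF fact_fact_dvd_fact[of m l]] by (metis fact_gt_zero of_nat_fact of_nat_le_iff of_nat_mult)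
  then have "s ^ (m + l) / fact (m + l) \<le> s ^ (m + l) / (fact m * fact l)"
    using assms by (intro divide_left_mono) auto
  then show ?thesis
    unfolding ecoeff_of_nat by (simp add: power_add)
qed

lemma sum_ecoeff_tail_le:
  assumes "s \<ge> 0"
  shows "(\<Sum>\<^sub>\<infinity>k\<in>{m..}. ecoeff s (int k)) \<le> ecoeff s (int m) * exp s"
proof -
  have "(\<Sum>\<^sub>\<infinity>k\<in>{m..}. ecoeff s (int k)) = (\<Sum>\<^sub>\<infinity>l. ecoeff s (int (m + l)))"
    by (rule infsum_reindex_bij_witness[of _ "\<lambda>l. m + l" "\<lambda>k. k - m"]) auto
  also have "\<dots> \<le> (\<Sum>\<^sub>\<infinity>l. ecoeff s (int m) * ecoeff s (int l))"
  proof (rule infsum_mono)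
    have "(\<lambda>k. ecoeff s (int k)) summable_on (range (\<lambda>l. m + l))"
      by (rule summable_on_subset_banach[OF has_sum_imp_summable[OF has_sum_ecoeff_nat]]) simp
    then show "(\<lambda>l. ecoeff s (int (m + l))) summable_on UNIV"
      by (subst (asm) summable_on_reindex) (auto simp: o_def simp del: of_nat_add)
    show "(\<lambda>l. ecoeff s (int m) * ecoeff s (int l)) summable_on UNIV"
      by (intro summable_on_cmult_right has_sum_imp_summable[OF has_sum_ecoeff_nat])
    show "ecoeff s (int (m + l)) \<le> ecoeff s (int m) * ecoeff s (int l)" for l
      by (rule ecoeff_add_le[OF assms])
  qed
  also have "\<dots> = ecoeff s (int m) * exp s"
    using infsumI[OF has_sum_ecoeff_nat[of s]] by (simp add: infsum_cmult_right')
  finally show ?thesis .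
qed

lemma bes_tail_le:
  assumes "s \<ge> 0"
  shows "bes_tail s m x \<le> ecoeff s (int m) * exp s * exp s"
proof -
  have "bes_tail s m x \<le> (\<Sum>\<^sub>\<infinity>k\<in>{m..}. ecoeff s (int k) * exp s)"
    unfolding bes_tail_def
    by (intro infsum_mono bes_tail_summable assms mult_left_mono ecoeff_le_exp ecoeff_nonneg summable_on_cmult_left
        summable_on_subset_banach[OF has_sum_imp_summable[OF has_sum_ecoeff_nat]]) auto
  also have "\<dots> = (\<Sum>\<^sub>\<infinity>k\<in>{m..}. ecoeff s (int k)) * exp s"
    by (rule infsum_cmult_left')
  also have "\<dots> \<le> ecoeff s (int m) * exp s * exp s"
    by (intro mult_right_mono sum_ecoeff_tail_le assms) simp
  finally show ?thesis .
qed

lemma bes_tail_has_sum: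
  assumes "s \<ge> 0"
  shows "((\<lambda>x. bes_tail s m (x + d)) has_sum (\<Sum>\<^sub>\<infinity>k\<in>{m..}. ecoeff s (int k)) * exp s) UNIV"
proof -
  let ?f = "\<lambda>k x. ecoeff s (int k) * ecoeff s (x + d + int k)"
  have row: "((\<lambda>x. ?f k x) has_sum ecoeff s (int k) * exp s) UNIV" for k
    using has_sum_cmult_right[OF has_sum_ecoeff[of s "d + int k"]] by (simp add: add.assoc)
  have summ: "(\<lambda>k. ecoeff s (int k) * exp s) summable_on {m..}"
    by (intro summable_on_cmult_left summable_on_subset_banach[OF has_sum_imp_summable[OF has_sum_ecoeff_nat]]) auto
  have "(\<lambda>(k, x). ?f k x) summable_on {m..} \<times> UNIV"
    by (rule summable_on_prodI(2)[OF _ summ])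
      (use row assms in \<open>simp add: abs_mult abs_ecoeff\<close>)
  then have 1: "(\<lambda>(x, k). ?f k x) summable_on UNIV \<times> {m..}"
    by (subst (asm) summable_on_swap) (simp add: case_prod_unfold)
  have "(\<lambda>x. bes_tail s m (x + d)) summable_on UNIV"
    unfolding bes_tail_def using summable_on_Sigma_banach[OF 1] by simp
  moreover have "(\<Sum>\<^sub>\<infinity>x. bes_tail s m (x + d)) = (\<Sum>\<^sub>\<infinity>k\<in>{m..}. \<Sum>\<^sub>\<infinity>x. ?f k x)"
    unfolding bes_tail_def by (rule infsum_swap_banach[OF 1])
  moreover have "\<dots> = (\<Sum>\<^sub>\<infinity>k\<in>{m..}. ecoeff s (int k) * exp s)"
    by (intro infsum_cong infsumI row)
  ultimately show ?thesis by (simp add: has_sum_iff infsum_cmult_left')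
qed

lemma bes_tail_infsum_le:
  assumes "s \<ge> 0"
  shows "(\<Sum>\<^sub>\<infinity>x. bes_tail s m (x + d)) \<le> ecoeff s (int m) * exp s * exp s"
  unfolding infsumI[OF bes_tail_has_sum[OF assms]]
  by (intro mult_right_mono sum_ecoeff_tail_le assms) simp

lemma bes_abs_summable:
  assumes "s \<ge> 0"
  shows "(\<lambda>x. norm (bes s (x + d))) summable_on UNIV"
  by (rule summable_on_comparison_test[OF has_sum_imp_summable[OF bes_tail_has_sum[OF assms, of 0 d]]])
    (use bes_le_bes_tail[OF assms] in auto)

lemma bes_bound:
  assumes "s \<ge> 0"
  shows "norm (bes s x) \<le> exp s * exp s"
  using order_trans[OF bes_le_bes_tail[OF assms] bes_tail_le[OF assms, of 0]]
  by (simp only: of_nat_0 ecoeff_0 mult_1)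

text \<open>The generating function of \<open>bes s\<close> is \<open>exp (s z - s / z)\<close>.
  Correlating with the coefficients of \<open>exp (s z)\<close> multiplies it by
  \<open>exp (s / z)\<close>, which leaves \<open>exp (s z)\<close>.\<close>

lemma infsum_bes_ecoeff:
  assumes s: "s \<ge> 0"
  shows "(\<Sum>\<^sub>\<infinity>x. bes s (x + i) * ecoeff s (x + m)) = ecoeff s (i - m)"
proof -
  have "(\<Sum>\<^sub>\<infinity>x. bes s (x + i) * ecoeff s (x + m)) = (\<Sum>\<^sub>\<infinity>x\<in>range (\<lambda>y. int y - m). bes s (x + i) * ecoeff s (x + m))"
  proof (rule infsum_cong_neutral)
    fix x assume "x \<in> UNIV - range (\<lambda>y. int y - m)"
    then have "x \<noteq> int (nat (x + m)) - m" by blast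
    then have "x + m < 0" by (simp split: if_splits)
    then show "bes s (x + i) * ecoeff s (x + m) = 0" by simp
  qed auto
  also have "\<dots> = (\<Sum>\<^sub>\<infinity>y. bes s (int y - m + i) * ecoeff s (int y))"
    by (subst infsum_reindex) (auto simp: inj_on_def o_def)
  also have "\<dots> = (\<Sum>\<^sub>\<infinity>y. \<Sum>\<^sub>\<infinity>k. ecoeff s (int y) * ecoeff (- s) (int k) * ecoeff s (i - m + int (y + k)))"
    unfolding bes_def infsum_cmult_left'[symmetric] by (intro infsum_cong) (simp add: algebra_simps)
  also have "\<dots> = ecoeff s (i - m + int 0)"
    by (rule infsum_ecoeff_cancel[where C = "exp s"]) (use s in \<open>simp add: abs_ecoeff ecoeff_le_exp\<close>)
  finally show ?thesis by simp
qed

text \<open>For \<open>d < n\<close> the cut-off loses nothing, since the terms with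
  \<open>k > d\<close> vanish; the full convolution is the coefficient of \<open>z^d\<close> in
  \<open>exp (s z) exp (- s z) = 1\<close>.\<close>

lemma sum_ecoeff_delta:
  assumes "d < int n"
  shows "(\<Sum>k<n. ecoeff (- s) (int k) * ecoeff s (d - int k)) = (if d = 0 then 1 else 0)"
proof (cases "d < 0")
  case False
  then obtain l where l: "d = int l" by (metis nat_eq_iff2 not_le)
  have "(\<Sum>k<n. ecoeff (- s) (int k) * ecoeff s (d - int k)) = (\<Sum>k\<le>l. ecoeff (- s) (int k) * ecoeff s (d - int k))"
    by (rule sum.mono_neutral_right) (use assms l in auto)
  also have "\<dots> = (\<Sum>k\<le>l. ecoeff s (int (l - k)) * ecoeff (- s) (int k))"
    by (intro sum.cong refl) (simp add: l of_nat_diff mult.commute)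
  finally show ?thesis by (simp only: sum_ecoeff_antidiagonal l of_nat_eq_0_iff)
qed auto

text \<open>Orthonormality reflects that \<open>exp (s z - s / z)\<close> times its value at
  \<open>1 / z\<close> is 1. Here the second Bessel function is expanded into its series, and
  \<open>infsum_bes_ecoeff\<close> sums each term over \<open>x\<close>.\<close>

lemma infsum_bes_bes:
  assumes s: "s \<ge> 0"
  shows "(\<Sum>\<^sub>\<infinity>x. bes s (x + i) * bes s (x + j)) = (if i = j then 1 else 0)"
proof -
  let ?f = "\<lambda>k x. ecoeff (- s) (int k) * (bes s (x + i) * ecoeff s (x + j + int k))"
  have s1: "(\<lambda>x. norm (bes s (x + i) * ecoeff s (x + j + int k))) summable_on UNIV" for k
    by (rule summable_on_mult_bounded[OF bes_abs_summable[OF s], where C = "exp s"])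
      (use s in \<open>simp add: abs_ecoeff ecoeff_le_exp\<close>)
  let ?B = "\<Sum>\<^sub>\<infinity>x. norm (bes s (x + i)) * exp s"
  have s2: "(\<lambda>x. norm (bes s (x + i)) * exp s) summable_on UNIV"
    by (intro summable_on_cmult_left bes_abs_summable s)
  have le: "norm (?f k x) \<le> ecoeff s (int k) * (norm (bes s (x + i)) * exp s)" for k x
    using s by (auto simp: abs_mult abs_ecoeff intro!: mult_left_mono ecoeff_le_exp ecoeff_nonneg)
  have "(\<lambda>(k, x). norm (ecoeff s (int k) * (norm (bes s (x + i)) * exp s))) summable_on UNIV \<times> UNIV"
  proof (rule summable_on_prodI(1))
    show "((\<lambda>x. norm (ecoeff s (int k) * (norm (bes s (x + i)) * exp s))) has_sum (ecoeff s (int k) * ?B)) UNIV" for k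
      using has_sum_cmult_right[OF has_sum_infsum[OF s2], of "ecoeff s (int k)"] s
      by (simp add: abs_mult abs_ecoeff)
    show "(\<lambda>k. ecoeff s (int k) * ?B) summable_on UNIV"
      by (intro summable_on_cmult_left has_sum_imp_summable[OF has_sum_ecoeff_nat])
  qed
  then have bound: "(\<lambda>a. norm (case a of (k, x) \<Rightarrow> ecoeff s (int k) * (norm (bes s (x + i)) * exp s))) summable_on UNIV \<times> UNIV"
    by (simp only: case_prod_unfold)
  have "(\<lambda>a. norm (case a of (k, x) \<Rightarrow> ?f k x)) summable_on UNIV \<times> UNIV"
  proof (rule Infinite_Sum.abs_summable_on_comparison_test[OF bound])
    fix a show "norm (case a of (k, x) \<Rightarrow> ?f k x) \<le> norm (case a of (k, x) \<Rightarrow> ecoeff s (int k) * (norm (bes s (x + i)) * exp s))"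
      unfolding case_prod_unfold by (rule order_trans[OF le]) simp
  qed
  then have 1: "(\<lambda>(k, x). ?f k x) summable_on UNIV \<times> UNIV"
    by (rule abs_summable_summable)
  have "(\<Sum>\<^sub>\<infinity>x. bes s (x + i) * bes s (x + j)) = (\<Sum>\<^sub>\<infinity>x. \<Sum>\<^sub>\<infinity>k. ?f k x)"
    unfolding bes_def[of s "_ + j"] infsum_cmult_right'[symmetric] by (intro infsum_cong) (simp add: mult_ac)
  also have "\<dots> = (\<Sum>\<^sub>\<infinity>k. \<Sum>\<^sub>\<infinity>x. ?f k x)"
    by (rule infsum_swap_banach[OF 1, symmetric])
  also have "\<dots> = (\<Sum>\<^sub>\<infinity>k. ecoeff (- s) (int k) * ecoeff s (i - j - int k))"
    unfolding infsum_cmult_right' by (intro infsum_cong) (simp add: infsum_bes_ecoeff[OF s] add.assoc diff_diff_eq)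
  also have "\<dots> = (\<Sum>\<^sub>\<infinity>k\<in>{..<Suc (nat (i - j))}. ecoeff (- s) (int k) * ecoeff s (i - j - int k))"
    by (rule infsum_cong_neutral) auto
  also have "\<dots> = (if i - j = 0 then 1 else 0)"
    by (simp only: infsum_finite finite_lessThan) (rule sum_ecoeff_delta, simp)
  finally show ?thesis by simp
qed

section \<open>The Gram matrix of truncated Bessel functions\<close>

text \<open>The first \<open>n - j\<close> terms of the series of \<open>J_(x+j+1)(2 s)\<close>.
  Term \<open>k\<close> involves column \<open>j + k\<close> of the matrix with entries
  \<open>ecoeff s (x + l + 1)\<close>, so this cut-off uses precisely the columns below
  \<open>n\<close>.\<close>

definition trunc_bes :: "real \<Rightarrow> nat \<Rightarrow> nat \<Rightarrow> int \<Rightarrow> real" where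
  "trunc_bes s n j x = (\<Sum>k<n - j. ecoeff (- s) (int k) * ecoeff s (x + int j + 1 + int k))"

text \<open>The truncations arise from the columns \<open>ecoeff s (x + l + 1)\<close> through the
  triangular matrix \<open>?U\<close>, whose diagonal entries are 1.\<close>

lemma det_trunc_bes:
  "det_on {..<n} (\<lambda>i j. trunc_bes s n j (X i)) = det_on {..<n} (\<lambda>i j. ecoeff s (X i + int j + 1))"
proof -
  let ?U = "\<lambda>l j. ecoeff (- s) (int l - int j)"
  have "trunc_bes s n j x = (\<Sum>l<n. ecoeff s (x + int l + 1) * ?U l j)" if "j < n" for j x
  proof -
    have "(\<Sum>l<n. ecoeff s (x + int l + 1) * ?U l j) = (\<Sum>l\<in>{j..<n}. ecoeff s (x + int l + 1) * ?U l j)"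
      by (rule sum.mono_neutral_right) auto
    also have "\<dots> = trunc_bes s n j x"
      unfolding trunc_bes_def
      by (rule sum.reindex_bij_witness[of _ "\<lambda>k. k + j" "\<lambda>l. l - j"]) (auto simp: of_nat_diff algebra_simps)
    finally show ?thesis ..
  qed
  then have "det_on {..<n} (\<lambda>i j. trunc_bes s n j (X i)) =
      det_on {..<n} (\<lambda>i j. \<Sum>l<n. ecoeff s (X i + int l + 1) * ?U l j)"
    by (intro det_on_cong) auto
  moreover have "det_on {..<n} ?U = 1"
    by (subst det_on_transpose[symmetric], simp, subst det_on_upper_triangular) auto
  ultimately show ?thesis by (simp add: det_on_mult)
qed

lemma trunc_bes_eq_0: "j < n \<Longrightarrow> x < - int n \<Longrightarrow> trunc_bes s n j x = 0"
  unfolding trunc_bes_def by (intro sum.neutral) auto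

lemma ecoeff_scale: "s \<noteq> 0 \<Longrightarrow> ecoeff s k = s powi k * ecoeff 1 k"
  by (simp add: ecoeff_def power_int_def)

text \<open>A power of \<open>s\<close> splits off every row and every column; the combined
  exponents \<open>part_pos p i + (i + 1) = p i\<close> add up to the size.\<close>

lemma det_ecoeff_part_pos:
  assumes "s > 0" "p \<in> bounded_partitions n"
  shows "det_on {..<n} (\<lambda>i j. ecoeff s (part_pos p i + int j + 1)) = s ^ psize p * pos_det n (part_pos p)"
proof -
  have "det_on {..<n} (\<lambda>i j. ecoeff s (part_pos p i + int j + 1)) =
     det_on {..<n} (\<lambda>i j. s powi part_pos p i * (ecoeff 1 (part_pos p i + int j + 1) * s powi (int j + 1)))"
    using assms(1) by (intro det_on_cong) (simp add: ecoeff_scale[of s] power_int_add)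
  also have "\<dots> = (\<Prod>i<n. s powi part_pos p i * s powi (int i + 1)) * pos_det n (part_pos p)"
    unfolding det_on_mult_left det_on_mult_right pos_det_def prod.distrib by simp
  also have "(\<Prod>i<n. s powi part_pos p i * s powi (int i + 1)) = (\<Prod>i<n. s ^ p i)"
    using assms(1) by (intro prod.cong refl) (simp add: part_pos_def flip: power_int_add)
  also have "\<dots> = s ^ psize p"
    using psize_bounded[of n p] assms(2) by (simp add: power_sum bounded_partitions_def)
  finally show ?thesis .
qed

lemma plancherel_weight_eq:
  assumes "\<alpha> > 0" "p \<in> bounded_partitions n"
  shows "plancherel_weight \<alpha> p =
    exp (- \<alpha>) * (det_on {..<n} (\<lambda>i j. trunc_bes (sqrt \<alpha>) n j (part_pos p i)))\<^sup>2"
proof -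
  have "(sqrt \<alpha> ^ psize p)\<^sup>2 = \<alpha> ^ psize p"
    using assms(1) by (simp flip: power_mult power_mult_distrib add: power_mult_distrib mult.commute[of _ 2]) (simp add: power_mult)
  moreover have "det_on {..<n} (\<lambda>i j. trunc_bes (sqrt \<alpha>) n j (part_pos p i)) = sqrt \<alpha> ^ psize p * pos_det n (part_pos p)"
    using assms by (simp only: det_trunc_bes det_ecoeff_part_pos real_sqrt_gt_zero)
  ultimately show ?thesis
    using assms by (simp add: plancherel_weight_def num_syt_eq_det power_mult_distrib) (simp add: power2_eq_square)
qed

definition rem_bes :: "real \<Rightarrow> nat \<Rightarrow> nat \<Rightarrow> int \<Rightarrow> real" where
  "rem_bes s n j x = bes s (x + int j + 1) - trunc_bes s n j x"

lemma norm_trunc_bes_le: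
  assumes "s \<ge> 0"
  shows "norm (trunc_bes s n j x) \<le> bes_tail s 0 (x + int j + 1)"
proof -
  have "norm (trunc_bes s n j x) \<le> (\<Sum>k<n - j. ecoeff s (int k) * ecoeff s (x + int j + 1 + int k))"
    unfolding trunc_bes_def by (rule order_trans[OF norm_sum]) (use assms in \<open>simp add: abs_mult abs_ecoeff\<close>)
  also have "\<dots> \<le> bes_tail s 0 (x + int j + 1)"
    unfolding bes_tail_def using assms
    by (intro finite_sum_le_infsum bes_tail_summable mult_nonneg_nonneg ecoeff_nonneg) auto
  finally show ?thesis .
qed

lemma norm_rem_bes_le:
  assumes "s \<ge> 0"
  shows "norm (rem_bes s n j x) \<le> bes_tail s (n - j) (x + int j + 1)"
proof -
  let ?f = "\<lambda>k. ecoeff (- s) (int k) * ecoeff s (x + int j + 1 + int k)"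
  have summable: "?f summable_on A" for A by (rule abs_summable_summable[OF bes_summable[OF assms]])
  have "bes s (x + int j + 1) = infsum ?f ({..<n - j} \<union> {n - j..})"
    unfolding bes_def by (intro infsum_cong_neutral) auto
  also have "\<dots> = infsum ?f {..<n - j} + infsum ?f {n - j..}"
    by (intro infsum_Un_disjoint summable) auto
  finally have "rem_bes s n j x = infsum ?f {n - j..}" by (simp add: rem_bes_def trunc_bes_def)
  also have "norm \<dots> \<le> (\<Sum>\<^sub>\<infinity>k\<in>{n - j..}. norm (?f k))"
    by (rule norm_infsum_bound[OF bes_summable[OF assms]])
  also have "\<dots> = bes_tail s (n - j) (x + int j + 1)"
    unfolding bes_tail_def using assms by (intro infsum_cong) (simp add: abs_mult abs_ecoeff)
  finally show ?thesis .
qed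

lemma abs_summable_rem_bes:
  assumes "s \<ge> 0"
  shows "(\<lambda>x. norm (rem_bes s n j x)) summable_on UNIV"
  using has_sum_imp_summable[OF bes_tail_has_sum[OF assms, of "n - j" "int j + 1"]]
  by (rule summable_on_comparison_test) (use norm_rem_bes_le[OF assms] in \<open>auto simp: add.assoc\<close>)

lemma abs_summable_trunc_bes:
  assumes "s \<ge> 0"
  shows "(\<lambda>x. norm (trunc_bes s n j x)) summable_on UNIV"
  using has_sum_imp_summable[OF bes_tail_has_sum[OF assms, of 0 "int j + 1"]]
  by (rule summable_on_comparison_test) (use norm_trunc_bes_le[OF assms] in \<open>auto simp: add.assoc\<close>)

lemma trunc_bes_bounded:
  assumes "s \<ge> 0"
  shows "norm (trunc_bes s n j x) \<le> exp s * exp s"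
  using order_trans[OF norm_trunc_bes_le[OF assms] bes_tail_le[OF assms, of 0]]
  by (simp only: of_nat_0 ecoeff_0 mult_1)

lemma rem_bes_bounded:
  assumes "s \<ge> 0"
  shows "norm (rem_bes s n j x) \<le> ecoeff s (int (n - j)) * exp s * exp s"
  using order_trans[OF norm_rem_bes_le[OF assms] bes_tail_le[OF assms]] .

text \<open>The sum that \<open>infsum_bes_ecoeff\<close> produces stops at \<open>n - j\<close>,
  and \<open>i - j < n - j\<close>. By \<open>sum_ecoeff_delta\<close> the truncation of one of the
  two functions therefore does not disturb the orthogonality relations.\<close>

lemma infsum_bes_trunc:
  assumes "s \<ge> 0" "i < n" "j < n"
  shows "(\<Sum>\<^sub>\<infinity>x. bes s (x + int i + 1) * trunc_bes s n j x) = (if i = j then 1 else 0)"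
proof -
  let ?f = "\<lambda>k x. ecoeff (- s) (int k) * (bes s (x + (int i + 1)) * ecoeff s (x + (int j + 1 + int k)))"
  have "((\<lambda>x. \<Sum>k<n - j. ?f k x) has_sum (\<Sum>k<n - j. ecoeff (- s) (int k) * ecoeff s (int i - int j - int k))) UNIV"
  proof (intro has_sum_finite_sum has_sum_cmult_right)
    fix k
    have "(\<lambda>x. norm (bes s (x + (int i + 1)) * ecoeff s (x + (int j + 1 + int k)))) summable_on UNIV"
      by (rule summable_on_mult_bounded[OF bes_abs_summable, where C = "exp s"])
        (use assms in \<open>simp_all add: abs_ecoeff ecoeff_le_exp\<close>)
    from has_sum_infsum[OF abs_summable_summable[OF this]]
    show "((\<lambda>x. bes s (x + (int i + 1)) * ecoeff s (x + (int j + 1 + int k))) has_sum ecoeff s (int i - int j - int k)) UNIV"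
      using assms by (simp only: infsum_bes_ecoeff) (simp add: algebra_simps)
  qed simp
  also have "(\<Sum>k<n - j. ecoeff (- s) (int k) * ecoeff s (int i - int j - int k)) = (if int i - int j = 0 then 1 else 0)"
    using assms by (intro sum_ecoeff_delta) (simp add: of_nat_diff)
  also have "(\<lambda>x. \<Sum>k<n - j. ?f k x) = (\<lambda>x. bes s (x + int i + 1) * trunc_bes s n j x)"
    by (simp add: trunc_bes_def sum_distrib_left add.assoc mult.left_commute)
  finally show ?thesis by (simp add: infsumI)
qed

definition gram :: "real \<Rightarrow> nat \<Rightarrow> nat \<Rightarrow> nat \<Rightarrow> real" where
  "gram s n i j = (\<Sum>\<^sub>\<infinity>x. trunc_bes s n i x * trunc_bes s n j x)"

lemma rem_bes_mult_summable:
  assumes "s \<ge> 0"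
  shows "(\<lambda>x. norm (rem_bes s n i x * rem_bes s n j x)) summable_on UNIV"
  by (rule summable_on_mult_bounded[OF abs_summable_rem_bes[OF assms] rem_bes_bounded[OF assms]])

lemma trunc_bes_mult_summable:
  assumes "s \<ge> 0"
  shows "(\<lambda>x. norm (trunc_bes s n i x * trunc_bes s n j x)) summable_on UNIV"
  by (rule summable_on_mult_bounded[OF abs_summable_trunc_bes[OF assms] trunc_bes_bounded[OF assms]])

text \<open>For \<open>r = b - t\<close> the inner products satisfy
  \<open>tt + bb = rr + bt + tb\<close>. Each of \<open>bb\<close>, \<open>bt\<close>,
  \<open>tb\<close> is the Kronecker delta, so \<open>tt\<close> is the delta plus
  \<open>rr\<close>.\<close>

lemma gram_eq:
  assumes s: "s \<ge> 0" and "i < n" "j < n"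
  shows "gram s n i j = (if i = j then 1 else 0) + (\<Sum>\<^sub>\<infinity>x. rem_bes s n i x * rem_bes s n j x)"
proof -
  let ?b = "\<lambda>i x. bes s (x + int i + 1)" and ?t = "trunc_bes s n" and ?r = "rem_bes s n"
  have b: "(\<lambda>x. norm (?b i x)) summable_on UNIV" for i
    using bes_abs_summable[OF s, of "int i + 1"] by (simp add: add.assoc)
  have tt: "(\<lambda>x. ?t i x * ?t j x) summable_on UNIV"
    by (rule abs_summable_summable[OF trunc_bes_mult_summable[OF s]])
  have rr: "(\<lambda>x. ?r i x * ?r j x) summable_on UNIV"
    by (rule abs_summable_summable[OF rem_bes_mult_summable[OF s]])
  have bt: "(\<lambda>x. ?b i x * ?t j x) summable_on UNIV" for i j
    by (rule abs_summable_summable[OF summable_on_mult_bounded[OF b trunc_bes_bounded[OF s]]])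
  have bb: "(\<lambda>x. ?b i x * ?b j x) summable_on UNIV"
    by (rule abs_summable_summable[OF summable_on_mult_bounded[OF b bes_bound[OF s]]])
  have "gram s n i j + (\<Sum>\<^sub>\<infinity>x. ?b i x * ?b j x) = (\<Sum>\<^sub>\<infinity>x. ?t i x * ?t j x + ?b i x * ?b j x)"
    unfolding gram_def by (rule infsum_add[OF tt bb, symmetric])
  also have "\<dots> = (\<Sum>\<^sub>\<infinity>x. ?r i x * ?r j x + (?b i x * ?t j x + ?b j x * ?t i x))"
    by (intro infsum_cong) (simp add: rem_bes_def algebra_simps)
  also have "\<dots> = (\<Sum>\<^sub>\<infinity>x. ?r i x * ?r j x) + ((\<Sum>\<^sub>\<infinity>x. ?b i x * ?t j x) + (\<Sum>\<^sub>\<infinity>x. ?b j x * ?t i x))"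
    by (simp only: infsum_add[OF rr summable_on_add[OF bt bt]] infsum_add[OF bt bt])
  finally have "gram s n i j + (\<Sum>\<^sub>\<infinity>x. ?b i x * ?b j x) = \<dots>" .
  moreover have "(\<Sum>\<^sub>\<infinity>x. ?b i x * ?b j x) = (if i = j then 1 else 0)"
    using infsum_bes_bes[OF s, of "int i + 1" "int j + 1"] by (simp add: add.assoc)
  ultimately show ?thesis
    using assms by (simp add: infsum_bes_trunc)
qed

text \<open>The excess over the identity is the sum over \<open>x\<close> of the squares of
  \<open>v_1 r_1(x) + v_2 r_2(x) + ...\<close>. This inequality yields both the invertibility of the
  Gram matrix and an estimate for solutions that is independent of \<open>n\<close>.\<close>

lemma gram_quadratic_form:
  assumes s: "s \<ge> 0"
  shows "(\<Sum>i<n. v i * (\<Sum>j<n. gram s n i j * v j)) \<ge> (\<Sum>i<n. (v i)\<^sup>2)"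
proof -
  let ?r = "rem_bes s n"
  have "(\<Sum>i<n. v i * (\<Sum>j<n. gram s n i j * v j)) =
     (\<Sum>i<n. \<Sum>j<n. v i * v j * ((if i = j then 1 else 0) + (\<Sum>\<^sub>\<infinity>x. ?r i x * ?r j x)))"
    using s by (intro sum.cong refl) (simp add: sum_distrib_left gram_eq mult_ac)
  also have "\<dots> = (\<Sum>i<n. \<Sum>j<n. v i * v j * (if i = j then 1 else 0)) +
      (\<Sum>i<n. \<Sum>j<n. v i * v j * (\<Sum>\<^sub>\<infinity>x. ?r i x * ?r j x))"
    by (simp only: distrib_left sum.distrib)
  also have "(\<Sum>i<n. \<Sum>j<n. v i * v j * (if i = j then 1 else 0)) = (\<Sum>i<n. (v i)\<^sup>2)"
    by (intro sum.cong refl) (simp add: power2_eq_square if_distrib[of "(*) _"] cong: if_cong)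
  also have "(\<Sum>i<n. \<Sum>j<n. v i * v j * (\<Sum>\<^sub>\<infinity>x. ?r i x * ?r j x)) = (\<Sum>\<^sub>\<infinity>x. \<Sum>i<n. \<Sum>j<n. v i * v j * (?r i x * ?r j x))"
    by (intro infsumI[symmetric] has_sum_finite_sum has_sum_cmult_right has_sum_infsum
        abs_summable_summable[OF rem_bes_mult_summable[OF s]]) auto
  also have "\<dots> = (\<Sum>\<^sub>\<infinity>x. (\<Sum>i<n. v i * ?r i x)\<^sup>2)"
    by (simp add: power2_eq_square sum_product mult_ac)
  finally show ?thesis by (simp add: infsum_nonneg)
qed

lemma det_gram_nonzero:
  assumes s: "s \<ge> 0"
  shows "det_on {..<n} (gram s n) \<noteq> 0"
proof
  assume "det_on {..<n} (gram s n) = 0"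
  then obtain v where v: "\<And>i. i < n \<Longrightarrow> (\<Sum>j<n. gram s n i j * v j) = 0" "\<exists>j<n. v j \<noteq> 0"
    using det_on_zero_kernel[of n "gram s n"] by blast
  then have "(\<Sum>i<n. (v i)\<^sup>2) \<le> 0"
    using gram_quadratic_form[OF s, of v n] by simp
  moreover obtain j where "j < n" "v j \<noteq> 0" using v by auto
  then have "(\<Sum>i<n. (v i)\<^sup>2) > 0" by (intro sum_pos2[of _ j]) auto
  ultimately show False by simp
qed

text \<open>One remainder is summed over \<open>x\<close> and the other one is estimated uniformly.
  The bound is small unless both indices are close to \<open>n\<close>.\<close>

lemma norm_infsum_rem_bes_le:
  assumes s: "s \<ge> 0"
  shows "\<bar>\<Sum>\<^sub>\<infinity>x. rem_bes s n i x * rem_bes s n j x\<bar> \<le>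
    (ecoeff s (int (n - i)) * exp s * exp s) * (ecoeff s (int (n - j)) * exp s * exp s)"
proof -
  let ?t = "\<lambda>m. ecoeff s (int m) * exp s * exp s"
  have t0: "?t m \<ge> 0" for m
    using s by (intro mult_nonneg_nonneg ecoeff_nonneg) auto
  have "\<bar>\<Sum>\<^sub>\<infinity>x. rem_bes s n i x * rem_bes s n j x\<bar> \<le> (\<Sum>\<^sub>\<infinity>x. norm (rem_bes s n i x * rem_bes s n j x))"
    using norm_infsum_bound[OF rem_bes_mult_summable[OF s]] by simp
  also have "\<dots> \<le> (\<Sum>\<^sub>\<infinity>x. bes_tail s (n - i) (x + (int i + 1)) * ?t (n - j))"
  proof (rule infsum_mono[OF rem_bes_mult_summable[OF s]])
    show "(\<lambda>x. bes_tail s (n - i) (x + (int i + 1)) * ?t (n - j)) summable_on UNIV"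
      by (intro summable_on_cmult_left has_sum_imp_summable[OF bes_tail_has_sum[OF s]])
    show "norm (rem_bes s n i x * rem_bes s n j x) \<le> bes_tail s (n - i) (x + (int i + 1)) * ?t (n - j)" for x
      unfolding norm_mult using norm_rem_bes_le[OF s, of n i x] rem_bes_bounded[OF s, of n j x] bes_tail_nonneg[OF s]
      by (intro mult_mono) (auto simp: add.assoc)
  qed
  also have "\<dots> = (\<Sum>\<^sub>\<infinity>x. bes_tail s (n - i) (x + (int i + 1))) * ?t (n - j)"
    by (rule infsum_cmult_left')
  also have "\<dots> \<le> ?t (n - i) * ?t (n - j)"
    by (intro mult_right_mono bes_tail_infsum_le s t0)
  finally show ?thesis .
qed

section \<open>Convergence of the kernels\<close>

definition bes_kernel :: "real \<Rightarrow> int \<Rightarrow> int \<Rightarrow> real" where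
  "bes_kernel s x y = (\<Sum>j. bes s (x + int j + 1) * bes s (y + int j + 1))"

lemma summable_bes_tail:
  assumes "s \<ge> 0"
  shows "summable (\<lambda>j. bes_tail s m (x + int j + 1))"
proof -
  have "(\<lambda>k. bes_tail s m (k + (x + 1))) summable_on range int"
    by (rule summable_on_subset_banach[OF has_sum_imp_summable[OF bes_tail_has_sum[OF assms]]]) simp
  then have "(\<lambda>j. bes_tail s m (x + int j + 1)) summable_on UNIV"
    by (subst (asm) summable_on_reindex) (auto simp: o_def algebra_simps)
  then show ?thesis by (rule summable_on_imp_summable)
qed

lemma tendsto_trunc_bes:
  assumes "s \<ge> 0"
  shows "(\<lambda>n. trunc_bes s n j x) \<longlonglongrightarrow> bes s (x + int j + 1)"
proof -
  have "(\<lambda>k. ecoeff (- s) (int k) * ecoeff s (x + int j + 1 + int k)) sums bes s (x + int j + 1)"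
    unfolding bes_def
    by (intro has_sum_imp_sums has_sum_infsum abs_summable_summable[OF bes_summable[OF assms]])
  then have "(\<lambda>m. \<Sum>k<m. ecoeff (- s) (int k) * ecoeff s (x + int j + 1 + int k)) \<longlonglongrightarrow> bes s (x + int j + 1)"
    by (simp add: sums_def)
  moreover have "filterlim (\<lambda>n. n - j) at_top sequentially"
    by (rule filterlim_minus_const_nat_at_top)
  ultimately show ?thesis
    unfolding trunc_bes_def by (rule filterlim_compose)
qed

text \<open>Setting the terms with \<open>j >= n\<close> to 0 turns the growing range of summation
  into a fixed one, where Tannery's theorem applies.\<close>

lemma tannery_sum:
  fixes a :: "nat \<Rightarrow> nat \<Rightarrow> real"
  assumes lim: "\<And>j. (\<lambda>n. a j n) \<longlonglongrightarrow> b j"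
    and bound: "\<And>j n. j < n \<Longrightarrow> norm (a j n) \<le> M j" and M: "summable M" "\<And>j. M j \<ge> 0"
  shows "(\<lambda>n. \<Sum>j<n. a j n) \<longlonglongrightarrow> suminf b"
proof -
  let ?a = "\<lambda>j n. if j < n then a j n else 0"
  have "(\<lambda>n. suminf (\<lambda>j. ?a j n)) \<longlonglongrightarrow> suminf b"
  proof (rule conjunct2[OF conjunct2[OF tannerys_theorem[OF _ _ M(1)]]])
    show "(\<lambda>n. ?a j n) \<longlonglongrightarrow> b j" for j
      by (rule Lim_transform_eventually[OF lim]) (auto intro!: eventually_mono[OF eventually_gt_at_top[of j]])
    show "\<forall>\<^sub>F (j, n) in at_top \<times>\<^sub>F sequentially. norm (?a j n) \<le> M j"
      by (rule always_eventually) (use bound M in auto)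
  qed simp
  moreover have "suminf (\<lambda>j. ?a j n) = (\<Sum>j<n. a j n)" for n
    by (subst suminf_finite[of "{..<n}"]) auto
  ultimately show ?thesis by simp
qed

lemma tendsto_sum_trunc_bes:
  assumes s: "s \<ge> 0"
  shows "(\<lambda>n. \<Sum>j<n. trunc_bes s n j x * trunc_bes s n j y) \<longlonglongrightarrow> bes_kernel s x y"
  unfolding bes_kernel_def
proof (rule tannery_sum)
  show "norm (trunc_bes s n j x * trunc_bes s n j y) \<le> bes_tail s 0 (x + int j + 1) * (exp s * exp s)" for j n
    unfolding norm_mult using norm_trunc_bes_le[OF s, of n j x] trunc_bes_bounded[OF s, of n j y] bes_tail_nonneg[OF s]
    by (intro mult_mono) auto
  show "summable (\<lambda>j. bes_tail s 0 (x + int j + 1) * (exp s * exp s))"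
    by (intro summable_mult2 summable_bes_tail s)
qed (use s in \<open>auto intro!: tendsto_mult tendsto_trunc_bes mult_nonneg_nonneg bes_tail_nonneg\<close>)

text \<open>\<open>X n\<close> is the inverse Gram matrix applied to the truncated functions at
  \<open>y\<close>. Writing the Gram matrix as \<open>I + R\<close> gives
  \<open>X = b - R X\<close>, so only the contribution of \<open>R X\<close> has to disappear.
  \<open>R\<close> is concentrated at indices near \<open>n\<close>, whereas the values
  \<open>trunc_bes s n i x\<close> are dominated by a summable sequence in \<open>i\<close> that
  does not depend on \<open>n\<close>.\<close>

lemma tendsto_kernel:
  assumes s: "s \<ge> 0"
    and sol: "\<And>n i. i < n \<Longrightarrow> (\<Sum>j<n. gram s n i j * X n j) = trunc_bes s n i y"
  shows "(\<lambda>n. \<Sum>i<n. trunc_bes s n i x * X n i) \<longlonglongrightarrow> bes_kernel s x y"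
proof -
  define c where "c = exp s * exp s"
  define t where "t m = ecoeff s (int m) * exp s * exp s" for m
  define S where "S = (\<Sum>j. bes_tail s 0 (y + int j + 1))"
  let ?b = "\<lambda>n i x. trunc_bes s n i x"
  let ?R = "\<lambda>n i j. \<Sum>\<^sub>\<infinity>x. rem_bes s n i x * rem_bes s n j x"
  have c: "c > 0" and t0: "t m \<ge> 0" for m
    using s by (auto simp: c_def t_def intro!: mult_nonneg_nonneg ecoeff_nonneg)
  have sum_b: "(\<Sum>i<n. (?b n i y)\<^sup>2) \<le> S * c" for n
  proof -
    have "(\<Sum>i<n. (?b n i y)\<^sup>2) \<le> (\<Sum>i<n. bes_tail s 0 (y + int i + 1) * c)"
    proof (rule sum_mono)
      fix i
      have "\<bar>?b n i y\<bar> * \<bar>?b n i y\<bar> \<le> bes_tail s 0 (y + int i + 1) * c"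
        using norm_trunc_bes_le[OF s, of n i y] trunc_bes_bounded[OF s, of n i y] bes_tail_nonneg[OF s]
        unfolding c_def by (intro mult_mono) auto
      then show "(?b n i y)\<^sup>2 \<le> bes_tail s 0 (y + int i + 1) * c"
        by (simp add: power2_eq_square)
    qed
    also have "\<dots> = (\<Sum>i<n. bes_tail s 0 (y + int i + 1)) * c"
      by (simp add: sum_distrib_right)
    also have "\<dots> \<le> S * c"
      unfolding S_def using c s by (intro mult_right_mono sum_le_suminf summable_bes_tail bes_tail_nonneg) auto
    finally show ?thesis .
  qed
  \<comment> \<open>With \<open>G\<close> the Gram matrix,
    \<open>|X|^2 <= <X, G X> = <X, b> <= (|X|^2 + |b|^2) / 2\<close>, hence
    \<open>|X|^2 <= |b|^2\<close>.\<close>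
  have sum_X: "(\<Sum>i<n. (X n i)\<^sup>2) \<le> S * c" for n
  proof -
    have "(\<Sum>i<n. (X n i)\<^sup>2) \<le> (\<Sum>i<n. X n i * ?b n i y)"
      using gram_quadratic_form[OF s, of "X n" n] by (simp add: sol)
    also have "\<dots> \<le> (\<Sum>i<n. ((X n i)\<^sup>2 + (?b n i y)\<^sup>2) / 2)"
    proof (rule sum_mono)
      fix i show "X n i * ?b n i y \<le> ((X n i)\<^sup>2 + (?b n i y)\<^sup>2) / 2"
        using sum_squares_bound[of "X n i" "?b n i y"] by simp
    qed
    also have "\<dots> = ((\<Sum>i<n. (X n i)\<^sup>2) + (\<Sum>i<n. (?b n i y)\<^sup>2)) / 2"
      by (simp add: sum_divide_distrib[symmetric] sum.distrib)
    finally show ?thesis using sum_b[of n] by simp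
  qed
  have X_le: "\<bar>X n i\<bar> \<le> sqrt (S * c)" if "i < n" for n i
  proof -
    have "(X n i)\<^sup>2 \<le> (\<Sum>i<n. (X n i)\<^sup>2)"
      using that by (intro member_le_sum) auto
    then have "sqrt ((X n i)\<^sup>2) \<le> sqrt (S * c)"
      using sum_X[of n] by (intro real_sqrt_le_mono) simp
    then show ?thesis by simp
  qed
  have R: "\<bar>?R n i j\<bar> \<le> t (n - i) * t (n - j)" for n i j
    unfolding t_def by (rule norm_infsum_rem_bes_le[OF s])
  have sum_t: "(\<Sum>j<n. t (n - j)) \<le> exp s * c" for n
  proof -
    have inj: "inj_on (\<lambda>j. n - j) {..<n}" by (auto simp: inj_on_def)
    have "(\<Sum>j<n. ecoeff s (int (n - j))) = (\<Sum>m\<in>(\<lambda>j. n - j) ` {..<n}. ecoeff s (int m))"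
      by (simp add: sum.reindex[OF inj])
    also have "\<dots> \<le> exp s"
      using s by (intro finite_sum_le_has_sum[OF has_sum_ecoeff_nat]) (auto intro: ecoeff_nonneg)
    finally have "(\<Sum>j<n. ecoeff s (int (n - j))) * c \<le> exp s * c"
      using c by (intro mult_right_mono) auto
    then show ?thesis by (simp only: t_def c_def sum_distrib_right mult.assoc)
  qed
  have err: "\<bar>(\<Sum>i<n. ?b n i x * X n i) - (\<Sum>i<n. ?b n i x * ?b n i y)\<bar> \<le>
      (\<Sum>i<n. bes_tail s 0 (x + int i + 1) * t (n - i)) * (exp s * c * sqrt (S * c))" for n
  proof -
    have "?b n i y = X n i + (\<Sum>j<n. ?R n i j * X n j)" if "i < n" for i
    proof -
      have "?b n i y = (\<Sum>j<n. ((if i = j then 1 else 0) + ?R n i j) * X n j)"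
        using that by (subst sol[symmetric]) (auto intro!: sum.cong simp: gram_eq[OF s])
      also have "\<dots> = (\<Sum>j<n. (if i = j then 1 else 0) * X n j) + (\<Sum>j<n. ?R n i j * X n j)"
        by (simp only: distrib_right sum.distrib)
      also have "(\<Sum>j<n. (if i = j then 1 else 0) * X n j) = X n i"
        using that by (simp add: if_distrib[of "\<lambda>x. x * _"] cong: if_cong)
      finally show ?thesis .
    qed
    then have "(\<Sum>i<n. ?b n i x * X n i) - (\<Sum>i<n. ?b n i x * ?b n i y) = - (\<Sum>i<n. ?b n i x * (\<Sum>j<n. ?R n i j * X n j))"
      by (simp add: distrib_left sum.distrib)
    also have "\<bar>\<dots>\<bar> \<le> (\<Sum>i<n. \<bar>?b n i x * (\<Sum>j<n. ?R n i j * X n j)\<bar>)"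
      by (simp add: sum_abs)
    also have "\<dots> \<le> (\<Sum>i<n. bes_tail s 0 (x + int i + 1) * (t (n - i) * (exp s * c * sqrt (S * c))))"
    proof (rule sum_mono)
      fix i
      have "\<bar>\<Sum>j<n. ?R n i j * X n j\<bar> \<le> (\<Sum>j<n. \<bar>?R n i j * X n j\<bar>)"
        by (rule sum_abs)
      also have "\<dots> \<le> (\<Sum>j<n. t (n - i) * t (n - j) * sqrt (S * c))"
        unfolding abs_mult by (intro sum_mono mult_mono R X_le mult_nonneg_nonneg t0) auto
      also have "\<dots> = t (n - i) * ((\<Sum>j<n. t (n - j)) * sqrt (S * c))"
        by (simp add: sum_distrib_left sum_distrib_right mult_ac)
      also have "\<dots> \<le> t (n - i) * (exp s * c * sqrt (S * c))"
        using sum_t[of n] t0 order_trans[OF sum_nonneg sum_X[of 0]]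
        by (intro mult_left_mono mult_right_mono) auto
      finally have "\<bar>\<Sum>j<n. ?R n i j * X n j\<bar> \<le> \<dots>" .
      then show "\<bar>?b n i x * (\<Sum>j<n. ?R n i j * X n j)\<bar> \<le> bes_tail s 0 (x + int i + 1) * (t (n - i) * (exp s * c * sqrt (S * c)))"
        unfolding abs_mult using norm_trunc_bes_le[OF s, of n i x] bes_tail_nonneg[OF s]
        by (intro mult_mono) auto
    qed
    finally show ?thesis by (simp add: sum_distrib_right mult.assoc)
  qed
  \<comment> \<open>For fixed \<open>i\<close> the factor \<open>t (n - i)\<close> tends to 0, and
    \<open>bes_tail\<close> times an upper bound for \<open>t\<close> is the summable
    majorant.\<close>
  have "(\<lambda>n. \<Sum>i<n. bes_tail s 0 (x + int i + 1) * t (n - i)) \<longlonglongrightarrow> (\<Sum>i::nat. 0)"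
  proof (rule tannery_sum)
    fix i
    have "(\<lambda>m. ecoeff s (int m)) \<longlonglongrightarrow> 0"
      by (rule summable_LIMSEQ_zero[OF sums_summable[OF has_sum_imp_sums[OF has_sum_ecoeff_nat]]])
    then have "(\<lambda>m. t m) \<longlonglongrightarrow> 0 * exp s * exp s"
      unfolding t_def by (intro tendsto_mult tendsto_const)
    then have "(\<lambda>n. t (n - i)) \<longlonglongrightarrow> 0 * exp s * exp s"
      by (rule filterlim_compose) (rule filterlim_minus_const_nat_at_top)
    then show "(\<lambda>n. bes_tail s 0 (x + int i + 1) * t (n - i)) \<longlonglongrightarrow> 0"
      by (auto intro!: tendsto_mult_right_zero)
  next
    fix i n :: nat
    have "t (n - i) \<le> exp s * exp s * exp s"
      unfolding t_def using s by (intro mult_right_mono ecoeff_le_exp) auto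
    then show "norm (bes_tail s 0 (x + int i + 1) * t (n - i)) \<le> bes_tail s 0 (x + int i + 1) * (exp s * exp s * exp s)"
      using bes_tail_nonneg[OF s, of 0 "x + int i + 1"] t0[of "n - i"] by (simp add: abs_mult mult_left_mono)
  qed (use s in \<open>auto intro!: summable_mult2 summable_bes_tail mult_nonneg_nonneg bes_tail_nonneg\<close>)
  then have "(\<lambda>n. (\<Sum>i<n. bes_tail s 0 (x + int i + 1) * t (n - i)) * (exp s * c * sqrt (S * c))) \<longlonglongrightarrow> 0"
    by (intro tendsto_mult_left_zero) simp
  then have "(\<lambda>n. (\<Sum>i<n. ?b n i x * X n i) - (\<Sum>i<n. ?b n i x * ?b n i y)) \<longlonglongrightarrow> 0"
    by (rule Lim_null_comparison[rotated]) (use err in auto)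
  from tendsto_add[OF this tendsto_sum_trunc_bes[OF s, of x y]] show ?thesis by simp
qed

text \<open>The weight is 2 at the points \<open>g h\<close> and 1 elsewhere, so the weighted Gram
  matrix is \<open>gram\<close> plus one rank-one term for each of the \<open>k\<close> points.
  \<open>det_on_add_low_rank\<close> then reduces the second determinant to size \<open>k\<close>,
  which stays fixed as \<open>n\<close> grows.\<close>

lemma has_sum_bounded_partitions:
  fixes g :: "nat \<Rightarrow> int"
  assumes "\<alpha> > 0" "inj_on g {..<k}"
    and sol: "\<And>i h. i < n \<Longrightarrow> h < k \<Longrightarrow> (\<Sum>j<n. gram (sqrt \<alpha>) n i j * X j h) = trunc_bes (sqrt \<alpha>) n i (g h)"
  shows "((\<lambda>p. plancherel_weight \<alpha> p * (\<Prod>i<n. if part_pos p i \<in> g ` {..<k} then 2 else 1)) has_sum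
    exp (- \<alpha>) * det_on {..<n} (gram (sqrt \<alpha>) n) *
      det_on {..<k} (\<lambda>a b. (if a = b then 1 else 0) + (\<Sum>i<n. trunc_bes (sqrt \<alpha>) n i (g a) * X i b))) (bounded_partitions n)"
proof -
  let ?b = "trunc_bes (sqrt \<alpha>) n" and ?f = "\<lambda>x. if x \<in> g ` {..<k} then 2 else (1 :: real)"
  have s: "sqrt \<alpha> \<ge> 0" using assms by simp
  have summ: "(\<lambda>x. norm (?f x * ?b i x * ?b j x)) summable_on UNIV" for i j
  proof -
    have "(\<lambda>x. norm (?b i x * ?b j x * ?f x)) summable_on UNIV"
      by (rule summable_on_mult_bounded[OF trunc_bes_mult_summable[OF s], where C = 2]) auto
    then show ?thesis by (simp add: mult_ac)
  qed
  have "(\<Sum>\<^sub>\<infinity>x. ?f x * ?b i x * ?b j x) = gram (sqrt \<alpha>) n i j + (\<Sum>h<k. ?b i (g h) * ?b j (g h))" for i j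
  proof -
    let ?e = "\<lambda>x. if x \<in> g ` {..<k} then ?b i x * ?b j x else 0"
    have e: "(?e has_sum (\<Sum>x\<in>g ` {..<k}. ?b i x * ?b j x)) UNIV"
      by (subst has_sum_cong_neutral[where g = "\<lambda>x. ?b i x * ?b j x" and T = "g ` {..<k}"]) (auto intro!: has_sum_finite)
    have "(\<Sum>\<^sub>\<infinity>x. ?f x * ?b i x * ?b j x) = (\<Sum>\<^sub>\<infinity>x. ?b i x * ?b j x + ?e x)"
      by (intro infsum_cong) auto
    also have "\<dots> = gram (sqrt \<alpha>) n i j + infsum ?e UNIV"
      unfolding gram_def
      by (intro infsum_add abs_summable_summable[OF trunc_bes_mult_summable[OF s]] has_sum_imp_summable[OF e])
    also have "infsum ?e UNIV = (\<Sum>h<k. ?b i (g h) * ?b j (g h))"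
      using infsumI[OF e] assms(2) by (simp add: sum.reindex)
    finally show ?thesis .
  qed
  moreover have "((\<lambda>p. (\<Prod>i<n. ?f (part_pos p i)) * (det_on {..<n} (\<lambda>i j. ?b j (part_pos p i)))\<^sup>2)
    has_sum det_on {..<n} (\<lambda>i j. \<Sum>\<^sub>\<infinity>x. ?f x * ?b i x * ?b j x)) (bounded_partitions n)"
    by (rule has_sum_partition_det_squared[OF trunc_bes_eq_0 summ])
  ultimately have "((\<lambda>p. (\<Prod>i<n. ?f (part_pos p i)) * (det_on {..<n} (\<lambda>i j. ?b j (part_pos p i)))\<^sup>2)
    has_sum det_on {..<n} (\<lambda>i j. gram (sqrt \<alpha>) n i j + (\<Sum>h<k. ?b i (g h) * ?b j (g h)))) (bounded_partitions n)"
    by simp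
  also have "det_on {..<n} (\<lambda>i j. gram (sqrt \<alpha>) n i j + (\<Sum>h<k. ?b i (g h) * ?b j (g h))) =
     det_on {..<n} (gram (sqrt \<alpha>) n) * det_on {..<k} (\<lambda>a b. (if a = b then 1 else 0) + (\<Sum>i<n. ?b i (g a) * X i b))"
    using det_on_add_low_rank[of n k "gram (sqrt \<alpha>) n" X "\<lambda>i h. ?b i (g h)" "\<lambda>h j. ?b j (g h)"] sol by simp
  finally have "((\<lambda>p. exp (- \<alpha>) * ((\<Prod>i<n. ?f (part_pos p i)) * (det_on {..<n} (\<lambda>i j. ?b j (part_pos p i)))\<^sup>2))
    has_sum exp (- \<alpha>) * (det_on {..<n} (gram (sqrt \<alpha>) n) *
      det_on {..<k} (\<lambda>a b. (if a = b then 1 else 0) + (\<Sum>i<n. ?b i (g a) * X i b)))) (bounded_partitions n)"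
    by (rule has_sum_cmult_right)
  then show ?thesis
    unfolding mult.assoc
    by (rule has_sum_cong[THEN iffD1, rotated]) (simp add: plancherel_weight_eq[OF assms(1)])
qed

section \<open>Correlation functions\<close>

definition partitions :: "(nat \<Rightarrow> nat) set" where
  "partitions = {p. is_partition p}"

lemma plancherel_weight_nonneg: "\<alpha> > 0 \<Longrightarrow> plancherel_weight \<alpha> p \<ge> 0"
  by (simp add: plancherel_weight_def)

lemma sum_plancherel_weight:
  "(\<Sum>p\<in>partitions_of N. plancherel_weight \<alpha> p) = exp (- \<alpha>) * (\<alpha> ^ N / fact N)"
proof -
  have "(\<Sum>p\<in>partitions_of N. plancherel_weight \<alpha> p) =
      (\<Sum>p\<in>partitions_of N. exp (- \<alpha>) * (\<alpha> ^ N / fact N) / fact N * real ((num_syt p)\<^sup>2))"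
    by (intro sum.cong refl) (simp add: plancherel_weight_def partitions_of_def)
  also have "\<dots> = exp (- \<alpha>) * (\<alpha> ^ N / fact N) / fact N * real (\<Sum>p\<in>partitions_of N. (num_syt p)\<^sup>2)"
    by (simp only: sum_distrib_left of_nat_sum)
  finally show ?thesis by (simp add: sum_num_syt_squared)
qed

text \<open>The size is Poisson distributed with parameter \<open>\<alpha>\<close>, because the
  squares of \<open>num_syt\<close> add up to \<open>N!\<close>; this is its generating function.
  \<open>c = 1\<close> gives the total mass, and larger \<open>c\<close> gives the exponential
  moments that dominate the later expansions.\<close>

lemma has_sum_plancherel_growth:
  assumes "\<alpha> > 0" "c \<ge> 0"
  shows "((\<lambda>p. plancherel_weight \<alpha> p * c ^ psize p) has_sum exp (- \<alpha>) * exp (\<alpha> * c)) partitions"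
proof -
  let ?f = "\<lambda>p. plancherel_weight \<alpha> p * c ^ psize p"
  have inner: "(\<Sum>p\<in>partitions_of N. ?f p) = exp (- \<alpha>) * ecoeff (\<alpha> * c) (int N)" for N
  proof -
    have "(\<Sum>p\<in>partitions_of N. ?f p) = (\<Sum>p\<in>partitions_of N. plancherel_weight \<alpha> p) * c ^ N"
      unfolding sum_distrib_right by (intro sum.cong refl) (simp add: partitions_of_def)
    then show ?thesis by (simp add: sum_plancherel_weight ecoeff_of_nat power_mult_distrib)
  qed
  have bij: "bij_betw snd (Sigma UNIV partitions_of) partitions"
    by (rule bij_betwI[where g = "\<lambda>p. (psize p, p)"]) (auto simp: partitions_of_def partitions_def)
  have row: "((\<lambda>p. ?f (snd (N, p))) has_sum exp (- \<alpha>) * ecoeff (\<alpha> * c) (int N)) (partitions_of N)" for N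
    using has_sum_finite[OF finite_partitions_of[of N], of ?f] by (simp add: inner)
  have total: "((\<lambda>N. exp (- \<alpha>) * ecoeff (\<alpha> * c) (int N)) has_sum exp (- \<alpha>) * exp (\<alpha> * c)) UNIV"
    by (intro has_sum_cmult_right has_sum_ecoeff_nat)
  have "(\<lambda>a. ?f (snd a)) summable_on Sigma UNIV partitions_of"
    by (rule summable_on_SigmaI[OF row has_sum_imp_summable[OF total]])
      (use assms in \<open>auto intro!: mult_nonneg_nonneg plancherel_weight_nonneg\<close>)
  then obtain S where S: "((\<lambda>a. ?f (snd a)) has_sum S) (Sigma UNIV partitions_of)"
    by (auto simp: summable_on_def)
  have "S = exp (- \<alpha>) * exp (\<alpha> * c)"
    using has_sum_SigmaD[OF S row] total by (rule has_sum_unique)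
  then show ?thesis
    using S has_sum_reindex_bij_betw[OF bij, of ?f] by simp
qed

lemma has_sum_plancherel_weight:
  "\<alpha> > 0 \<Longrightarrow> (plancherel_weight \<alpha> has_sum 1) partitions"
  using has_sum_plancherel_growth[of \<alpha> 1] by (simp flip: exp_add)

text \<open>Monotone convergence: a finite set that nearly exhausts the sum is already contained in
  some \<open>A n\<close>.\<close>

lemma tendsto_infsum_incseq:
  fixes f :: "'x \<Rightarrow> real"
  assumes f: "f summable_on (\<Union>n. A n)" "\<And>x. x \<in> (\<Union>n. A n) \<Longrightarrow> f x \<ge> 0" and A: "incseq A"
  shows "(\<lambda>n. infsum f (A n)) \<longlonglongrightarrow> infsum f (\<Union>n. A n)"
proof (rule increasing_LIMSEQ)
  have summ: "f summable_on A n" for n by (rule summable_on_subset_banach[OF f(1)]) auto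
  show "infsum f (A n) \<le> infsum f (A (Suc n))" for n
    by (rule infsum_mono2[OF summ summ]) (use A f(2) in \<open>auto simp: incseq_Suc_iff\<close>)
  show "infsum f (A n) \<le> infsum f (\<Union>n. A n)" for n
    by (rule infsum_mono2[OF summ f(1)]) (use f(2) in auto)
  fix e :: real assume "e > 0"
  then obtain F where F: "finite F" "F \<subseteq> (\<Union>n. A n)" "infsum f (\<Union>n. A n) - e \<le> sum f F"
    using infsum_finite_approximation[OF f(1) \<open>e > 0\<close>] by (auto simp: dist_real_def)
  from F(1,2) have "\<exists>n. F \<subseteq> A n"
  proof (induction F rule: finite_induct)
    case (insert x F)
    then obtain n m where "F \<subseteq> A n" "x \<in> A m" by auto
    then have "insert x F \<subseteq> A (max n m)"
      using incseqD[OF A, of n "max n m"] incseqD[OF A, of m "max n m"] by auto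
    then show ?case by blast
  qed simp
  then obtain n where "F \<subseteq> A n" ..
  then have "sum f F \<le> infsum f (A n)"
    using F f(2) by (intro finite_sum_le_infsum summ) auto
  then show "\<exists>n. infsum f (\<Union>n. A n) \<le> infsum f (A n) + e"
    using F(3) by (intro exI[of _ n]) simp
qed

lemma bounded_partitions_mono: "n \<le> m \<Longrightarrow> bounded_partitions n \<subseteq> bounded_partitions m"
  by (auto simp: bounded_partitions_def)

lemma Union_bounded_partitions: "(\<Union>n. bounded_partitions n) = partitions"
  using partition_in_bounded by (auto simp: bounded_partitions_def partitions_def)

lemma plancherel_summable_bounded:
  assumes "\<alpha> > 0" "\<And>p. norm (u p) \<le> (C :: real)"
  shows "(\<lambda>p. plancherel_weight \<alpha> p * u p) summable_on partitions"
proof (rule abs_summable_summable, rule summable_on_mult_bounded)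
  show "(\<lambda>p. norm (plancherel_weight \<alpha> p)) summable_on partitions"
    using has_sum_imp_summable[OF has_sum_plancherel_weight[OF assms(1)]] plancherel_weight_nonneg[OF assms(1)] by simp
qed (rule assms)

text \<open>Rows from \<open>n\<close> on are empty and sit at positions below
  \<open>- int n\<close>, outside \<open>H\<close>, so the first \<open>n\<close> rows account for
  all of the intersection.\<close>

lemma prod_two_part_pos:
  assumes "p \<in> bounded_partitions n" "\<And>h. h \<in> H \<Longrightarrow> h \<ge> - int n"
  shows "(\<Prod>i<n. if part_pos p i \<in> H then 2 else 1 :: real) = 2 ^ card (H \<inter> range (part_pos p))"
proof -
  have p: "is_partition p" "\<And>i. i \<ge> n \<Longrightarrow> p i = 0"
    using assms by (auto simp: bounded_partitions_def)
  have "(\<Prod>i<n. if part_pos p i \<in> H then 2 else 1 :: real) = (\<Prod>i\<in>{i\<in>{..<n}. part_pos p i \<in> H}. 2)"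
    by (subst prod.inter_filter) auto
  also have "\<dots> = 2 ^ card (part_pos p ` {i\<in>{..<n}. part_pos p i \<in> H})"
    by (simp add: card_image[OF inj_part_pos[OF p(1)]])
  also have "part_pos p ` {i\<in>{..<n}. part_pos p i \<in> H} = H \<inter> range (part_pos p)"
  proof -
    have "i < n" if "part_pos p i \<in> H" for i
      using assms(2)[OF that] p(2)[of i] by (cases "i < n") (auto simp: part_pos_def)
    then show ?thesis by auto
  qed
  finally show ?thesis .
qed

lemma infsum_two_power_det:
  assumes \<alpha>: "\<alpha> > 0" and H: "finite H"
  shows "(\<Sum>\<^sub>\<infinity>p\<in>partitions. plancherel_weight \<alpha> p * 2 ^ card (H \<inter> range (part_pos p))) =
    det_on H (\<lambda>x y. (if x = y then 1 else 0) + bes_kernel (sqrt \<alpha>) x y)"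
proof -
  let ?s = "sqrt \<alpha>"
  have s: "?s \<ge> 0" using \<alpha> by simp
  obtain g where g: "bij_betw g {0..<card H} H"
    using ex_bij_betw_nat_finite[OF H] by blast
  define k where "k = card H"
  have g: "bij_betw g {..<k} H" "inj_on g {..<k}" "g ` {..<k} = H"
    using g by (auto simp: k_def lessThan_atLeast0 bij_betw_def)
  define X where "X y n = (SOME X. \<forall>i<n. (\<Sum>j<n. gram ?s n i j * X j) = trunc_bes ?s n i y)" for y n
  have X: "(\<Sum>j<n. gram ?s n i j * X y n j) = trunc_bes ?s n i y" if "i < n" for y n i
  proof -
    have "\<exists>X. \<forall>i<n. (\<Sum>j<n. gram ?s n i j * X j) = trunc_bes ?s n i y"
    proof (rule det_on_nonzero_solve[OF det_gram_nonzero[OF s], of n "\<lambda>i. trunc_bes ?s n i y"])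
      fix X assume "\<And>i. i < n \<Longrightarrow> (\<Sum>j<n. gram ?s n i j * X j) = trunc_bes ?s n i y"
      then show ?thesis by (intro exI[of _ X]) simp
    qed
    from someI_ex[OF this] show ?thesis
      using that unfolding X_def by simp
  qed
  let ?L = "\<lambda>n. exp (- \<alpha>) * det_on {..<n} (gram ?s n)"
  let ?D = "\<lambda>n. det_on {..<k} (\<lambda>a b. (if a = b then 1 else 0) + (\<Sum>i<n. trunc_bes ?s n i (g a) * X (g b) n i))"
  let ?u = "\<lambda>p. plancherel_weight \<alpha> p * 2 ^ card (H \<inter> range (part_pos p))"
  have incseq: "incseq bounded_partitions" by (auto simp: incseq_def bounded_partitions_mono)
  \<comment> \<open>The case without points: \<open>?L n\<close> is the mass of the partitions with
    at most \<open>n\<close> parts. It tends to the total mass 1, which replaces any evaluation of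
    the Gram determinant.\<close>
  have weight: "infsum (plancherel_weight \<alpha>) (bounded_partitions n) = ?L n" for n
    using has_sum_bounded_partitions[OF \<alpha>, of g 0 n "\<lambda>_ _. 0"] by (simp add: infsumI)
  have "(\<lambda>n. infsum (plancherel_weight \<alpha>) (bounded_partitions n)) \<longlonglongrightarrow> infsum (plancherel_weight \<alpha>) partitions"
    unfolding Union_bounded_partitions[symmetric]
    by (rule tendsto_infsum_incseq[OF _ plancherel_weight_nonneg[OF \<alpha>] incseq])
      (use has_sum_imp_summable[OF has_sum_plancherel_weight[OF \<alpha>]] in \<open>simp add: Union_bounded_partitions\<close>)
  then have L: "?L \<longlonglongrightarrow> 1"
    unfolding weight infsumI[OF has_sum_plancherel_weight[OF \<alpha>]] .
  have D: "?D \<longlonglongrightarrow> det_on {..<k} (\<lambda>a b. (if a = b then 1 else 0) + bes_kernel ?s (g a) (g b))"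
    unfolding det_on_def by (intro tendsto_intros tendsto_kernel[OF s] X)
  have "card (H \<inter> A) \<le> k" for A
    unfolding k_def by (intro card_mono H) auto
  then have "(\<lambda>p. ?u p) summable_on partitions"
    by (intro plancherel_summable_bounded[OF \<alpha>, where C = "2 ^ k"]) (auto simp: power_increasing)
  then have "(\<lambda>n. infsum ?u (bounded_partitions n)) \<longlonglongrightarrow> infsum ?u partitions"
    unfolding Union_bounded_partitions[symmetric]
    by (rule tendsto_infsum_incseq[OF _ _ incseq]) (simp add: plancherel_weight_nonneg[OF \<alpha>])
  moreover have "\<forall>\<^sub>F n in sequentially. infsum ?u (bounded_partitions n) = ?L n * ?D n"
  proof -
    obtain m where m: "\<And>h. h \<in> H \<Longrightarrow> h \<ge> - int m"
    proof (cases "H = {}")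
      case False
      then show ?thesis
        using that[of "nat \<bar>Min H\<bar>"] Min_le[OF H] by (smt (verit) int_nat_eq)
    qed auto
    have "infsum ?u (bounded_partitions n) = ?L n * ?D n" if "n \<ge> m" for n
    proof -
      have ge: "h \<ge> - int n" if "h \<in> H" for h
        using m[OF that] \<open>n \<ge> m\<close> by linarith
      have "infsum ?u (bounded_partitions n) =
         (\<Sum>\<^sub>\<infinity>p\<in>bounded_partitions n. plancherel_weight \<alpha> p * (\<Prod>i<n. if part_pos p i \<in> g ` {..<k} then 2 else 1))"
        unfolding g(3) by (intro infsum_cong) (simp add: prod_two_part_pos[OF _ ge])
      also have "\<dots> = ?L n * ?D n"
        by (intro infsumI has_sum_bounded_partitions[OF \<alpha> g(2)] X)
      finally show ?thesis .
    qed
    then show ?thesis by (auto simp: eventually_sequentially)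
  qed
  ultimately have "(\<lambda>n. ?L n * ?D n) \<longlonglongrightarrow> infsum ?u partitions"
    by (rule Lim_transform_eventually)
  then have "infsum ?u partitions = 1 * det_on {..<k} (\<lambda>a b. (if a = b then 1 else 0) + bes_kernel ?s (g a) (g b))"
    by (rule LIMSEQ_unique[OF _ tendsto_mult[OF L D]])
  also have "\<dots> = det_on {..<k} (\<lambda>a b. (if g a = g b then 1 else 0) + bes_kernel ?s (g a) (g b))"
    using g(2) by (simp, intro det_on_cong) (auto simp: inj_on_eq_iff)
  also have "\<dots> = det_on H (\<lambda>x y. (if x = y then 1 else 0) + bes_kernel ?s x y)"
    by (rule det_on_reindex[OF g(1)]) simp
  finally show ?thesis .
qed

definition correlation :: "real \<Rightarrow> int set \<Rightarrow> real" where
  "correlation \<alpha> H = (\<Sum>\<^sub>\<infinity>p\<in>partitions. plancherel_weight \<alpha> p * (if H \<subseteq> range (part_pos p) then 1 else 0))"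

theorem correlation_eq_det:
  assumes "\<alpha> > 0" "finite H"
  shows "correlation \<alpha> H = det_on H (bes_kernel (sqrt \<alpha>))"
  using assms(2)
proof (induction H rule: finite_psubset_induct)
  case (psubset H)
  let ?K = "bes_kernel (sqrt \<alpha>)"
  \<comment> \<open>The power counts the subsets of \<open>H\<close> contained in \<open>A\<close>.
    Its expectation is therefore the sum of the correlation functions of all subsets of
    \<open>H\<close>, and the proper ones cancel by induction.\<close>
  have "2 ^ card (H \<inter> A) = (\<Sum>T\<in>Pow H. if T \<subseteq> A then 1 else 0 :: real)" for A
  proof -
    have "(\<Sum>T\<in>Pow H. if T \<subseteq> A then 1 else 0 :: real) = (\<Sum>T\<in>{T \<in> Pow H. T \<subseteq> A}. 1)"
      using psubset.hyps by (subst sum.inter_filter) auto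
    also have "{T \<in> Pow H. T \<subseteq> A} = Pow (H \<inter> A)" by auto
    finally show ?thesis
      using card_Pow[of "H \<inter> A"] psubset.hyps by (simp del: Pow_Int_eq)
  qed
  then have "(\<Sum>\<^sub>\<infinity>p\<in>partitions. plancherel_weight \<alpha> p * 2 ^ card (H \<inter> range (part_pos p))) =
     (\<Sum>\<^sub>\<infinity>p\<in>partitions. \<Sum>T\<in>Pow H. plancherel_weight \<alpha> p * (if T \<subseteq> range (part_pos p) then 1 else 0))"
    by (simp only: sum_distrib_left)
  also have "\<dots> = (\<Sum>T\<in>Pow H. correlation \<alpha> T)"
    unfolding correlation_def using psubset.hyps
    by (intro infsumI has_sum_finite_sum has_sum_infsum plancherel_summable_bounded[OF assms(1), where C = 1]) auto
  finally have "(\<Sum>T\<in>Pow H. correlation \<alpha> T) = (\<Sum>T\<in>Pow H. det_on T ?K)"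
    using infsum_two_power_det[OF assms(1) psubset.hyps] det_on_one_plus[OF psubset.hyps, of ?K] by simp
  moreover have "(\<Sum>T\<in>Pow H. F T) = F H + (\<Sum>T\<in>Pow H - {H}. F T)" for F :: "int set \<Rightarrow> real"
    using psubset.hyps by (intro sum.remove) auto
  moreover have "(\<Sum>T\<in>Pow H - {H}. correlation \<alpha> T) = (\<Sum>T\<in>Pow H - {H}. det_on T ?K)"
    by (intro sum.cong refl psubset.IH) auto
  ultimately show ?case by simp
qed

section \<open>Derivatives with respect to the order\<close>

lemma DERIV_rGamma_real: "(rGamma has_field_derivative deriv rGamma z) (at (z :: real))"
proof -
  obtain d where "(rGamma has_field_derivative d) (at z)"
    using has_field_derivative_rGamma[of z UNIV] by blast
  then show ?thesis
    using DERIV_imp_deriv by fastforce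
qed

text \<open>This is the derivative of \<open>z * rGamma (z + 1) = rGamma z\<close>.\<close>

lemma rGamma_deriv_rec:
  assumes "(z :: real) \<noteq> 0"
  shows "deriv rGamma (z + 1) = (deriv rGamma z - rGamma (z + 1)) / z"
proof -
  have "((\<lambda>z. z * rGamma (z + 1)) has_field_derivative (1 * rGamma (z + 1) + deriv rGamma (z + 1) * z)) (at z)"
    using DERIV_rGamma_real[of "z + 1"] by (intro DERIV_mult DERIV_ident) (simp add: DERIV_shift)
  moreover have "(\<lambda>z. z * rGamma (z + 1)) = (rGamma :: real \<Rightarrow> real)"
    by (simp add: fun_eq_iff rGamma_plus1)
  ultimately have "deriv rGamma z = 1 * rGamma (z + 1) + deriv rGamma (z + 1) * z"
    using DERIV_imp_deriv by fastforce
  then show ?thesis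
    using assms by (simp add: field_simps)
qed

text \<open>A compactness bound on \<open>[1, 3]\<close> is carried to the right by the functional
  equation. The steps start in \<open>[2, 3]\<close>, so that always \<open>z >= 2\<close> and the
  recursion for the derivative returns at most \<open>(C + C) / 2 = C\<close>. On
  \<open>[1, 3]\<close> continuity of the derivative comes from its expression through
  \<open>Digamma\<close>.\<close>

lemma rGamma_bounded:
  "\<exists>C>0. \<forall>z\<ge>1. \<bar>rGamma z\<bar> \<le> (C :: real) \<and> \<bar>deriv rGamma z\<bar> \<le> C"
proof -
  let ?d = "\<lambda>z :: real. - rGamma z * Digamma z"
  have cont: "continuous_on {1..3 :: real} rGamma"
    using DERIV_isCont[OF DERIV_rGamma_real] by (intro continuous_at_imp_continuous_on) auto
  have cont': "continuous_on {1..3 :: real} ?d"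
    by (intro continuous_intros cont continuous_on_Polygamma) (auto elim!: nonpos_Ints_cases)
  have "compact (rGamma ` {1..3 :: real})" "compact (?d ` {1..3 :: real})"
    by (intro compact_continuous_image cont cont' compact_Icc)+
  then obtain A B where A: "\<And>z. z \<in> {1..3 :: real} \<Longrightarrow> norm (rGamma z) \<le> A"
    and B: "\<And>z. z \<in> {1..3 :: real} \<Longrightarrow> norm (?d z) \<le> B"
    by (metis (no_types, lifting) bounded_iff compact_imp_bounded imageI)
  define C where "C = max A B"
  have C: "\<bar>rGamma z\<bar> \<le> C \<and> \<bar>deriv rGamma z\<bar> \<le> C" if "z \<in> {1..3}" for z :: real
  proof -
    have "z \<notin> \<int>\<^sub>\<le>\<^sub>0" using that by (auto elim!: nonpos_Ints_cases)
    then have "deriv rGamma z = ?d z"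
      using has_field_derivative_rGamma[of z UNIV] by (intro DERIV_imp_deriv) simp
    then show ?thesis
      using A[OF that] B[OF that] by (auto simp: C_def)
  qed
  have "C \<ge> 1" using C[of 1] by simp
  have "\<bar>rGamma (w + real N)\<bar> \<le> C \<and> \<bar>deriv rGamma (w + real N)\<bar> \<le> C" if "w \<in> {2..3}" for w N
  proof (induction N)
    case 0
    then show ?case using C[of w] that by simp
  next
    case (Suc N)
    define z where "z = w + real N"
    have z: "z \<ge> 2" using that by (simp add: z_def)
    have "rGamma (z + 1) = rGamma z / z"
      using rGamma_plus1[of z] z by (simp add: field_simps)
    then have "\<bar>rGamma (z + 1)\<bar> = \<bar>rGamma z\<bar> / z"
      using z by simp
    also have "\<dots> \<le> C / 1"
      using Suc z \<open>C \<ge> 1\<close> unfolding z_def[symmetric] by (intro frac_le) auto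
    finally have 1: "\<bar>rGamma (z + 1)\<bar> \<le> C" by simp
    have "\<bar>deriv rGamma (z + 1)\<bar> = \<bar>deriv rGamma z - rGamma (z + 1)\<bar> / z"
      using rGamma_deriv_rec[of z] z by simp
    also have "\<dots> \<le> (C + C) / 2"
      using Suc 1 z \<open>C \<ge> 1\<close> unfolding z_def[symmetric]
      by (intro frac_le order_trans[OF abs_triangle_ineq4] add_mono) auto
    finally have 2: "\<bar>deriv rGamma (z + 1)\<bar> \<le> C" by simp
    have "w + real (Suc N) = z + 1" by (simp add: z_def)
    then show ?case using 1 2 by (simp only: simp_thms)
  qed
  note step = this
  have "\<bar>rGamma z\<bar> \<le> C \<and> \<bar>deriv rGamma z\<bar> \<le> C" if "z \<ge> 1" for z
  proof (cases "z \<le> 3")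
    case False
    define N where "N = nat \<lfloor>z - 2\<rfloor>"
    have "real N \<le> z - 2" "z - 2 < real N + 1"
      using False unfolding N_def by linarith+
    then show ?thesis
      using step[of "z - real N" N] by auto
  qed (use C that in auto)
  then show ?thesis
    using \<open>C \<ge> 1\<close> by (intro exI[of _ C]) simp
qed

section \<open>The Bessel series as a function of the order\<close>

definition bessel_term :: "real \<Rightarrow> nat \<Rightarrow> real \<Rightarrow> real" where
  "bessel_term s m \<nu> = (- 1) ^ m / fact m * rGamma (real m + \<nu> + 1) * s powr (2 * real m + \<nu>)"

definition bessel_term_deriv :: "real \<Rightarrow> nat \<Rightarrow> real \<Rightarrow> real" where
  "bessel_term_deriv s m \<nu> = (- 1) ^ m / fact m * (deriv rGamma (real m + \<nu> + 1) * s powr (2 * real m + \<nu>) +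
     rGamma (real m + \<nu> + 1) * (s powr (2 * real m + \<nu>) * ln s))"

lemma Bessel_J_eq: "Bessel_J \<nu> (2 * s) = (\<Sum>m. bessel_term s m \<nu>)"
  by (simp add: Bessel_J_def bessel_term_def)

lemma DERIV_bessel_term:
  assumes "s > 0"
  shows "(bessel_term s m has_field_derivative bessel_term_deriv s m \<nu>) (at \<nu>)"
proof -
  have "((\<lambda>\<nu>. rGamma (real m + \<nu> + 1)) has_field_derivative deriv rGamma (real m + \<nu> + 1)) (at \<nu>)"
    using DERIV_rGamma_real[of "\<nu> + (real m + 1)"] DERIV_shift[of rGamma _ \<nu> "real m + 1"] by (simp add: add_ac)
  moreover have "((\<lambda>\<nu>. s powr (2 * real m + \<nu>)) has_field_derivative s powr (2 * real m + \<nu>) * ln s) (at \<nu>)"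
    using assms by (auto intro!: derivative_eq_intros)
  ultimately have "((\<lambda>\<nu>. (- 1) ^ m / fact m * (rGamma (real m + \<nu> + 1) * s powr (2 * real m + \<nu>))) has_field_derivative
      (- 1) ^ m / fact m * (deriv rGamma (real m + \<nu> + 1) * s powr (2 * real m + \<nu>) +
        s powr (2 * real m + \<nu>) * ln s * rGamma (real m + \<nu> + 1))) (at \<nu>)"
    by (intro DERIV_cmult DERIV_mult)
  then show ?thesis by (simp add: bessel_term_def[abs_def] bessel_term_deriv_def mult_ac)
qed

abbreviation bessel_bound :: "real \<Rightarrow> real \<Rightarrow> nat \<Rightarrow> real" where
  "bessel_bound K s m \<equiv> K * ((s\<^sup>2) ^ m / fact m)"

text \<open>The condition \<open>real m + \<nu> \<ge> 0\<close> places the argument of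
  \<open>rGamma\<close> in the range covered by \<open>rGamma_bounded\<close>. The factor
  \<open>1 + |ln s|\<close> in the constant pays for the derivative of the power of
  \<open>s\<close>.\<close>

lemma bessel_term_bounds:
  assumes "s > 0"
  shows "\<exists>K\<ge>0. \<forall>m \<nu>. real m + \<nu> \<ge> 0 \<longrightarrow>
    \<bar>bessel_term s m \<nu>\<bar> \<le> bessel_bound K s m * s powr \<nu> \<and>
    \<bar>bessel_term_deriv s m \<nu>\<bar> \<le> bessel_bound K s m * s powr \<nu>"
proof -
  obtain C :: real where C0: "C > 0" "\<forall>z\<ge>1. \<bar>rGamma z\<bar> \<le> C \<and> \<bar>deriv rGamma z\<bar> \<le> C"
    using rGamma_bounded by blast
  have C: "C > 0" "\<And>z. z \<ge> 1 \<Longrightarrow> \<bar>rGamma z\<bar> \<le> C" "\<And>z. z \<ge> 1 \<Longrightarrow> \<bar>deriv rGamma z\<bar> \<le> C"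
    using C0 by simp_all
  have powr: "s powr (2 * real m + \<nu>) = (s\<^sup>2) ^ m * s powr \<nu>" for m \<nu>
  proof -
    have "s powr (2 * real m) = (s\<^sup>2) ^ m"
      using powr_realpow[OF assms, of "2 * m"] by (simp add: power_mult)
    then show ?thesis by (simp add: powr_add)
  qed
  show ?thesis
  proof (intro exI[of _ "C * (1 + \<bar>ln s\<bar>)"] conjI allI impI)
    show "C * (1 + \<bar>ln s\<bar>) \<ge> 0" using C by simp
    fix m :: nat and \<nu> :: real assume m: "real m + \<nu> \<ge> 0"
    let ?P = "(s\<^sup>2) ^ m / fact m * s powr \<nu>"
    have P: "?P \<ge> 0" by simp
    have "\<bar>bessel_term s m \<nu>\<bar> = \<bar>rGamma (real m + \<nu> + 1)\<bar> * ?P"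
      by (simp add: bessel_term_def powr abs_mult power_abs)
    also have "\<dots> \<le> (C * (1 + \<bar>ln s\<bar>)) * ?P"
      using C(2)[of "real m + \<nu> + 1"] m C(1) P
      by (intro mult_right_mono) (auto simp: distrib_left intro: order_trans)
    finally show "\<bar>bessel_term s m \<nu>\<bar> \<le> C * (1 + \<bar>ln s\<bar>) * ((s\<^sup>2) ^ m / fact m) * s powr \<nu>"
      by (simp add: mult.assoc)
    have "bessel_term_deriv s m \<nu> = (- 1) ^ m * (deriv rGamma (real m + \<nu> + 1) + rGamma (real m + \<nu> + 1) * ln s) * ?P"
      unfolding bessel_term_deriv_def powr by (simp add: algebra_simps add_divide_distrib)
    then have "\<bar>bessel_term_deriv s m \<nu>\<bar> = \<bar>deriv rGamma (real m + \<nu> + 1) + rGamma (real m + \<nu> + 1) * ln s\<bar> * ?P"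
      using P by (simp add: abs_mult power_abs)
    also have "\<dots> \<le> (C + C * \<bar>ln s\<bar>) * ?P"
      using C(2,3)[of "real m + \<nu> + 1"] m P
      by (intro mult_right_mono order_trans[OF abs_triangle_ineq] add_mono) (auto simp: abs_mult intro!: mult_right_mono)
    finally show "\<bar>bessel_term_deriv s m \<nu>\<bar> \<le> C * (1 + \<bar>ln s\<bar>) * ((s\<^sup>2) ^ m / fact m) * s powr \<nu>"
      using P by (simp add: mult.assoc distrib_left)
  qed
qed

lemma eventually_real_nat_plus_ge: "\<forall>\<^sub>F m in sequentially. real m + c \<ge> 0"
  using eventually_ge_at_top[of "nat \<lceil>- c\<rceil>"] by eventually_elim linarith

lemma summable_bessel_bound: "summable (\<lambda>m. bessel_bound K s m * (c :: real))"
proof -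
  have "summable (\<lambda>m. (s\<^sup>2) ^ m / fact m)"
    using summable_exp[of "s\<^sup>2"] by (simp add: divide_inverse mult.commute)
  then show ?thesis by (intro summable_mult2 summable_mult)
qed

text \<open>Differentiation term by term, by the Weierstrass test on a neighbourhood of
  \<open>\<nu>\<close>. For negative orders the bounds on the terms fail for finitely many
  \<open>m\<close> only, whence the eventual versions of the tests.\<close>

lemma Bessel_J_series:
  assumes s: "s > 0"
  shows "(\<lambda>m. bessel_term s m \<nu>) sums Bessel_J \<nu> (2 * s)"
    "((\<lambda>\<nu>. Bessel_J \<nu> (2 * s)) has_field_derivative (\<Sum>m. bessel_term_deriv s m \<nu>)) (at \<nu>)"
proof -
  obtain K where K0: "K \<ge> 0" "\<forall>m \<nu>. real m + \<nu> \<ge> 0 \<longrightarrow>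
    \<bar>bessel_term s m \<nu>\<bar> \<le> bessel_bound K s m * s powr \<nu> \<and>
    \<bar>bessel_term_deriv s m \<nu>\<bar> \<le> bessel_bound K s m * s powr \<nu>"
    using bessel_term_bounds[OF s] by blast
  have K: "K \<ge> 0"
    "\<And>m \<nu>. real m + \<nu> \<ge> 0 \<Longrightarrow> \<bar>bessel_term s m \<nu>\<bar> \<le> bessel_bound K s m * s powr \<nu>"
    "\<And>m \<nu>. real m + \<nu> \<ge> 0 \<Longrightarrow> \<bar>bessel_term_deriv s m \<nu>\<bar> \<le> bessel_bound K s m * s powr \<nu>"
    using K0 by simp_all
  let ?S = "{\<nu> - 1<..<\<nu> + 1}"
  \<comment> \<open>On the interval a power of \<open>s\<close> is at most its value at the right
    end if \<open>s \<ge> 1\<close> and at the left end otherwise; the sum of both values covers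
    either case.\<close>
  let ?M = "\<lambda>m. bessel_bound K s m * (s powr (\<nu> - 1) + s powr (\<nu> + 1))"
  have powr_le: "s powr \<mu> \<le> s powr (\<nu> - 1) + s powr (\<nu> + 1)" if "\<mu> \<in> ?S" for \<mu>
  proof (cases "s \<ge> 1")
    case True
    then have "s powr \<mu> \<le> s powr (\<nu> + 1)" using that by (intro powr_mono) auto
    then show ?thesis by (simp add: add_increasing)
  next
    case False
    then have "s powr \<mu> \<le> s powr (\<nu> - 1)" using that s by (intro powr_mono') auto
    then show ?thesis by (simp add: add_increasing2)
  qed
  have "\<forall>\<^sub>F m in sequentially. \<forall>\<mu>\<in>?S. norm (bessel_term_deriv s m \<mu>) \<le> ?M m"
    using eventually_real_nat_plus_ge[of "\<nu> - 1"]
  proof eventually_elim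
    case (elim m)
    show ?case
    proof
      fix \<mu> assume \<mu>: "\<mu> \<in> ?S"
      have "\<bar>bessel_term_deriv s m \<mu>\<bar> \<le> bessel_bound K s m * s powr \<mu>"
        using elim \<mu> by (intro K(3)) auto
      also have "\<dots> \<le> ?M m"
        using K(1) by (intro mult_left_mono powr_le \<mu>) auto
      finally show "norm (bessel_term_deriv s m \<mu>) \<le> ?M m" by simp
    qed
  qed
  then have unif: "uniformly_convergent_on ?S (\<lambda>n \<mu>. \<Sum>m<n. bessel_term_deriv s m \<mu>)"
    by (rule Weierstrass_m_test'_ev) (rule summable_bessel_bound)
  have "summable (\<lambda>m. bessel_term s m \<nu>)"
  proof (rule summable_comparison_test_ev)
    show "\<forall>\<^sub>F m in sequentially. norm (bessel_term s m \<nu>) \<le> bessel_bound K s m * s powr \<nu>"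
      using eventually_real_nat_plus_ge[of \<nu>] by eventually_elim (use K(2) in auto)
  qed (rule summable_bessel_bound)
  note series = has_field_derivative_series'[OF _ has_field_derivative_at_within[OF DERIV_bessel_term[OF s]] unif _ this, of \<nu>]
  show "(\<lambda>m. bessel_term s m \<nu>) sums Bessel_J \<nu> (2 * s)"
    unfolding Bessel_J_eq by (rule summable_sums, rule series(1)) (auto simp: interior_open)
  show "((\<lambda>\<nu>. Bessel_J \<nu> (2 * s)) has_field_derivative (\<Sum>m. bessel_term_deriv s m \<nu>)) (at \<nu>)"
    unfolding Bessel_J_eq by (rule series(2)) (auto simp: interior_open)
qed

lemma DERIV_Bessel_J:
  assumes "s > 0"
  shows "((\<lambda>\<nu>. Bessel_J \<nu> (2 * s)) has_field_derivative Bessel_J_order_deriv \<nu> (2 * s)) (at \<nu>)"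
  unfolding Bessel_J_order_deriv_def
  using Bessel_J_series(2)[OF assms] DERIV_imp_deriv[OF Bessel_J_series(2)[OF assms]] by simp

text \<open>Growth like \<open>s ^ n\<close> is good enough: later the derivative is always
  multiplied by a Bessel function that is at most a constant times
  \<open>s ^ n / fact n\<close>.\<close>

lemma Bessel_J_order_deriv_bound:
  assumes s: "s > 0"
  obtains K where "\<And>n. \<bar>Bessel_J_order_deriv (real n) (2 * s)\<bar> \<le> K * s ^ n"
proof -
  obtain K where K0: "K \<ge> 0" "\<forall>m \<nu>. real m + \<nu> \<ge> 0 \<longrightarrow>
    \<bar>bessel_term s m \<nu>\<bar> \<le> bessel_bound K s m * s powr \<nu> \<and>
    \<bar>bessel_term_deriv s m \<nu>\<bar> \<le> bessel_bound K s m * s powr \<nu>"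
    using bessel_term_bounds[OF s] by blast
  have K: "K \<ge> 0"
    "\<And>m \<nu>. real m + \<nu> \<ge> 0 \<Longrightarrow> \<bar>bessel_term_deriv s m \<nu>\<bar> \<le> bessel_bound K s m * s powr \<nu>"
    using K0 by simp_all
  show ?thesis
  proof (rule that[of "\<Sum>m. bessel_bound K s m * 1"])
    fix n
    have "Bessel_J_order_deriv (real n) (2 * s) = (\<Sum>m. bessel_term_deriv s m (real n))"
      unfolding Bessel_J_order_deriv_def by (rule DERIV_imp_deriv[OF Bessel_J_series(2)[OF s]])
    also have "norm \<dots> \<le> (\<Sum>m. bessel_bound K s m * s ^ n)"
      by (rule norm_suminf_le[OF _ summable_bessel_bound]) (use K(2)[of _ "real n"] s in \<open>simp add: powr_realpow\<close>)
    also have "\<dots> = (\<Sum>m. bessel_bound K s m * 1) * s ^ n"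
      by (subst suminf_mult2[OF summable_bessel_bound]) simp
    finally show "\<bar>Bessel_J_order_deriv (real n) (2 * s)\<bar> \<le> (\<Sum>m. bessel_bound K s m * 1) * s ^ n"
      by simp
  qed
qed

text \<open>The three-term relation \<open>J_(nu-1) + J_(nu+1) = (2 nu / t) J_nu\<close> at
  \<open>t = 2 s\<close>. Term by term, the first series contributes \<open>m + nu\<close> times the
  \<open>m\<close>-th term of \<open>J_nu\<close>, and the second one, shifted by one index,
  contributes \<open>-m\<close> times it.\<close>

lemma Bessel_J_recurrence:
  assumes s: "s > 0"
  shows "s * (Bessel_J (\<nu> - 1) (2 * s) + Bessel_J (\<nu> + 1) (2 * s)) = \<nu> * Bessel_J \<nu> (2 * s)"
proof -
  let ?g = "\<lambda>m. if m = 0 then 0 else bessel_term s (m - 1) (\<nu> + 1)"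
  have g: "?g sums Bessel_J (\<nu> + 1) (2 * s)"
    using sums_Suc[of ?g "Bessel_J (\<nu> + 1) (2 * s)"] Bessel_J_series(1)[OF s, of "\<nu> + 1"] by simp
  have "s * (bessel_term s m (\<nu> - 1) + ?g m) = \<nu> * bessel_term s m \<nu>" for m
  proof -
    have 1: "s * bessel_term s m (\<nu> - 1) = (real m + \<nu>) * bessel_term s m \<nu>"
    proof -
      have "s powr (2 * real m + \<nu>) = s powr (2 * real m + (\<nu> - 1)) * s"
        using s powr_add[of s "2 * real m + (\<nu> - 1)" 1] by simp
      moreover have "rGamma (real m + (\<nu> - 1) + 1) = (real m + \<nu>) * rGamma (real m + \<nu> + 1)"
        using rGamma_plus1[of "real m + \<nu>"] by simp
      ultimately show ?thesis by (simp add: bessel_term_def mult_ac)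
    qed
    have 2: "s * ?g m = - real m * bessel_term s m \<nu>"
    proof (cases m)
      case (Suc k)
      have "s powr (2 * real m + \<nu>) = s powr (2 * real k + (\<nu> + 1)) * s"
        using s powr_add[of s "2 * real k + (\<nu> + 1)" 1] Suc by (simp add: algebra_simps)
      moreover have "bessel_term s k (\<nu> + 1) = (- 1) ^ k / fact k * rGamma (real m + \<nu> + 1) * s powr (2 * real k + (\<nu> + 1))"
        by (simp add: bessel_term_def Suc add_ac)
      moreover have "(fact m :: real) = real m * fact k" "(- 1 :: real) ^ m = - ((- 1) ^ k)" "m \<noteq> 0"
        using Suc by simp_all
      moreover have "?g m = bessel_term s k (\<nu> + 1)"
        using Suc by simp
      ultimately show ?thesis by (simp add: bessel_term_def[of s m])
    qed simp
    show ?thesis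
      using 1 2 by (simp add: algebra_simps)
  qed
  then have "(\<lambda>m. \<nu> * bessel_term s m \<nu>) sums (s * (Bessel_J (\<nu> - 1) (2 * s) + Bessel_J (\<nu> + 1) (2 * s)))"
    using sums_mult[OF sums_add[OF Bessel_J_series(1)[OF s, of "\<nu> - 1"] g], of s] by simp
  then show ?thesis
    using sums_mult[OF Bessel_J_series(1)[OF s, of \<nu>], of \<nu>] by (rule sums_unique2)
qed

text \<open>The three-term relation differentiated with respect to the order; the product rule
  creates the additional \<open>J\<close>.\<close>

lemma Bessel_J_order_deriv_recurrence:
  assumes s: "s > 0"
  shows "s * (Bessel_J_order_deriv (\<nu> - 1) (2 * s) + Bessel_J_order_deriv (\<nu> + 1) (2 * s)) =
    Bessel_J \<nu> (2 * s) + \<nu> * Bessel_J_order_deriv \<nu> (2 * s)"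
proof -
  let ?J = "\<lambda>\<nu>. Bessel_J \<nu> (2 * s)" and ?D = "\<lambda>\<nu>. Bessel_J_order_deriv \<nu> (2 * s)"
  have shift: "((\<lambda>\<nu>. ?J (\<nu> + c)) has_field_derivative ?D (\<nu> + c)) (at \<nu>)" for c
    using DERIV_Bessel_J[OF s, of "\<nu> + c"] by (simp add: DERIV_shift)
  have "((\<lambda>\<nu>. s * (?J (\<nu> + - 1) + ?J (\<nu> + 1))) has_field_derivative s * (?D (\<nu> + - 1) + ?D (\<nu> + 1))) (at \<nu>)"
    by (intro DERIV_cmult DERIV_add shift)
  moreover have "((\<lambda>\<nu>. \<nu> * ?J \<nu>) has_field_derivative (1 * ?J \<nu> + ?D \<nu> * \<nu>)) (at \<nu>)"
    by (intro DERIV_mult DERIV_ident DERIV_Bessel_J s)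
  moreover have "(\<lambda>\<nu>. s * (?J (\<nu> + - 1) + ?J (\<nu> + 1))) = (\<lambda>\<nu>. \<nu> * ?J \<nu>)"
    using Bessel_J_recurrence[OF s] by (simp add: fun_eq_iff)
  ultimately have "s * (?D (\<nu> + - 1) + ?D (\<nu> + 1)) = 1 * ?J \<nu> + ?D \<nu> * \<nu>"
    using DERIV_unique by fastforce
  then show ?thesis by (simp add: mult.commute)
qed

section \<open>Integer orders, and decay for large orders\<close>

lemma rGamma_of_int_plus1: "rGamma (real_of_int k + 1) = ecoeff 1 k"
proof (cases "k < 0")
  case True
  then have "real_of_int k + 1 \<in> \<int>\<^sub>\<le>\<^sub>0"
    unfolding nonpos_Ints_def by (intro CollectI exI[of _ "k + 1"]) auto
  then show ?thesis
    using True by (simp add: rGamma_eq_zero_iff)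
next
  case False
  then obtain n where "k = int n" by (metis nat_eq_iff2 not_le)
  then show ?thesis
    using Gamma_fact[of n, where ?'a = real]
    by (simp add: rGamma_inverse_Gamma ecoeff_of_nat add.commute divide_inverse)
qed

lemma bessel_term_int:
  assumes "s > 0"
  shows "bessel_term s m (real_of_int x) = ecoeff (- s) (int m) * ecoeff s (x + int m)"
proof -
  have "2 * real m + real_of_int x = real_of_int (int m + (x + int m))" by simp
  then have "s powr (2 * real m + real_of_int x) = s powi (int m + (x + int m))"
    using assms by (simp only:) (rule powr_real_of_int'; simp)
  also have "\<dots> = s powi int m * s powi (x + int m)"
    using assms by (intro power_int_add) simp
  finally have "s powr (2 * real m + real_of_int x) = s ^ m * s powi (x + int m)"
    by (simp only: power_int_of_nat)
  moreover have "rGamma (real m + real_of_int x + 1) = ecoeff 1 (x + int m)"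
    using rGamma_of_int_plus1[of "x + int m"] by (simp add: add.commute)
  ultimately show ?thesis
    using ecoeff_scale[of s "x + int m"] power_minus[of s m] assms
    by (simp only: bessel_term_def ecoeff_of_nat) simp
qed

lemma Bessel_J_of_int:
  assumes "s > 0"
  shows "Bessel_J (real_of_int x) (2 * s) = bes s x"
proof -
  have "(\<lambda>k. ecoeff (- s) (int k) * ecoeff s (x + int k)) sums bes s x"
    unfolding bes_def using assms
    by (intro has_sum_imp_sums has_sum_infsum abs_summable_summable[OF bes_summable]) simp
  then show ?thesis
    using Bessel_J_series(1)[OF assms, of "real_of_int x"]
    by (simp only: bessel_term_int[OF assms] sums_unique2)
qed

lemma norm_bes_le:
  assumes s: "s \<ge> 0"
  shows "\<bar>bes s (int n)\<bar> \<le> ecoeff s (int n) * (exp s * exp s)"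
proof -
  have "\<bar>bes s (int n)\<bar> \<le> bes_tail s 0 (int n)"
    using bes_le_bes_tail[OF s] by simp
  also have "\<dots> \<le> (\<Sum>\<^sub>\<infinity>k\<in>{0..}. ecoeff s (int k) * (ecoeff s (int n) * exp s))"
    unfolding bes_tail_def
  proof (rule infsum_mono[OF bes_tail_summable[OF s]])
    show "(\<lambda>k. ecoeff s (int k) * (ecoeff s (int n) * exp s)) summable_on {0..}"
      by (intro summable_on_cmult_left summable_on_subset_banach[OF has_sum_imp_summable[OF has_sum_ecoeff_nat]]) auto
    fix k
    have "ecoeff s (int n + int k) \<le> ecoeff s (int n) * ecoeff s (int k)"
      using ecoeff_add_le[OF s, of n k] by simp
    also have "\<dots> \<le> ecoeff s (int n) * exp s"
      using s by (intro mult_left_mono ecoeff_le_exp ecoeff_nonneg)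
    finally show "ecoeff s (int k) * ecoeff s (int n + int k) \<le> ecoeff s (int k) * (ecoeff s (int n) * exp s)"
      using s by (intro mult_left_mono ecoeff_nonneg)
  qed
  also have "\<dots> = exp s * (ecoeff s (int n) * exp s)"
    using infsumI[OF has_sum_ecoeff_nat[of s]] by (simp add: infsum_cmult_left' atLeast_0)
  finally show ?thesis by (simp add: mult_ac)
qed

lemma tendsto_int_shift:
  fixes F :: "int \<Rightarrow> real"
  assumes "(\<lambda>n. F (int n)) \<longlonglongrightarrow> l"
  shows "(\<lambda>n. F (x + int n)) \<longlonglongrightarrow> l"
proof (cases "x \<ge> 0")
  case True
  then show ?thesis
    using LIMSEQ_ignore_initial_segment[OF assms, of "nat x"] by (simp add: add.commute)
next
  case False
  then show ?thesis by - (rule LIMSEQ_offset[of _ "nat (- x)"], use assms in simp)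
qed

lemma bes_tendsto_0:
  assumes "s \<ge> 0"
  shows "(\<lambda>n. bes s (x + int n)) \<longlonglongrightarrow> 0"
proof (rule tendsto_int_shift, rule Lim_null_comparison)
  show "\<forall>\<^sub>F n in sequentially. norm (bes s (int n)) \<le> ecoeff s (int n) * (exp s * exp s)"
    using norm_bes_le[OF assms] by simp
  have "(\<lambda>n. ecoeff s (int n)) \<longlonglongrightarrow> 0"
    by (rule summable_LIMSEQ_zero[OF sums_summable[OF has_sum_imp_sums[OF has_sum_ecoeff_nat]]])
  then show "(\<lambda>n. ecoeff s (int n) * (exp s * exp s)) \<longlonglongrightarrow> 0"
    by (rule tendsto_mult_left_zero)
qed

lemma bes_recurrence:
  assumes "s > 0"
  shows "s * (bes s x + bes s (x + 2)) = real_of_int (x + 1) * bes s (x + 1)"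
  using Bessel_J_recurrence[OF assms, of "real_of_int (x + 1)"]
  by (simp add: Bessel_J_of_int[OF assms, symmetric] add.commute)

text \<open>\<open>?F n\<close> is the Casoratian of the two shifted sequences. By the three-term
  recurrence \<open>?F n - ?F (Suc n)\<close> is \<open>x - y\<close> times the \<open>n\<close>-th
  summand of the kernel, and \<open>?F\<close> tends to 0, so the series telescopes.\<close>

lemma bes_kernel_off_diagonal:
  assumes s: "s > 0" and "x \<noteq> y"
  shows "bes_kernel s x y = s * (bes s x * bes s (y + 1) - bes s (x + 1) * bes s y) / real_of_int (x - y)"
proof -
  let ?F = "\<lambda>n. s * (bes s (x + int n) * bes s (y + 1 + int n) - bes s (x + 1 + int n) * bes s (y + int n))"
  have "?F \<longlonglongrightarrow> s * (0 * 0 - 0 * 0)"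
    using s by (intro tendsto_intros bes_tendsto_0) auto
  then have "(\<lambda>n. ?F n - ?F (Suc n)) sums (?F 0)"
    using telescope_sums'[of ?F 0] by simp
  moreover have "?F n - ?F (Suc n) = real_of_int (x - y) * (bes s (x + int n + 1) * bes s (y + int n + 1))" for n
  proof -
    let ?u = "x + int n" and ?v = "y + int n"
    have "?F n - ?F (Suc n) = bes s (?v + 1) * (s * (bes s ?u + bes s (?u + 2))) - bes s (?u + 1) * (s * (bes s ?v + bes s (?v + 2)))"
      by (simp add: algebra_simps)
    also have "\<dots> = real_of_int (x - y) * (bes s (?u + 1) * bes s (?v + 1))"
      unfolding bes_recurrence[OF s] by (simp add: algebra_simps)
    finally show ?thesis .
  qed
  ultimately have "(\<lambda>n. real_of_int (x - y) * (bes s (x + int n + 1) * bes s (y + int n + 1))) sums (?F 0)"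
    by simp
  then have "(\<lambda>n. real_of_int (x - y) * (bes s (x + int n + 1) * bes s (y + int n + 1)) / real_of_int (x - y))
     sums (?F 0 / real_of_int (x - y))" by (rule sums_divide)
  moreover have "real_of_int (x - y) * t / real_of_int (x - y) = t" for t
    using \<open>x \<noteq> y\<close> by simp
  ultimately have "(\<lambda>n. bes s (x + int n + 1) * bes s (y + int n + 1)) sums (?F 0 / real_of_int (x - y))"
    by (simp only:)
  then have "bes_kernel s x y = ?F 0 / real_of_int (x - y)"
    unfolding bes_kernel_def by (rule sums_unique[symmetric])
  then show ?thesis by (simp only: of_nat_0 add_0_right)
qed

text \<open>The confluent case of the same telescoping: the order derivative replaces one of the two
  sequences. Its recurrence carries an inhomogeneous Bessel term, and this term is what leaves the
  square as the difference.\<close>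

lemma bes_kernel_diagonal:
  assumes s: "s > 0"
  defines "D \<equiv> \<lambda>x. Bessel_J_order_deriv (real_of_int x) (2 * s)"
  shows "bes_kernel s x x = s * (D x * bes s (x + 1) - bes s x * D (x + 1))"
proof -
  let ?F = "\<lambda>x. s * (D x * bes s (x + 1) - bes s x * D (x + 1))"
  obtain K where K: "\<And>n. \<bar>Bessel_J_order_deriv (real n) (2 * s)\<bar> \<le> K * s ^ n"
    using Bessel_J_order_deriv_bound[OF s] by blast
  define c where "c = exp s * exp s"
  have "K \<ge> 0" using order_trans[OF abs_ge_zero K[of 0]] by simp
  have DK: "\<bar>D (int n)\<bar> \<le> K * s ^ n" for n
    using K[of n] by (simp add: D_def)
  have b: "\<bar>bes s (int n)\<bar> \<le> s ^ n / fact n * c" for n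
    using norm_bes_le[of s n] s by (simp add: ecoeff_of_nat c_def)
  \<comment> \<open>The bound \<open>K * s ^ n\<close> for the derivative and the bound
    \<open>s ^ n / fact n * c\<close> for the Bessel function multiply to a constant times
    \<open>s^(2n) / n!\<close>, which tends to 0.\<close>
  have bound: "\<bar>?F (int n)\<bar> \<le> 2 * s * K * c * s * ((s\<^sup>2) ^ n / fact n)" for n
  proof -
    have "\<bar>D (int n) * bes s (int n + 1)\<bar> \<le> (K * s ^ n) * (s ^ Suc n / fact (Suc n) * c)"
      unfolding abs_mult using DK[of n] b[of "Suc n"] s \<open>K \<ge> 0\<close> by (intro mult_mono) (auto simp: add.commute)
    also have "\<dots> \<le> (K * s ^ n) * (s ^ Suc n / fact n * c)"
      using s \<open>K \<ge> 0\<close> by (intro mult_left_mono mult_right_mono divide_left_mono fact_mono) (auto simp: c_def)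
    finally have 1: "\<bar>D (int n) * bes s (int n + 1)\<bar> \<le> K * c * s * ((s\<^sup>2) ^ n / fact n)"
      by (simp add: power_mult_distrib power2_eq_square mult_ac)
    have "\<bar>bes s (int n) * D (int n + 1)\<bar> \<le> (s ^ n / fact n * c) * (K * s ^ Suc n)"
      unfolding abs_mult using DK[of "Suc n"] b[of n] s by (intro mult_mono) (auto simp: add.commute c_def)
    then have 2: "\<bar>bes s (int n) * D (int n + 1)\<bar> \<le> K * c * s * ((s\<^sup>2) ^ n / fact n)"
      by (simp add: power_mult_distrib power2_eq_square mult_ac)
    have "\<bar>?F (int n)\<bar> = s * \<bar>D (int n) * bes s (int n + 1) - bes s (int n) * D (int n + 1)\<bar>"
      using s by (simp add: abs_mult)
    also have "\<dots> \<le> s * (2 * (K * c * s * ((s\<^sup>2) ^ n / fact n)))"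
      using 1 2 s by (intro mult_left_mono) linarith+
    finally show ?thesis by (simp add: mult_ac)
  qed
  have lim: "(\<lambda>n. 2 * s * K * c * s * ((s\<^sup>2) ^ n / fact n)) \<longlonglongrightarrow> 0"
    using summable_LIMSEQ_zero[OF summable_exp[of "s\<^sup>2"]]
    by (intro tendsto_mult_right_zero) (simp add: divide_inverse mult.commute)
  have "(\<lambda>n. ?F (int n)) \<longlonglongrightarrow> 0"
    by (rule Lim_null_comparison[OF _ lim], rule always_eventually, rule allI, unfold real_norm_def, rule bound)
  then have "(\<lambda>n. ?F (x + int n)) \<longlonglongrightarrow> 0" by (rule tendsto_int_shift)
  then have "(\<lambda>n. ?F (x + int n) - ?F (x + int (Suc n))) sums (?F x)"
    using telescope_sums'[of "\<lambda>n. ?F (x + int n)" 0] by simp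
  moreover have "?F (x + int n) - ?F (x + int (Suc n)) = bes s (x + int n + 1) * bes s (x + int n + 1)" for n
  proof -
    let ?u = "x + int n"
    have rec: "s * (D ?u + D (?u + 2)) = bes s (?u + 1) + real_of_int (?u + 1) * D (?u + 1)"
      using Bessel_J_order_deriv_recurrence[OF s, of "real_of_int (?u + 1)"] Bessel_J_of_int[OF s, of "?u + 1"]
      by (simp add: D_def add_ac)
    have "?F ?u - ?F (x + int (Suc n)) = bes s (?u + 1) * (s * (D ?u + D (?u + 2))) - D (?u + 1) * (s * (bes s ?u + bes s (?u + 2)))"
      by (simp add: algebra_simps)
    also have "\<dots> = bes s (?u + 1) * bes s (?u + 1)"
      unfolding rec bes_recurrence[OF s] by (simp add: algebra_simps)
    finally show ?thesis .
  qed
  ultimately have "(\<lambda>n. bes s (x + int n + 1) * bes s (x + int n + 1)) sums (?F x)" by simp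
  then show ?thesis by (simp add: bes_kernel_def sums_iff)
qed

theorem discrete_Bessel_kernel_eq:
  assumes "\<alpha> > 0"
  shows "discrete_Bessel_kernel \<alpha> x y = bes_kernel (sqrt \<alpha>) x y"
proof -
  have s: "sqrt \<alpha> > 0" using assms by simp
  have J: "Bessel_J (real_of_int x) (2 * sqrt \<alpha>) = bes (sqrt \<alpha>) x"
    "Bessel_J (real_of_int x + 1) (2 * sqrt \<alpha>) = bes (sqrt \<alpha>) (x + 1)" for x
    using Bessel_J_of_int[OF s, of x] Bessel_J_of_int[OF s, of "x + 1"] by simp_all
  show ?thesis
  proof (cases "x = y")
    case True
    then show ?thesis
      using bes_kernel_diagonal[OF s, of x] by (simp add: discrete_Bessel_kernel_def Let_def J)
  next
    case False
    then show ?thesis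
      using bes_kernel_off_diagonal[OF s False] by (simp add: discrete_Bessel_kernel_def Let_def J)
  qed
qed

section \<open>Expansion over occupied positions\<close>

text \<open>The points \<open>h\<close> are the nonnegative arguments at which \<open>f\<close> is
  evaluated in \<open>g\<close>. Negative arguments, where \<open>f\<close> is 1, are left out, so
  that the set is finite for a partition.\<close>

definition occupied :: "nat \<Rightarrow> (nat \<Rightarrow> nat) \<Rightarrow> nat set" where
  "occupied L p = {h. int h - int L \<in> range (part_pos p)}"

lemma part_pos_nonneg_less:
  assumes "is_partition p" "part_pos p i + int L \<ge> 0"
  shows "i < psize p + L"
proof (rule ccontr)
  assume "\<not> i < psize p + L"
  then have "i \<ge> psize p" "i \<ge> L" by auto
  then have "p i = 0"
    using partition_in_bounded[OF assms(1)] by (auto simp: bounded_partitions_def)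
  then show False
    using assms(2) \<open>i \<ge> L\<close> by (simp add: part_pos_def)
qed

lemma occupied_eq: "occupied L p = (\<lambda>i. nat (part_pos p i + int L)) ` {i. part_pos p i + int L \<ge> 0}"
proof (intro equalityI subsetI)
  fix h assume "h \<in> occupied L p"
  then obtain i where "int h - int L = part_pos p i" by (auto simp: occupied_def)
  then have "part_pos p i + int L = int h" by simp
  then show "h \<in> (\<lambda>i. nat (part_pos p i + int L)) ` {i. part_pos p i + int L \<ge> 0}"
    by (intro image_eqI[of _ _ i]) auto
qed (auto simp: occupied_def)

lemma finite_nonneg_positions:
  assumes "is_partition p"
  shows "finite {i. part_pos p i + int L \<ge> 0}" "card {i. part_pos p i + int L \<ge> 0} \<le> psize p + L"
proof -
  have sub: "{i. part_pos p i + int L \<ge> 0} \<subseteq> {..<psize p + L}"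
    using part_pos_nonneg_less[OF assms] by auto
  then show "finite {i. part_pos p i + int L \<ge> 0}" by (rule finite_subset) simp
  show "card {i. part_pos p i + int L \<ge> 0} \<le> psize p + L"
    using card_mono[OF _ sub] by simp
qed

lemma finite_occupied: "is_partition p \<Longrightarrow> finite (occupied L p)"
  unfolding occupied_eq by (intro finite_imageI finite_nonneg_positions)

lemma card_occupied_le:
  assumes "is_partition p"
  shows "card (occupied L p) \<le> psize p + L"
  using card_image_le[OF finite_nonneg_positions(1)[OF assms]] finite_nonneg_positions(2)[OF assms]
  unfolding occupied_eq by (rule order_trans)

text \<open>Rows with a negative argument contribute the factor 1; the finitely many others
  correspond injectively to the occupied points.\<close>

lemma prodinf_positions:
  fixes f :: "int \<Rightarrow> complex"
  assumes p: "is_partition p" and f: "\<And>n. n < 0 \<Longrightarrow> f n = 1"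
  shows "(\<Prod>i. f (part_pos p i + int L)) = (\<Prod>h\<in>occupied L p. f (int h))"
proof -
  let ?I = "{i. part_pos p i + int L \<ge> 0}"
  have "(\<Prod>i. f (part_pos p i + int L)) = (\<Prod>i\<in>?I. f (part_pos p i + int L))"
    by (rule prodinf_finite[OF finite_nonneg_positions(1)[OF p]]) (auto intro: f)
  also have "\<dots> = (\<Prod>i\<in>?I. f (int (nat (part_pos p i + int L))))"
    by (intro prod.cong) auto
  also have "\<dots> = (\<Prod>h\<in>occupied L p. f (int h))"
  proof -
    have "inj_on (\<lambda>i. nat (part_pos p i + int L)) ?I"
    proof (rule inj_onI)
      fix i j assume "i \<in> ?I" "j \<in> ?I" "nat (part_pos p i + int L) = nat (part_pos p j + int L)"
      then have "part_pos p i = part_pos p j" by simp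
      then show "i = j"
        using inj_part_pos[OF p, of UNIV] by (auto dest: injD)
    qed
    then show ?thesis
      unfolding occupied_eq by (subst prod.reindex) (auto simp: o_def)
  qed
  finally show ?thesis .
qed

lemma prod_one_plus:
  fixes \<phi> :: "'i \<Rightarrow> 'a :: comm_semiring_1"
  assumes "finite A"
  shows "(\<Prod>h\<in>A. 1 + \<phi> h) = (\<Sum>T\<in>Pow A. \<Prod>h\<in>T. \<phi> h)"
proof -
  have "(\<Prod>h\<in>A. 1 + \<phi> h) = (\<Prod>h\<in>A. \<phi> h + 1)" by (simp add: add.commute)
  also have "\<dots> = (\<Sum>T\<in>Pow A. \<Prod>h\<in>T. \<phi> h)"
    by (subst prod_add[OF assms]) simp
  finally show ?thesis .
qed

definition rho :: "real \<Rightarrow> nat \<Rightarrow> nat set \<Rightarrow> real" where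
  "rho \<alpha> L T = correlation \<alpha> ((\<lambda>h. int h - int L) ` T)"

lemma has_sum_rho:
  assumes "\<alpha> > 0"
  shows "(plancherel_weight \<alpha> has_sum rho \<alpha> L T) {p \<in> partitions. T \<subseteq> occupied L p}"
proof -
  let ?H = "(\<lambda>h. int h - int L) ` T"
  have "((\<lambda>p. plancherel_weight \<alpha> p * (if ?H \<subseteq> range (part_pos p) then 1 else 0)) has_sum rho \<alpha> L T) partitions"
    unfolding rho_def correlation_def
    by (intro has_sum_infsum plancherel_summable_bounded[OF assms, where C = 1]) auto
  moreover have "?H \<subseteq> range (part_pos p) \<longleftrightarrow> T \<subseteq> occupied L p" for p
    by (auto simp: occupied_def)
  ultimately show ?thesis by (subst has_sum_cong_neutral[where T = partitions and
          g = "\<lambda>p. plancherel_weight \<alpha> p * (if ?H \<subseteq> range (part_pos p) then 1 else 0)"]) auto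
qed

lemma rho_nonneg: "\<alpha> > 0 \<Longrightarrow> rho \<alpha> L T \<ge> 0"
  by (rule has_sum_nonneg[OF has_sum_rho]) (auto intro: plancherel_weight_nonneg)

lemma rho_eq_det:
  assumes "\<alpha> > 0" "finite T"
  shows "rho \<alpha> L T = det_on T (\<lambda>i j. discrete_Bessel_kernel \<alpha> (int i - int L) (int j - int L))"
proof -
  have "bij_betw (\<lambda>h. int h - int L) T ((\<lambda>h. int h - int L) ` T)"
    by (auto simp: bij_betw_def inj_on_def)
  from det_on_reindex[OF this assms(2), of "bes_kernel (sqrt \<alpha>)"] show ?thesis
    by (simp only: rho_def correlation_eq_det[OF assms(1) finite_imageI[OF assms(2)]] discrete_Bessel_kernel_eq[OF assms(1)])
qed

text \<open>Summing \<open>C ^ card T\<close> over the subsets of the occupied set gives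
  \<open>(1 + C) ^ card (occupied L p)\<close>, which is at most
  \<open>(1 + C) ^ (psize p + L)\<close>, and the Poisson distributed size has all exponential
  moments. This majorant justifies the exchange of expectation and expansion.\<close>

lemma summable_occupied_subsets:
  assumes "\<alpha> > 0" "C \<ge> (0 :: real)"
  shows "(\<lambda>(p, T). plancherel_weight \<alpha> p * C ^ card T) summable_on Sigma partitions (\<lambda>p. Pow (occupied L p))"
    "(\<lambda>p. plancherel_weight \<alpha> p * (1 + C) ^ card (occupied L p)) summable_on partitions"
proof -
  show 1: "(\<lambda>p. plancherel_weight \<alpha> p * (1 + C) ^ card (occupied L p)) summable_on partitions"
  proof (rule summable_on_comparison_test)
    show "(\<lambda>p. plancherel_weight \<alpha> p * (1 + C) ^ psize p * (1 + C) ^ L) summable_on partitions"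
      using assms by (intro summable_on_cmult_left has_sum_imp_summable[OF has_sum_plancherel_growth]) auto
    fix p assume "p \<in> partitions"
    then have "(1 + C) ^ card (occupied L p) \<le> (1 + C) ^ (psize p + L)"
      using assms by (intro power_increasing card_occupied_le) (auto simp: partitions_def)
    then show "plancherel_weight \<alpha> p * (1 + C) ^ card (occupied L p) \<le> plancherel_weight \<alpha> p * (1 + C) ^ psize p * (1 + C) ^ L"
      unfolding mult.assoc power_add[symmetric] by (intro mult_left_mono plancherel_weight_nonneg assms(1))
  qed (use assms in \<open>auto intro!: mult_nonneg_nonneg plancherel_weight_nonneg\<close>)
  show "(\<lambda>(p, T). plancherel_weight \<alpha> p * C ^ card T) summable_on Sigma partitions (\<lambda>p. Pow (occupied L p))"
  proof (rule summable_on_SigmaI[OF _ 1])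
    fix p assume "p \<in> partitions"
    then have fin: "finite (occupied L p)" by (auto simp: partitions_def intro: finite_occupied)
    have "(\<Sum>T\<in>Pow (occupied L p). plancherel_weight \<alpha> p * C ^ card T) = plancherel_weight \<alpha> p * (1 + C) ^ card (occupied L p)"
      using prod_one_plus[OF fin, of "\<lambda>_. C"] by (simp flip: sum_distrib_left)
    then show "((\<lambda>T. case (p, T) of (p, T) \<Rightarrow> plancherel_weight \<alpha> p * C ^ card T) has_sum
        plancherel_weight \<alpha> p * (1 + C) ^ card (occupied L p)) (Pow (occupied L p))"
      using has_sum_finite[of "Pow (occupied L p)" "\<lambda>T. plancherel_weight \<alpha> p * C ^ card T"] fin by simp
  qed (use assms in \<open>auto intro!: mult_nonneg_nonneg plancherel_weight_nonneg\<close>)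
qed

lemma norm_prod_le_power:
  fixes \<phi> :: "'i \<Rightarrow> 'a :: {real_normed_field}"
  assumes "\<And>h. norm (\<phi> h) \<le> C"
  shows "norm (\<Prod>h\<in>T. \<phi> h) \<le> C ^ card T"
proof -
  have "norm (\<Prod>h\<in>T. \<phi> h) = (\<Prod>h\<in>T. norm (\<phi> h))"
    by (rule prod_norm[symmetric])
  also have "\<dots> \<le> (\<Prod>h\<in>T. C)" by (intro prod_mono) (use assms in auto)
  finally show ?thesis by simp
qed

text \<open>Fubini on the pairs of a partition \<open>p\<close> and a subset \<open>T\<close> of its
  occupied set: summing over \<open>T\<close> first gives the product of the factors
  \<open>1 + \<phi> h\<close>, and summing over \<open>p\<close> first gives \<open>rho\<close> at
  \<open>T\<close>.\<close>

lemma has_sum_correlation_expansion: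
  fixes \<phi> :: "nat \<Rightarrow> 'a :: {real_normed_field, banach}"
  assumes \<alpha>: "\<alpha> > 0" and \<phi>: "\<And>h. norm (\<phi> h) \<le> C"
  obtains S where "((\<lambda>p. of_real (plancherel_weight \<alpha> p) * (\<Prod>h\<in>occupied L p. 1 + \<phi> h)) has_sum S) partitions"
    "((\<lambda>T. (\<Prod>h\<in>T. \<phi> h) * of_real (rho \<alpha> L T)) has_sum S) {T. finite T}"
proof -
  let ?W = "plancherel_weight \<alpha>" and ?A = "Sigma partitions (\<lambda>p. Pow (occupied L p))"
  let ?v = "\<lambda>(p, T). of_real (?W p) * (\<Prod>h\<in>T. \<phi> h) :: 'a"
  have "C \<ge> 0" using order_trans[OF norm_ge_zero \<phi>] .
  have "?v summable_on ?A"
  proof (rule abs_summable_summable, rule Infinite_Sum.abs_summable_on_comparison_test)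
    show "(\<lambda>a. norm (case a of (p, T) \<Rightarrow> ?W p * C ^ card T)) summable_on ?A"
      using summable_occupied_subsets(1)[OF \<alpha> \<open>C \<ge> 0\<close>, of L] \<open>C \<ge> 0\<close> plancherel_weight_nonneg[OF \<alpha>]
      by (simp add: case_prod_unfold abs_mult)
    fix a show "norm (?v a) \<le> norm (case a of (p, T) \<Rightarrow> ?W p * C ^ card T)"
      using \<open>C \<ge> 0\<close> plancherel_weight_nonneg[OF \<alpha>] norm_prod_le_power[of \<phi> C, OF \<phi>]
      by (auto simp: case_prod_unfold norm_mult abs_mult intro!: mult_left_mono)
  qed
  then obtain S where S: "(?v has_sum S) ?A" by (auto simp: summable_on_def)
  show ?thesis
  proof (rule that)
    show "((\<lambda>p. of_real (?W p) * (\<Prod>h\<in>occupied L p. 1 + \<phi> h)) has_sum S) partitions"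
    proof (rule has_sum_SigmaD[OF S])
      fix p assume "p \<in> partitions"
      then have fin: "finite (occupied L p)" by (auto simp: partitions_def intro: finite_occupied)
      show "((\<lambda>T. ?v (p, T)) has_sum of_real (?W p) * (\<Prod>h\<in>occupied L p. 1 + \<phi> h)) (Pow (occupied L p))"
        using has_sum_finite[of "Pow (occupied L p)" "\<lambda>T. ?v (p, T)"] fin
        by (simp add: prod_one_plus sum_distrib_left)
    qed
    let ?B = "Sigma {T. finite T} (\<lambda>T. {p \<in> partitions. T \<subseteq> occupied L p})"
    have "bij_betw prod.swap ?B ?A"
      by (rule bij_betwI[where g = prod.swap]) (auto simp: partitions_def dest: finite_subset[OF _ finite_occupied])
    from has_sum_reindex_bij_betw[OF this, of ?v S] S
    have S': "((\<lambda>a. ?v (prod.swap a)) has_sum S) ?B" by simp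
    show "((\<lambda>T. (\<Prod>h\<in>T. \<phi> h) * of_real (rho \<alpha> L T)) has_sum S) {T. finite T}"
    proof (rule has_sum_SigmaD[OF S'])
      fix T
      have "((\<lambda>p. (\<Prod>h\<in>T. \<phi> h) * of_real (?W p)) has_sum (\<Prod>h\<in>T. \<phi> h) * of_real (rho \<alpha> L T)) {p \<in> partitions. T \<subseteq> occupied L p}"
        by (intro has_sum_cmult_right) (simp only: has_sum_of_real_iff has_sum_rho[OF \<alpha>])
      then show "((\<lambda>p. ?v (prod.swap (T, p))) has_sum (\<Prod>h\<in>T. \<phi> h) * of_real (rho \<alpha> L T)) {p \<in> partitions. T \<subseteq> occupied L p}"
        by (simp add: mult.commute)
    qed
  qed
qed

text \<open>The expansion applied to the constant function with value \<open>C\<close>.\<close>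

lemma summable_rho:
  assumes "\<alpha> > 0" "C \<ge> (0 :: real)"
  shows "(\<lambda>T. C ^ card T * rho \<alpha> L T) summable_on {T. finite T}"
proof (rule has_sum_correlation_expansion[OF assms(1), of "\<lambda>_. C" C L])
  fix S assume "((\<lambda>T. (\<Prod>h\<in>T. C) * of_real (rho \<alpha> L T)) has_sum S) {T. finite T}"
  then show ?thesis by (auto dest: has_sum_imp_summable)
qed (use assms in simp)

section \<open>From finite sets to tuples\<close>

lemma card_tuples_onto:
  assumes "finite T" "card T = k"
  shows "card {h \<in> {..<k} \<rightarrow>\<^sub>E UNIV. inj_on h {..<k} \<and> h ` {..<k} = T} = fact k"
    "finite {h \<in> {..<k} \<rightarrow>\<^sub>E UNIV. inj_on h {..<k} \<and> h ` {..<k} = T}"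
proof -
  have eq: "{h \<in> {..<k} \<rightarrow>\<^sub>E UNIV. inj_on h {..<k} \<and> h ` {..<k} = T} = {h \<in> {..<k} \<rightarrow>\<^sub>E T. inj_on h {..<k}}"
  proof (intro equalityI subsetI)
    fix h assume h: "h \<in> {h \<in> {..<k} \<rightarrow>\<^sub>E T. inj_on h {..<k}}"
    then have "h ` {..<k} = T"
      using assms by (intro card_subset_eq) (auto simp: card_image)
    then show "h \<in> {h \<in> {..<k} \<rightarrow>\<^sub>E UNIV. inj_on h {..<k} \<and> h ` {..<k} = T}"
      using h by auto
  qed auto
  show "card {h \<in> {..<k} \<rightarrow>\<^sub>E UNIV. inj_on h {..<k} \<and> h ` {..<k} = T} = fact k"
    unfolding eq using assms card_inj_on_subset_funcset[of "{..<k}" T "{..<k}"] by (simp add: fact_prod_rev)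
  show "finite {h \<in> {..<k} \<rightarrow>\<^sub>E UNIV. inj_on h {..<k} \<and> h ` {..<k} = T}"
    unfolding eq by (rule finite_subset[of _ "{..<k} \<rightarrow>\<^sub>E T"]) (auto intro: finite_PiE assms)
qed

text \<open>Every \<open>k\<close>-set is the image of \<open>k!\<close> injective tuples, which
  cancels \<open>1 / fact k\<close>, and tuples with a repetition contribute 0. Grouping the finite
  sets by cardinality gives the outer series.\<close>

lemma sums_over_tuples:
  fixes D :: "nat set \<Rightarrow> 'a :: {real_normed_field, banach}"
  assumes D: "(\<lambda>T. norm (D T)) summable_on {T. finite T}"
    and F: "\<And>k h. F k h = (if inj_on h {..<k} then D (h ` {..<k}) else 0)"
  shows "F k summable_on nat_tuples k"
    "(\<lambda>k. 1 / fact k * (\<Sum>\<^sub>\<infinity>h\<in>nat_tuples k. F k h)) sums (\<Sum>\<^sub>\<infinity>T\<in>{T. finite T}. D T)"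
proof -
  let ?S = "\<lambda>k. {T :: nat set. finite T \<and> card T = k}"
  let ?B = "\<lambda>k T. {h \<in> nat_tuples k. inj_on h {..<k} \<and> h ` {..<k} = T}"
  have sumD: "(\<lambda>T. norm (D T)) summable_on ?S k" for k
    by (rule summable_on_subset_banach[OF D]) auto
  have tuples: "(F k has_sum (fact k * infsum D (?S k))) (nat_tuples k)" for k
  proof -
    have bij: "bij_betw snd (Sigma (?S k) (?B k)) {h \<in> nat_tuples k. inj_on h {..<k}}"
      by (rule bij_betwI[where g = "\<lambda>h. (h ` {..<k}, h)"]) (auto simp: card_image)
    let ?G = "\<lambda>a. D (fst a)"
    have "(\<lambda>a. norm (?G a)) summable_on Sigma (?S k) (?B k)"
    proof (rule summable_on_SigmaI)
      show "(\<lambda>T. fact k * norm (D T)) summable_on ?S k"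
        by (intro summable_on_cmult_right sumD)
      fix T assume "T \<in> ?S k"
      then show "((\<lambda>h. norm (?G (T, h))) has_sum fact k * norm (D T)) (?B k T)"
        using has_sum_finite[of "?B k T" "\<lambda>_. norm (D T)"] card_tuples_onto[of T k] by simp
    qed simp
    then have "?G summable_on Sigma (?S k) (?B k)" by (rule abs_summable_summable)
    then obtain S where S: "(?G has_sum S) (Sigma (?S k) (?B k))" by (auto simp: summable_on_def)
    have "((\<lambda>T. fact k * D T) has_sum S) (?S k)"
    proof (rule has_sum_SigmaD[OF S])
      fix T assume "T \<in> ?S k"
      then show "((\<lambda>h. ?G (T, h)) has_sum fact k * D T) (?B k T)"
        using has_sum_finite[of "?B k T" "\<lambda>_. D T"] card_tuples_onto[of T k] by simp
    qed
    moreover have "((\<lambda>T. fact k * D T) has_sum (fact k * infsum D (?S k))) (?S k)"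
      by (intro has_sum_cmult_right has_sum_infsum abs_summable_summable[OF sumD])
    ultimately have S_eq: "S = fact k * infsum D (?S k)" by (rule has_sum_unique)
    have "((\<lambda>a. F k (snd a)) has_sum S) (Sigma (?S k) (?B k))"
      using S by (rule has_sum_cong[THEN iffD1, rotated]) (auto simp: F)
    then have "(F k has_sum S) {h \<in> nat_tuples k. inj_on h {..<k}}"
      by (subst (asm) has_sum_reindex_bij_betw[OF bij])
    then have "(F k has_sum S) (nat_tuples k)"
      by (subst has_sum_cong_neutral[where g = "F k" and T = "{h \<in> nat_tuples k. inj_on h {..<k}}"]) (auto simp: F)
    then show ?thesis by (simp only: S_eq)
  qed
  then show "F k summable_on nat_tuples k" by (rule has_sum_imp_summable)
  have bij: "bij_betw snd (Sigma UNIV ?S) {T :: nat set. finite T}"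
    by (rule bij_betwI[where g = "\<lambda>T. (card T, T)"]) auto
  have total: "(D has_sum infsum D {T. finite T}) {T. finite T}"
    by (intro has_sum_infsum abs_summable_summable[OF D])
  then have "((\<lambda>a. D (snd a)) has_sum infsum D {T. finite T}) (Sigma UNIV ?S)"
    by (subst has_sum_reindex_bij_betw[OF bij])
  then have "((\<lambda>k. infsum D (?S k)) has_sum infsum D {T. finite T}) UNIV"
    by (rule has_sum_SigmaD) (use abs_summable_summable[OF sumD] in simp)
  then have "(\<lambda>k. infsum D (?S k)) sums infsum D {T. finite T}" by (rule has_sum_imp_sums)
  then show "(\<lambda>k. 1 / fact k * (\<Sum>\<^sub>\<infinity>h\<in>nat_tuples k. F k h)) sums (\<Sum>\<^sub>\<infinity>T\<in>{T. finite T}. D T)"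
    by (simp add: infsumI[OF tuples])
qed

section \<open>The Fredholm determinant\<close>

lemma infsum_mult_le_sqrt:
  fixes q v :: "'x \<Rightarrow> real"
  assumes q: "(\<lambda>x. (q x)\<^sup>2) summable_on A" and v: "(\<lambda>x. (v x)\<^sup>2) summable_on A"
  shows "(\<lambda>x. norm (q x * v x)) summable_on A"
    "(\<Sum>\<^sub>\<infinity>x\<in>A. norm (q x * v x)) \<le> sqrt (\<Sum>\<^sub>\<infinity>x\<in>A. (q x)\<^sup>2) * sqrt (\<Sum>\<^sub>\<infinity>x\<in>A. (v x)\<^sup>2)"
proof -
  show 1: "(\<lambda>x. norm (q x * v x)) summable_on A"
  proof (rule summable_on_comparison_test[OF summable_on_add[OF q v]])
    fix x
    have "2 * (\<bar>q x\<bar> * \<bar>v x\<bar>) \<le> (q x)\<^sup>2 + (v x)\<^sup>2"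
      using sum_squares_bound[of "\<bar>q x\<bar>" "\<bar>v x\<bar>"] by simp
    moreover have "0 \<le> \<bar>q x\<bar> * \<bar>v x\<bar>" by simp
    ultimately show "norm (q x * v x) \<le> (q x)\<^sup>2 + (v x)\<^sup>2"
      unfolding real_norm_def abs_mult by linarith
  qed simp
  show "(\<Sum>\<^sub>\<infinity>x\<in>A. norm (q x * v x)) \<le> sqrt (\<Sum>\<^sub>\<infinity>x\<in>A. (q x)\<^sup>2) * sqrt (\<Sum>\<^sub>\<infinity>x\<in>A. (v x)\<^sup>2)"
  proof (rule infsum_le_finite_sums[OF 1])
    fix F assume F: "finite F" "F \<subseteq> A"
    have "(\<Sum>x\<in>F. norm (q x * v x)) \<le> sqrt (\<Sum>x\<in>F. (q x)\<^sup>2) * sqrt (\<Sum>x\<in>F. (v x)\<^sup>2)"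
      using L2_set_mult_ineq[of q v F] by (simp add: abs_mult L2_set_def)
    also have "\<dots> \<le> sqrt (\<Sum>\<^sub>\<infinity>x\<in>A. (q x)\<^sup>2) * sqrt (\<Sum>\<^sub>\<infinity>x\<in>A. (v x)\<^sup>2)"
      by (intro mult_mono real_sqrt_le_mono finite_sum_le_infsum q v F) (auto intro: sum_nonneg infsum_nonneg)
    finally show "(\<Sum>x\<in>F. norm (q x * v x)) \<le> \<dots>" .
  qed
qed

lemma ell2_iff: "u \<in> ell2 \<longleftrightarrow> (\<lambda>n. (cmod (u n))\<^sup>2) summable_on UNIV"
  by (simp add: ell2_def summable_on_UNIV_nonneg_real_iff)

lemma ell2_norm_eq:
  assumes "u \<in> ell2"
  shows "ell2_norm u = sqrt (\<Sum>\<^sub>\<infinity>n. (cmod (u n))\<^sup>2)"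
proof -
  have "(\<lambda>n. (cmod (u n))\<^sup>2) sums (\<Sum>\<^sub>\<infinity>n. (cmod (u n))\<^sup>2)"
    using assms unfolding ell2_iff by (intro has_sum_imp_sums has_sum_infsum)
  then show ?thesis by (simp add: ell2_norm_def sums_iff)
qed

text \<open>The kernel is dominated by a rank-one kernel with a square summable \<open>q\<close>, so
  Cauchy-Schwarz bounds the operator norm by \<open>C\<close> times the squared norm of
  \<open>q\<close>.\<close>

lemma bounded_ell2_kernelI:
  assumes q: "(\<lambda>x. (q x)\<^sup>2) summable_on UNIV" and K: "\<And>x y. cmod (K x y) \<le> C * (q x * q y)" and C: "C \<ge> 0"
  shows "bounded_ell2_kernel K"
  unfolding bounded_ell2_kernel_def
proof (intro conjI ballI allI exI)
  define Q where "Q = (\<Sum>\<^sub>\<infinity>x. (q x)\<^sup>2)"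
  have Q0: "Q \<ge> 0" by (simp add: Q_def infsum_nonneg)
  fix u x assume u: "u \<in> ell2"
  have v: "(\<lambda>n. (cmod (u n))\<^sup>2) summable_on UNIV"
    using u by (simp add: ell2_iff)
  note cs = infsum_mult_le_sqrt[OF q v]
  have le: "cmod (K x y * u y) \<le> C * \<bar>q x\<bar> * norm (q y * cmod (u y))" for x y
  proof -
    have "C * (q x * q y) \<le> C * (\<bar>q x\<bar> * \<bar>q y\<bar>)"
      using C by (intro mult_left_mono) (simp_all flip: abs_mult)
    from mult_right_mono[OF order_trans[OF K this], of "cmod (u y)"] show ?thesis
      by (simp add: norm_mult abs_mult mult_ac)
  qed
  have sum_abs: "(\<lambda>y. cmod (K x y * u y)) summable_on UNIV" for x
    by (rule summable_on_comparison_test[OF summable_on_cmult_right[OF cs(1)] le]) simp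
  then show "(\<lambda>y. K x y * u y) summable_on UNIV" by (rule abs_summable_summable)
  have bound: "(cmod (kernel_operator K u x))\<^sup>2 \<le> (C * sqrt Q * ell2_norm u)\<^sup>2 * (q x)\<^sup>2" for x
  proof -
    have "cmod (kernel_operator K u x) \<le> (\<Sum>\<^sub>\<infinity>y. cmod (K x y * u y))"
      unfolding kernel_operator_def by (rule norm_infsum_bound[OF sum_abs])
    also have "\<dots> \<le> (\<Sum>\<^sub>\<infinity>y. C * \<bar>q x\<bar> * norm (q y * cmod (u y)))"
      by (rule infsum_mono[OF sum_abs summable_on_cmult_right[OF cs(1)] le])
    also have "\<dots> = C * \<bar>q x\<bar> * (\<Sum>\<^sub>\<infinity>y. norm (q y * cmod (u y)))"
      by (rule infsum_cmult_right')
    also have "\<dots> \<le> C * \<bar>q x\<bar> * (sqrt Q * ell2_norm u)"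
      unfolding Q_def ell2_norm_eq[OF u] using C by (intro mult_left_mono cs(2)) simp
    finally have "(cmod (kernel_operator K u x))\<^sup>2 \<le> (C * \<bar>q x\<bar> * (sqrt Q * ell2_norm u))\<^sup>2"
      by (intro power_mono) auto
    then show ?thesis by (simp add: power_mult_distrib mult_ac)
  qed
  have summ: "(\<lambda>x. (C * sqrt Q * ell2_norm u)\<^sup>2 * (q x)\<^sup>2) summable_on UNIV"
    by (rule summable_on_cmult_right[OF q])
  have summ': "(\<lambda>x. (cmod (kernel_operator K u x))\<^sup>2) summable_on UNIV"
    by (rule summable_on_comparison_test[OF summ bound]) simp
  then show ell2: "kernel_operator K u \<in> ell2" by (simp add: ell2_iff)
  have "(\<Sum>\<^sub>\<infinity>x. (cmod (kernel_operator K u x))\<^sup>2) \<le> (\<Sum>\<^sub>\<infinity>x. (C * sqrt Q * ell2_norm u)\<^sup>2 * (q x)\<^sup>2)"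
    by (rule infsum_mono[OF summ' summ bound])
  also have "\<dots> = (C * sqrt Q * ell2_norm u)\<^sup>2 * Q"
    unfolding Q_def by (rule infsum_cmult_right')
  also have "\<dots> = (C * Q * ell2_norm u)\<^sup>2"
    using Q0 by (simp add: power_mult_distrib power2_eq_square)
  finally have "ell2_norm (kernel_operator K u) \<le> sqrt ((C * Q * ell2_norm u)\<^sup>2)"
    unfolding ell2_norm_eq[OF ell2] by (rule real_sqrt_le_mono)
  also have "\<dots> = C * Q * ell2_norm u"
    using C Q0 ell2_norm_eq[OF u] by (simp add: infsum_nonneg)
  finally show "ell2_norm (kernel_operator K u) \<le> C * (\<Sum>\<^sub>\<infinity>x. (q x)\<^sup>2) * ell2_norm u"
    by (simp only: Q_def)
qed

lemma kernel_operator_unit_seq: "kernel_operator K (unit_seq n) x = K x n"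
proof -
  have "kernel_operator K (unit_seq n) x = (\<Sum>\<^sub>\<infinity>y\<in>{n}. K x y)"
    unfolding kernel_operator_def by (rule infsum_cong_neutral) (auto simp: unit_seq_def)
  then show ?thesis by simp
qed

lemma bes_kernel_commute: "bes_kernel s x y = bes_kernel s y x"
  by (simp add: bes_kernel_def mult.commute)

text \<open>For distinct points the nonnegative number \<open>rho \<alpha> L {x, y}\<close> is the 2
  x 2 minor of a symmetric kernel, that is, the product of the diagonal values minus the square of
  the off-diagonal one.\<close>

lemma discrete_Bessel_kernel_le:
  assumes "\<alpha> > 0"
  shows "\<bar>discrete_Bessel_kernel \<alpha> (int x - int L) (int y - int L)\<bar> \<le> sqrt (rho \<alpha> L {x}) * sqrt (rho \<alpha> L {y})"
proof -
  let ?B = "\<lambda>x y. discrete_Bessel_kernel \<alpha> (int x - int L) (int y - int L)"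
  have diag: "rho \<alpha> L {x} = ?B x x" for x
    using rho_eq_det[OF assms, of "{x}" L] by simp
  show ?thesis
  proof (cases "x = y")
    case True
    then show ?thesis
      using rho_nonneg[OF assms, of L "{x}"] by (simp add: diag)
  next
    case False
    have "?B y x = ?B x y"
      using assms by (simp add: discrete_Bessel_kernel_eq bes_kernel_commute)
    then have "rho \<alpha> L {x, y} = rho \<alpha> L {x} * rho \<alpha> L {y} - (?B x y)\<^sup>2"
      using rho_eq_det[OF assms, of "{x, y}" L] False by (simp add: det_on_pair diag power2_eq_square)
    then have "(?B x y)\<^sup>2 \<le> rho \<alpha> L {x} * rho \<alpha> L {y}"
      using rho_nonneg[OF assms, of L "{x, y}"] by simp
    then have "sqrt ((?B x y)\<^sup>2) \<le> sqrt (rho \<alpha> L {x} * rho \<alpha> L {y})"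
      by (rule real_sqrt_le_mono)
    then show ?thesis by (simp add: real_sqrt_mult)
  qed
qed

text \<open>The singletons form a part of the convergent sum over all finite sets at
  \<open>C = 1\<close>. By \<open>rho_eq_det\<close> the terms are the diagonal values of the
  shifted Bessel kernel, so its trace is finite.\<close>

lemma summable_rho_singleton:
  assumes "\<alpha> > 0"
  shows "(\<lambda>x. rho \<alpha> L {x}) summable_on UNIV"
proof -
  have "(\<lambda>T. 1 ^ card T * rho \<alpha> L T) summable_on range (\<lambda>x. {x})"
    by (rule summable_on_subset_banach[OF summable_rho[OF assms]]) auto
  then show ?thesis by (subst (asm) summable_on_reindex) (auto simp: inj_on_def o_def)
qed

lemma poissonized_plancherel_integral:
  fixes g :: "(nat \<Rightarrow> nat) \<Rightarrow> complex"
  assumes \<alpha>: "\<alpha> > 0" and g: "(\<lambda>p. norm (of_real (plancherel_weight \<alpha> p) * g p)) summable_on partitions"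
  shows "integrable (poissonized_plancherel \<alpha>) g"
    "(\<integral>p. g p \<partial>poissonized_plancherel \<alpha>) = (\<Sum>\<^sub>\<infinity>p\<in>partitions. of_real (plancherel_weight \<alpha> p) * g p)"
proof -
  have M: "poissonized_plancherel \<alpha> = density (count_space partitions) (\<lambda>p. ennreal (plancherel_weight \<alpha> p))"
    by (simp add: poissonized_plancherel_def point_measure_def partitions_def)
  have W: "AE p in count_space partitions. 0 \<le> plancherel_weight \<alpha> p"
    using plancherel_weight_nonneg[OF \<alpha>] by simp
  have "Infinite_Set_Sum.abs_summable_on (\<lambda>p. of_real (plancherel_weight \<alpha> p) * g p) partitions"
    using g unfolding abs_summable_equivalent .
  then have int: "integrable (count_space partitions) (\<lambda>p. plancherel_weight \<alpha> p *\<^sub>R g p)"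
    by (simp add: Infinite_Set_Sum.abs_summable_on_def scaleR_conv_of_real)
  then show "integrable (poissonized_plancherel \<alpha>) g"
    unfolding M by (subst integrable_density[OF _ _ W]) auto
  have "(\<integral>p. g p \<partial>poissonized_plancherel \<alpha>) = (\<integral>p. plancherel_weight \<alpha> p *\<^sub>R g p \<partial>count_space partitions)"
    unfolding M by (subst integral_density[OF _ _ W]) auto
  also have "\<dots> = infsetsum (\<lambda>p. of_real (plancherel_weight \<alpha> p) * g p) partitions"
    by (simp add: infsetsum_def scaleR_conv_of_real)
  also have "\<dots> = (\<Sum>\<^sub>\<infinity>p\<in>partitions. of_real (plancherel_weight \<alpha> p) * g p)"
    using g by (intro infsetsum_infsum) (simp only: abs_summable_equivalent[symmetric])
  finally show "(\<integral>p. g p \<partial>poissonized_plancherel \<alpha>) = (\<Sum>\<^sub>\<infinity>p\<in>partitions. of_real (plancherel_weight \<alpha> p) * g p)" .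
qed

lemma det_on_of_real: "det_on S (\<lambda>i j. of_real (A i j)) = of_real (det_on S A)"
  by (simp add: det_on_def)

theorem theorem1p3:
  fixes L :: nat and \<alpha> :: real and f :: "int \<Rightarrow> complex"
    and g :: "(nat \<Rightarrow> nat) \<Rightarrow> complex" and \<phi> :: "int \<Rightarrow> complex"
    and F :: "nat \<Rightarrow> (nat \<Rightarrow> nat) \<Rightarrow> complex" and K :: "nat \<Rightarrow> nat \<Rightarrow> complex"
  assumes "\<alpha> > 0"
    and "bounded (range f)"
    and "\<And>n. n < 0 \<Longrightarrow> f n = 1"
    and "\<And>p. is_partition p \<Longrightarrow> g p = (\<Prod>i. f (int (p i) + int L - int (Suc i)))"
    and "\<And>n. \<phi> n = f n - 1"
    and "\<And>k h. F k h = (\<Prod>j<k. \<phi> (int (h j))) *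
           Determinant.det (Matrix.mat k k (\<lambda>(i, j). complex_of_real
             (discrete_Bessel_kernel \<alpha> (int (h i) - int L) (int (h j) - int L))))"
    and "\<And>x y. K x y =
           complex_of_real (discrete_Bessel_kernel \<alpha> (int x - int L) (int y - int L)) * \<phi> (int y)"
  shows "integrable (poissonized_plancherel \<alpha>) g \<and>
         (\<forall>k. F k summable_on nat_tuples k) \<and>
         (\<lambda>k. 1 / fact k * (\<Sum>\<^sub>\<infinity>h\<in>nat_tuples k. F k h)) sums
           (\<integral>p. g p \<partial>poissonized_plancherel \<alpha>) \<and>
         bounded_ell2_kernel K \<and>
         (\<integral>p. g p \<partial>poissonized_plancherel \<alpha>) = fredholm_det (kernel_operator K)"
proof -
  obtain B where B: "\<And>n. cmod (f n) \<le> B"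
    using assms(2) by (auto simp: bounded_iff)
  define C where "C = B + 1"
  have C: "cmod (\<phi> n) \<le> C" for n
    unfolding assms(5) C_def by (intro norm_triangle_le_diff add_mono B) auto
  have "C \<ge> 0" using order_trans[OF norm_ge_zero C] .
  let ?W = "plancherel_weight \<alpha>" and ?\<phi> = "\<lambda>h :: nat. \<phi> (int h)"
  let ?K = "\<lambda>i j. discrete_Bessel_kernel \<alpha> (int i - int L) (int j - int L)"
  let ?D = "\<lambda>T. (\<Prod>h\<in>T. ?\<phi> h) * complex_of_real (rho \<alpha> L T)"

  have g: "g p = (\<Prod>h\<in>occupied L p. 1 + ?\<phi> h)" if "p \<in> partitions" for p
  proof -
    have p: "is_partition p" using that by (simp add: partitions_def)
    have "g p = (\<Prod>i. f (part_pos p i + int L))"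
      unfolding assms(4)[OF p] by (simp add: part_pos_def algebra_simps)
    also have "\<dots> = (\<Prod>h\<in>occupied L p. f (int h))"
      by (rule prodinf_positions[OF p]) (rule assms(3))
    finally show ?thesis by (simp add: assms(5))
  qed
  have summable_g: "(\<lambda>p. norm (of_real (?W p) * g p)) summable_on partitions"
  proof (rule summable_on_comparison_test[OF summable_occupied_subsets(2)[OF assms(1) \<open>C \<ge> 0\<close>, of L]])
    fix p assume p: "p \<in> partitions"
    have "norm (1 + ?\<phi> h) \<le> 1 + C" for h
      using norm_triangle_le[of 1 "?\<phi> h" "1 + C"] C[of "int h"] by simp
    from norm_prod_le_power[of "\<lambda>h. 1 + ?\<phi> h", OF this, of "occupied L p"]
    show "norm (of_real (?W p) * g p) \<le> ?W p * (1 + C) ^ card (occupied L p)"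
      using plancherel_weight_nonneg[OF assms(1), of p] by (simp add: g[OF p] norm_mult mult_left_mono)
  qed simp
  note integral = poissonized_plancherel_integral[OF assms(1) summable_g]

  obtain S where S: "((\<lambda>p. of_real (?W p) * (\<Prod>h\<in>occupied L p. 1 + ?\<phi> h)) has_sum S) partitions"
    "(?D has_sum S) {T. finite T}"
    using has_sum_correlation_expansion[of \<alpha> ?\<phi> C L] assms(1) C by blast
  have "((\<lambda>p. of_real (?W p) * g p) has_sum S) partitions"
    using S(1) by (rule has_sum_cong[THEN iffD1, rotated]) (simp add: g)
  then have E: "(\<integral>p. g p \<partial>poissonized_plancherel \<alpha>) = S"
    unfolding integral(2) by (rule infsumI)

  have summable_D: "(\<lambda>T. norm (?D T)) summable_on {T. finite T}"
  proof (rule summable_on_comparison_test[OF summable_rho[OF assms(1) \<open>C \<ge> 0\<close>, of L]])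
    fix T
    show "norm (?D T) \<le> C ^ card T * rho \<alpha> L T"
      using rho_nonneg[OF assms(1), of L T] norm_prod_le_power[of ?\<phi> C T] C
      by (simp add: norm_mult mult_right_mono)
  qed simp
  \<comment> \<open>A repetition in \<open>h\<close> makes two rows equal. For an injective tuple
    the summand depends on the image alone, so the sum over tuples reduces to one over finite
    sets.\<close>
  have F: "F k h = (if inj_on h {..<k} then ?D (h ` {..<k}) else 0)" for k h
  proof -
    have det: "Determinant.det (Matrix.mat k k (\<lambda>(i, j). complex_of_real (?K (h i) (h j)))) =
        complex_of_real (det_on {..<k} (\<lambda>i j. ?K (h i) (h j)))"
      by (simp only: det_mat_eq_det_on det_on_of_real)
    show ?thesis
    proof (cases "inj_on h {..<k}")
      case True
      then have "bij_betw h {..<k} (h ` {..<k})" by (simp add: bij_betw_def)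
      then have "det_on {..<k} (\<lambda>i j. ?K (h i) (h j)) = rho \<alpha> L (h ` {..<k})"
        using det_on_reindex[of h "{..<k}" "h ` {..<k}" ?K] rho_eq_det[OF assms(1), of "h ` {..<k}" L] by simp
      then show ?thesis
        unfolding assms(6) det using True by (simp add: prod.reindex)
    next
      case False
      then obtain i j where "i < k" "j < k" "i \<noteq> j" "h i = h j"
        unfolding inj_on_def by blast
      then have "det_on {..<k} (\<lambda>i j. ?K (h i) (h j)) = 0"
        by (intro det_on_identical_rows[of i j]) auto
      then show ?thesis
        unfolding assms(6) det using False by simp
    qed
  qed
  have sums: "(\<lambda>k. 1 / fact k * (\<Sum>\<^sub>\<infinity>h\<in>nat_tuples k. F k h)) sums S"
    using sums_over_tuples(2)[OF summable_D F] unfolding infsumI[OF S(2)] .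

  \<comment> \<open>The comparison sequence is the square root of the one-point function, which is
    square summable because the trace is finite.\<close>
  have "bounded_ell2_kernel K"
  proof (rule bounded_ell2_kernelI)
    show "(\<lambda>x. (sqrt (rho \<alpha> L {x}))\<^sup>2) summable_on UNIV"
      using summable_rho_singleton[OF assms(1), of L] rho_nonneg[OF assms(1)] by simp
    show "cmod (K x y) \<le> C * (sqrt (rho \<alpha> L {x}) * sqrt (rho \<alpha> L {y}))" for x y
    proof -
      have "cmod (K x y) = cmod (\<phi> (int y)) * \<bar>?K x y\<bar>"
        by (simp add: assms(7) norm_mult)
      also have "\<dots> \<le> C * (sqrt (rho \<alpha> L {x}) * sqrt (rho \<alpha> L {y}))"
        by (rule mult_mono[OF C discrete_Bessel_kernel_le[OF assms(1)] \<open>C \<ge> 0\<close>]) simp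
      finally show ?thesis .
    qed
  qed fact
  moreover have "fredholm_det (kernel_operator K) = S"
  proof -
    \<comment> \<open>Column \<open>j\<close> contains the factor \<open>\<phi> (int (h j))\<close>
      throughout; pulling it out of every column yields the product in \<open>F\<close>.\<close>
    have "Determinant.det (Matrix.mat k k (\<lambda>(i, j). K (h i) (h j))) = F k h" for k h
      unfolding assms(6,7) det_mat_eq_det_on by (rule det_on_mult_right)
    then show ?thesis
      unfolding fredholm_det_def kernel_operator_unit_seq using sums by (simp add: sums_iff)
  qed
  ultimately show ?thesis
    using integral(1) sums_over_tuples(1)[OF summable_D F] sums E by simp
qed

end
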